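(* Assume (E) (stated in the context). Let $B_\rho(a)\subset\mathbb{R}^d$ denote the ball of radius $\rho$ centred at $a$, and $B_\rho=B_\rho(0)$. (i) There exist positive real numbers $c$ and $t_0$, uniform in $x_0$, such that for all $0<t\le t_0$ and all $y^0$ with $|y^0|\le \frac{c}{t}$ the mapping $$(q_0,p^0)\longmapsto (X,Y)(t,x_0,y^0,q_0,p^0)$$ defined on the polydisc $B_{c^2/t^2}\times B_{c^3/t^3}$ is a diffeomorphism onto its image. (ii) There exists $r>0$ such that, after reducing $c$ and $t_0$ if necessary, the image of the diffeomorphism in (i) contains the polydisc $B_r(\tilde x(t))\times B_{r/t}(\tilde y(t))$, where $(\tilde x(t),\tilde y(t))=(X,Y)(t,x_0,y^0,0,0)$.
   Context: $M$ is a compact $d$-dimensional Riemannian manifold; we work in local coordinates $(x,y)\in\mathbb{R}^d\times\mathbb{R}^d$ on $T^*M$. $g(x)=(g_{ij}(x))$ is the smooth positive definite matrix of the metric in these coordinates and $G(x)=g(x)^{-1}$; $g$, $G$ and their derivatives are bounded. $(\cdot,\cdot)$ is the Euclidean inner product, and $(\frac{\partial}{\partial x}(G(x)y,y),q)=\sum_i q^i\,\frac{\partial}{\partial x^i}(G(x)y,y)$. The Hamiltonian is $$H(x,y,q,p)=\tfrac12 (g(x)q,q)-(G(x)y,p)+\tfrac12\Big(\tfrac{\partial}{\partial x}(G(x)y,y),q\Big),$$ where $p$ is conjugate to $x$ and $q$ is conjugate to $y$. The Hamiltonian system is $$\dot x=\frac{\partial H}{\partial p},\quad \dot y=\frac{\partial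 H}{\partial q},\quad \dot q=-\frac{\partial H}{\partial y},\quad \dot p=-\frac{\partial H}{\partial x},$$ with initial condition $x(0)=x_0$, $y(0)=y^0$, $q(0)=q_0$, $p(0)=p^0$. Its flow is denoted $(X,Y,Q,P)(t,x_0,y^0,q_0,p^0)$. Assumption (E): there are constants $t_0,c_0>0$ such that for all $c\in(0,c_0]$ and $t\in(0,t_0]$ the solution of the Hamiltonian system exists on $[0,t]$ whenever $|y^0|\le \frac{c}{t}$, $|q_0|\le\frac{c^2}{t^2}$, $|p^0|\le\frac{c^3}{t^3}$, with $x_0$ arbitrary. *)

theory Defs
  imports "HOL-Analysis.Analysis"
begin

primrec iter_deriv ::
  "'a::euclidean_space list \<Rightarrow> ('a \<Rightarrow> 'b::real_normed_vector) \<Rightarrow> 'a \<Rightarrow> 'b" where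
  "iter_deriv [] f = f"
| "iter_deriv (v # vs) f = (\<lambda>x. frechet_derivative (iter_deriv vs f) (at x) v)"

(* C-infinity, meant for open S: all iterated directional derivatives are differentiable at every
   point of S, hence also continuous there. *)
definition smooth_on ::
  "'a::euclidean_space set \<Rightarrow> ('a \<Rightarrow> 'b::real_normed_vector) \<Rightarrow> bool" where
  "smooth_on S f \<longleftrightarrow> (\<forall>vs. \<forall>x\<in>S. iter_deriv vs f differentiable (at x))"

definition bounded_derivs :: "('a::euclidean_space \<Rightarrow> 'b::real_normed_vector) \<Rightarrow> bool" where
  "bounded_derivs f \<longleftrightarrow> (\<forall>vs. bounded (range (iter_deriv vs f)))"

(* For open S; the values of inv_into outside the open set f ` S play no role. *)
definition diffeo_onto_image ::
  "'a::euclidean_space set \<Rightarrow> ('a \<Rightarrow> 'b::euclidean_space) \<Rightarrow> bool" where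
  "diffeo_onto_image S f \<longleftrightarrow>
     inj_on f S \<and> open (f ` S) \<and> smooth_on S f \<and> smooth_on (f ` S) (inv_into S f)"

definition pos_def_matrix :: "real^'n^'n \<Rightarrow> bool" where
  "pos_def_matrix A \<longleftrightarrow> transpose A = A \<and> (\<forall>v. v \<noteq> 0 \<longrightarrow> (A *v v) \<bullet> v > 0)"

definition grad :: "(real^'n \<Rightarrow> real) \<Rightarrow> real^'n \<Rightarrow> real^'n" where
  "grad f x = (\<chi> i. frechet_derivative f (at x) (axis i 1))"

definition ham ::
  "(real^'n \<Rightarrow> real^'n^'n) \<Rightarrow> real^'n \<Rightarrow> real^'n \<Rightarrow> real^'n \<Rightarrow> real^'n \<Rightarrow> real" where
  "ham g x y q p =
     1/2 * ((g x *v q) \<bullet> q)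
     - (matrix_inv (g x) *v y) \<bullet> p
     + 1/2 * (grad (\<lambda>\<xi>. (matrix_inv (g \<xi>) *v y) \<bullet> y) x \<bullet> q)"

definition ham_solution ::
  "(real^'n \<Rightarrow> real^'n^'n) \<Rightarrow> real \<Rightarrow> (real \<Rightarrow> real^'n) \<Rightarrow> (real \<Rightarrow> real^'n)
     \<Rightarrow> (real \<Rightarrow> real^'n) \<Rightarrow> (real \<Rightarrow> real^'n) \<Rightarrow> bool" where
  "ham_solution g T x y q p \<longleftrightarrow> (\<forall>s\<in>{0..T}.
     (x has_vector_derivative grad (\<lambda>\<pi>. ham g (x s) (y s) (q s) \<pi>) (p s)) (at s within {0..T}) \<and>
     (y has_vector_derivative grad (\<lambda>\<kappa>. ham g (x s) (y s) \<kappa> (p s)) (q s)) (at s within {0..T}) \<and>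
     (q has_vector_derivative - grad (\<lambda>\<eta>. ham g (x s) \<eta> (q s) (p s)) (y s)) (at s within {0..T}) \<and>
     (p has_vector_derivative - grad (\<lambda>\<xi>. ham g \<xi> (y s) (q s) (p s)) (x s)) (at s within {0..T}))"

definition ham_reaches ::
  "(real^'n \<Rightarrow> real^'n^'n) \<Rightarrow> real \<Rightarrow> real^'n \<Rightarrow> real^'n \<Rightarrow> real^'n \<Rightarrow> real^'n
     \<Rightarrow> (real^'n) \<times> (real^'n) \<times> (real^'n) \<times> (real^'n) \<Rightarrow> bool" where
  "ham_reaches g t x0 y0 q0 p0 z \<longleftrightarrow> (\<exists>x y q p. ham_solution g t x y q p \<and>
     x 0 = x0 \<and> y 0 = y0 \<and> q 0 = q0 \<and> p 0 = p0 \<and> z = (x t, y t, q t, p t))"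

definition ham_exists ::
  "(real^'n \<Rightarrow> real^'n^'n) \<Rightarrow> real \<Rightarrow> real^'n \<Rightarrow> real^'n \<Rightarrow> real^'n \<Rightarrow> real^'n \<Rightarrow> bool" where
  "ham_exists g t x0 y0 q0 p0 \<longleftrightarrow> (\<exists>x y q p. ham_solution g t x y q p \<and>
     x 0 = x0 \<and> y 0 = y0 \<and> q 0 = q0 \<and> p 0 = p0)"

(* Only meaningful when ham_exists holds; the end point is then unique for smooth g. *)
definition ham_flow ::
  "(real^'n \<Rightarrow> real^'n^'n) \<Rightarrow> real \<Rightarrow> real^'n \<Rightarrow> real^'n \<Rightarrow> real^'n \<Rightarrow> real^'n
     \<Rightarrow> (real^'n) \<times> (real^'n) \<times> (real^'n) \<times> (real^'n)" where
  "ham_flow g t x0 y0 q0 p0 = (THE z. ham_reaches g t x0 y0 q0 p0 z)"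

definition flow_X ::
  "(real^'n \<Rightarrow> real^'n^'n) \<Rightarrow> real \<Rightarrow> real^'n \<Rightarrow> real^'n \<Rightarrow> real^'n \<Rightarrow> real^'n \<Rightarrow> real^'n" where
  "flow_X g t x0 y0 q0 p0 = fst (ham_flow g t x0 y0 q0 p0)"

definition flow_Y ::
  "(real^'n \<Rightarrow> real^'n^'n) \<Rightarrow> real \<Rightarrow> real^'n \<Rightarrow> real^'n \<Rightarrow> real^'n \<Rightarrow> real^'n \<Rightarrow> real^'n" where
  "flow_Y g t x0 y0 q0 p0 = fst (snd (ham_flow g t x0 y0 q0 p0))"

definition assumption_E :: "(real^'n \<Rightarrow> real^'n^'n) \<Rightarrow> bool" where
  "assumption_E g \<longleftrightarrow> (\<exists>t0>0. \<exists>c0>0. \<forall>c\<in>{0<..c0}. \<forall>t\<in>{0<..t0}. \<forall>x0 y0 q0 p0.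
     norm y0 \<le> c / t \<and> norm q0 \<le> c^2 / t^2 \<and> norm p0 \<le> c^3 / t^3
       \<longrightarrow> ham_exists g t x0 y0 q0 p0)"

definition polydisc :: "real \<Rightarrow> real \<Rightarrow> ((real^'n) \<times> (real^'n)) set" where
  "polydisc c t = ball 0 (c^2 / t^2) \<times> ball 0 (c^3 / t^3)"

definition XY_map ::
  "(real^'n \<Rightarrow> real^'n^'n) \<Rightarrow> real \<Rightarrow> real^'n \<Rightarrow> real^'n
     \<Rightarrow> (real^'n) \<times> (real^'n) \<Rightarrow> (real^'n) \<times> (real^'n)" where
  "XY_map g t x0 y0 = (\<lambda>(q0, p0). (flow_X g t x0 y0 q0 p0, flow_Y g t x0 y0 q0 p0))"

(* The existence clause says that the map really is defined on the whole polydisc. *)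
definition diffeo_property :: "(real^'n \<Rightarrow> real^'n^'n) \<Rightarrow> real \<Rightarrow> real \<Rightarrow> bool" where
  "diffeo_property g c t0 \<longleftrightarrow> (\<forall>x0 t y0. 0 < t \<and> t \<le> t0 \<and> norm y0 \<le> c / t \<longrightarrow>
     (\<forall>(q0, p0) \<in> polydisc c t. ham_exists g t x0 y0 q0 p0) \<and>
     diffeo_onto_image (polydisc c t) (XY_map g t x0 y0))"

end

theory Submission
  imports Defs
begin

text \<open>
  The Hamiltonian is polynomial in \<open>(y, q, p)\<close> and quasi-homogeneous: if \<open>y\<close>, \<open>q\<close>, \<open>p\<close> have weights
  \<open>1\<close>, \<open>2\<close>, \<open>3\<close>, then the components of its vector field \<open>V\<close> have weights \<open>1\<close>, \<open>2\<close>, \<open>3\<close>, \<open>4\<close>. Hence a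
  solution on \<open>[0, \<delta>]\<close> that starts at \<open>(x, \<tau> y, \<tau>\<^sup>2 q, \<tau>\<^sup>3 p)\<close> turns into a solution on \<open>[0, \<tau> \<delta>]\<close> that
  starts at \<open>(x, y, q, p)\<close>. The polydiscs in the theorem have exactly these weights, so time \<open>t\<close> with
  parameter \<open>c\<close> is equivalent to one fixed time \<open>\<delta>\<close> with data of size \<open>\<rho> = c / \<delta>\<close>, whatever \<open>t\<close> is. Only
  this normalised situation needs analysis, with bounds uniform in \<open>x\<close>, which are available
  because \<open>V\<close> and all its derivatives are bounded on \<open>{|y|, |q|, |p| < 2}\<close>.

  Fix \<open>\<delta>\<close> so small that the Picard map on curves over \<open>[0, \<delta>]\<close> is a contraction. The points
  \<open>(x, 0, 0, 0)\<close> are equilibria, and the linearised system there is nilpotent, so that its flow is explicit; the part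
  \<open>(q\<^sub>0, p\<^sub>0) \<mapsto> (x, y)\<close> of it at time \<open>\<delta>\<close> is the block matrix with rows \<open>(-\<delta>\<^sup>2/2, -\<delta>\<^sup>3/6 G)\<close> and \<open>(\<delta> g, \<delta>\<^sup>2/2)\<close>,
  which is invertible with a bound independent of \<open>x\<close> (\<open>lin_endpoint_inv_bound\<close>). For data of size
  \<open>\<rho>\<close> the true endpoint map differs from this isomorphism by a map with Lipschitz constant \<open>O(\<rho>)\<close>
  (\<open>endpoint_close_to_linear\<close>). For small \<open>\<rho>\<close> it therefore expands distances up to a factor, so that
  it is injective, its derivative is invertible and, by a contraction argument, its image contains a
  ball about the image of \<open>0\<close> (\<open>perturbed_linear_expanding\<close>, \<open>perturbed_linear_image_contains_ball\<close>).

  Smoothness has two sources. The flow is a smooth function of the initial value (\<open>smooth_bdd_sol\<close>):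
  its derivative is the resolvent of a linearised integral operator on the space of curves, and
  derivatives of resolvents are again products of resolvents, so differentiability of order \<open>k\<close>
  reproduces itself at order \<open>k + 1\<close>. The inverse of an expanding smooth map is smooth
  (\<open>diffeo_onto_image_if_expanding\<close>) by the same mechanism, with the inverse of the derivative in
  place of the resolvent.
\<close>

section \<open>Functions with bounded derivatives\<close>

text \<open>
  The class \<open>C\<^sub>b\<^sup>k\<close>. The recursion uses directional derivatives only, so that all orders of
  differentiation keep the same value type and statements about all \<open>k\<close> can be proved by induction.
\<close>
primrec Cb :: "nat \<Rightarrow> 'a::euclidean_space set \<Rightarrow> ('a \<Rightarrow> 'b::real_normed_vector) \<Rightarrow> bool" where
  "Cb 0 S f \<longleftrightarrow> bounded (f ` S)"
| "Cb (Suc k) S f \<longleftrightarrow> bounded (f ` S) \<and>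
     (\<exists>f'. (\<forall>x\<in>S. (f has_derivative f' x) (at x)) \<and> (\<forall>v. Cb k S (\<lambda>x. f' x v)))"

definition smooth_bdd :: "'a::euclidean_space set \<Rightarrow> ('a \<Rightarrow> 'b::real_normed_vector) \<Rightarrow> bool" where
  "smooth_bdd S f \<longleftrightarrow> (\<forall>k. Cb k S f)"

lemma Cb_bounded: "Cb k S f \<Longrightarrow> bounded (f ` S)"
  by (cases k) auto

lemma Cb_SucI:
  assumes "bounded (f ` S)" "\<And>x. x \<in> S \<Longrightarrow> (f has_derivative f' x) (at x)"
    "\<And>v. Cb k S (\<lambda>x. f' x v)"
  shows "Cb (Suc k) S f"
  unfolding Cb.simps using assms by blast

lemma Cb_SucE:
  assumes "Cb (Suc k) S f"
  obtains f' where "bounded (f ` S)" "\<And>x. x \<in> S \<Longrightarrow> (f has_derivative f' x) (at x)"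
    "\<And>v. Cb k S (\<lambda>x. f' x v)"
  using assms unfolding Cb.simps by blast

lemma Cb_Suc_imp: "Cb (Suc k) S f \<Longrightarrow> Cb k S f"
proof (induction k arbitrary: f)
  case 0 then show ?case by (simp add: Cb_bounded)
next
  case (Suc k)
  from Suc.prems show ?case
    by (rule Cb_SucE) (rule Cb_SucI, auto intro: Suc.IH simp del: Cb.simps)
qed

lemma Cb_cong:
  assumes "open S" "\<And>x. x \<in> S \<Longrightarrow> f x = g x" "Cb k S f"
  shows "Cb k S g"
proof (cases k)
  case 0
  then show ?thesis using assms by (auto cong: image_cong)
next
  case (Suc m)
  then obtain f' where f': "\<forall>x\<in>S. (f has_derivative f' x) (at x)" "\<forall>v. Cb m S (\<lambda>x. f' x v)"
    and b: "bounded (f ` S)" using assms(3) by auto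
  have "\<forall>x\<in>S. (g has_derivative f' x) (at x)"
    using f' assms(1,2) by (auto intro: has_derivative_transform_within_open)
  then show ?thesis using f' b assms(2) Suc by (auto cong: image_cong)
qed

lemma Cb_const: "Cb k S (\<lambda>x. c)"
proof (induction k arbitrary: c)
  case 0 show ?case by (auto intro: finite_imp_bounded finite_subset[of _ "{c}"])
next
  case (Suc k)
  show ?case by (rule Cb_SucI[where f'="\<lambda>_ _. 0"])
    (auto intro: finite_imp_bounded finite_subset[of _ "{c}"] simp: Suc)
qed

lemma Cb_add: "Cb k S f \<Longrightarrow> Cb k S g \<Longrightarrow> Cb k S (\<lambda>x. f x + g x)"
proof (induction k arbitrary: f g)
  case 0 then show ?case by (auto intro: bounded_plus_comp)
next
  case (Suc k)
  then obtain f' g' where "\<forall>x\<in>S. (f has_derivative f' x) (at x)" "\<forall>v. Cb k S (\<lambda>x. f' x v)"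
     "\<forall>x\<in>S. (g has_derivative g' x) (at x)" "\<forall>v. Cb k S (\<lambda>x. g' x v)" by auto
  with Suc show ?case
    by (intro Cb_SucI[where f'="\<lambda>x v. f' x v + g' x v"])
      (auto intro: bounded_plus_comp derivative_intros)
qed

lemma Cb_linear:
  assumes L: "bounded_linear L"
  shows "Cb k S f \<Longrightarrow> Cb k S (\<lambda>x. L (f x))"
proof (induction k arbitrary: f)
  case 0 then show ?case using bounded_linear_image[of "f ` S", OF _ L] by (simp add: image_image)
next
  case (Suc k)
  then obtain f' where "\<forall>x\<in>S. (f has_derivative f' x) (at x)" "\<forall>v. Cb k S (\<lambda>x. f' x v)" by auto
  moreover have "bounded ((\<lambda>x. L (f x)) ` S)"
    using bounded_linear_image[OF _ L] Cb_bounded[OF Suc.prems] by (metis image_image)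
  ultimately show ?case
    by (intro Cb_SucI[where f'="\<lambda>x v. L (f' x v)"])
      (auto intro: Suc.IH bounded_linear.has_derivative[OF L])
qed

lemma Cb_minus: "Cb k S f \<Longrightarrow> Cb k S (\<lambda>x. - f x)"
  by (rule Cb_linear) (rule bounded_linear_minus, rule bounded_linear_ident)

lemma Cb_diff: "Cb k S f \<Longrightarrow> Cb k S g \<Longrightarrow> Cb k S (\<lambda>x. f x - g x)"
  using Cb_add[OF _ Cb_minus] by force

lemma Cb_sum: "(\<And>i. i \<in> I \<Longrightarrow> Cb k S (f i)) \<Longrightarrow> Cb k S (\<lambda>x. \<Sum>i\<in>I. f i x)"
  by (induction I rule: infinite_finite_induct) (auto intro: Cb_const Cb_add)

lemma bounded_bilinear_image:
  assumes "bounded_bilinear pr" "bounded (f ` S)" "bounded (g ` S)"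
  shows "bounded ((\<lambda>x. pr (f x) (g x)) ` S)"
proof -
  interpret bounded_bilinear pr by fact
  obtain K where K: "K > 0" "\<And>a b. norm (pr a b) \<le> norm a * norm b * K" using pos_bounded by blast
  obtain F where F: "\<And>x. x \<in> S \<Longrightarrow> norm (f x) \<le> F" using assms(2) unfolding bounded_iff by blast
  obtain G where G: "\<And>x. x \<in> S \<Longrightarrow> norm (g x) \<le> G" using assms(3) unfolding bounded_iff by blast
  have "norm (pr (f x) (g x)) \<le> F * G * K" if "x \<in> S" for x
  proof -
    have "norm (pr (f x) (g x)) \<le> norm (f x) * norm (g x) * K" by (rule K(2))
    also have "\<dots> \<le> F * G * K"
      using F[OF that] G[OF that] K(1) order_trans[OF norm_ge_zero F[OF that]]
      by (intro mult_right_mono mult_mono) auto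
    finally show ?thesis .
  qed
  then show ?thesis unfolding bounded_iff by auto
qed

lemma Cb_bilinear:
  assumes B: "bounded_bilinear pr"
  shows "Cb k S f \<Longrightarrow> Cb k S g \<Longrightarrow> Cb k S (\<lambda>x. pr (f x) (g x))"
proof (induction k arbitrary: f g)
  case 0 then show ?case using bounded_bilinear_image[OF B] by auto
next
  case (Suc k)
  then obtain f' g' where d: "\<forall>x\<in>S. (f has_derivative f' x) (at x)" "\<forall>v. Cb k S (\<lambda>x. f' x v)"
     "\<forall>x\<in>S. (g has_derivative g' x) (at x)" "\<forall>v. Cb k S (\<lambda>x. g' x v)" by auto
  have *: "Cb k S f" "Cb k S g" using Suc.prems Cb_Suc_imp by blast+
  show ?case
  proof (rule Cb_SucI[where f'="\<lambda>x v. pr (f x) (g' x v) + pr (f' x v) (g x)"])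
    show "bounded ((\<lambda>x. pr (f x) (g x)) ` S)"
      by (rule bounded_bilinear_image[OF B Cb_bounded[OF *(1)] Cb_bounded[OF *(2)]])
    show "((\<lambda>x. pr (f x) (g x)) has_derivative (\<lambda>v. pr (f x) (g' x v) + pr (f' x v) (g x))) (at x)"
      if "x \<in> S" for x using that d by (intro bounded_bilinear.FDERIV[OF B]) auto
    show "Cb k S (\<lambda>x. pr (f x) (g' x v) + pr (f' x v) (g x))" for v
      using d by (intro Cb_add Suc.IH *) auto
  qed
qed

lemma Cb_restrict_linear:
  assumes L: "bounded_linear L" "bounded (L ` S)"
  shows "Cb k S L"
proof (cases k)
  case (Suc m)
  show ?thesis unfolding Suc
    by (rule Cb_SucI[where f'="\<lambda>x. L"]) (auto intro: assms Cb_const bounded_linear_imp_has_derivative)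
qed (simp add: assms)

text \<open>
  For a projection \<open>L\<close> this lets a function of the position alone be read as a function on phase space,
  where the projection itself is unbounded.
\<close>
lemma Cb_compose_linear:
  assumes L: "bounded_linear L"
  shows "Cb k T f \<Longrightarrow> L ` S \<subseteq> T \<Longrightarrow> Cb k S (\<lambda>x. f (L x))"
proof (induction k arbitrary: f)
  case 0 then show ?case by (auto intro: bounded_subset simp: image_image[of f L, symmetric])
next
  case (Suc k)
  then obtain f' where f': "\<forall>x\<in>T. (f has_derivative f' x) (at x)" "\<forall>v. Cb k T (\<lambda>x. f' x v)"
    and b: "bounded (f ` T)" by auto
  show ?case
  proof (rule Cb_SucI[where f'="\<lambda>x v. f' (L x) (L v)"])
    show "bounded ((\<lambda>x. f (L x)) ` S)"
      using Suc.prems(2) by (auto intro: bounded_subset[OF b])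
    show "((\<lambda>x. f (L x)) has_derivative (\<lambda>v. f' (L x) (L v))) (at x)" if "x \<in> S" for x
      using that Suc.prems(2) f' diff_chain_at[OF bounded_linear_imp_has_derivative[OF L], of f "f' (L x)" x]
      by (auto simp: o_def)
    show "Cb k S (\<lambda>x. f' (L x) (L v))" for v using Suc.IH Suc.prems(2) f' by blast
  qed
qed

lemma Cb_frechet:
  assumes "open S" "Cb (Suc k) S f"
  shows "x \<in> S \<Longrightarrow> (f has_derivative frechet_derivative f (at x)) (at x)"
    and "Cb k S (\<lambda>x. frechet_derivative f (at x) v)"
proof -
  obtain f' where f': "\<forall>x\<in>S. (f has_derivative f' x) (at x)" "\<forall>v. Cb k S (\<lambda>x. f' x v)"
    using assms by auto
  then have eq: "f' x = frechet_derivative f (at x)" if "x \<in> S" for x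
    using that frechet_derivative_at by blast
  show "x \<in> S \<Longrightarrow> (f has_derivative frechet_derivative f (at x)) (at x)" using eq f' by auto
  show "Cb k S (\<lambda>x. frechet_derivative f (at x) v)"
    by (rule Cb_cong[OF assms(1) _ f'(2)[rule_format, of v]]) (simp add: eq)
qed

lemma smooth_bddD:
  assumes "open S" "smooth_bdd S f"
  shows "x \<in> S \<Longrightarrow> (f has_derivative frechet_derivative f (at x)) (at x)"
    and "smooth_bdd S (\<lambda>x. frechet_derivative f (at x) v)"
  using assms Cb_frechet[OF assms(1)] unfolding smooth_bdd_def by blast+

lemma smooth_bdd_imp_smooth_on:
  assumes "open S" "smooth_bdd S f"
  shows "smooth_on S f"
proof -
  have "smooth_bdd S (iter_deriv vs f)" for vs
  proof (induction vs)
    case Nil then show ?case by (simp add: assms)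
  next
    case (Cons v vs) then show ?case using smooth_bddD(2)[OF assms(1)] by simp
  qed
  then show ?thesis using smooth_bddD(1)[OF assms(1)]
    unfolding smooth_on_def by (meson differentiableI)
qed

lemma smooth_on_imp_smooth_bdd:
  assumes "smooth_on UNIV f" "bounded_derivs f"
  shows "smooth_bdd UNIV f"
proof -
  have "Cb k UNIV (iter_deriv vs f)" for k vs
  proof (induction k arbitrary: vs)
    case 0 then show ?case using assms(2) by (auto simp: bounded_derivs_def)
  next
    case (Suc k)
    have "(iter_deriv vs f has_derivative frechet_derivative (iter_deriv vs f) (at x)) (at x)" for x
      using assms(1) by (auto simp: smooth_on_def frechet_derivative_works)
    moreover have "Cb k UNIV (\<lambda>x. frechet_derivative (iter_deriv vs f) (at x) v)" for v
      using Suc[of "v # vs"] by simp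
    ultimately show ?case using assms(2) by (intro Cb_SucI) (auto simp: bounded_derivs_def)
  qed
  from this[of _ "[]"] show ?thesis by (simp add: smooth_bdd_def)
qed

text \<open>
  In finite dimension bounded directional derivatives bound the operator norm of the derivative:
  expand the direction in the standard basis.
\<close>
lemma Cb_derivative_bound:
  fixes f :: "'a::euclidean_space \<Rightarrow> 'b::real_normed_vector"
  assumes f': "\<And>x. x \<in> S \<Longrightarrow> (f has_derivative f' x) (at x)" "\<And>v. bounded ((\<lambda>x. f' x v) ` S)"
  shows "\<exists>L>0. \<forall>x\<in>S. \<forall>h. norm (f' x h) \<le> L * norm h"
proof -
  have "\<exists>B. \<forall>x\<in>S. norm (f' x b) \<le> B" for b using f'(2)[of b] unfolding bounded_iff by auto
  then obtain B where B: "\<And>x b. x \<in> S \<Longrightarrow> norm (f' x b) \<le> B b" by metis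
  define L where "L = (\<Sum>b\<in>Basis. \<bar>B b\<bar>) + 1"
  have "norm (f' x h) \<le> L * norm h" if "x \<in> S" for x h
  proof -
    interpret bounded_linear "f' x" using f'(1)[OF that] by (rule has_derivative_bounded_linear)
    have "f' x h = (\<Sum>b\<in>Basis. (h \<bullet> b) *\<^sub>R f' x b)"
      by (subst euclidean_representation[of h, symmetric]) (simp only: sum scaleR)
    also have "norm \<dots> \<le> (\<Sum>b\<in>Basis. norm h * \<bar>B b\<bar>)"
      using B[OF that] by (intro sum_norm_le) (auto intro!: mult_mono Basis_le_norm order_trans[OF _ abs_ge_self])
    also have "\<dots> \<le> L * norm h" by (simp add: L_def sum_distrib_left[symmetric] algebra_simps)
    finally show ?thesis .
  qed
  moreover have "L > 0" unfolding L_def by (smt (verit) sum_nonneg abs_ge_zero)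
  ultimately show ?thesis by blast
qed

lemma Cb_lipschitz:
  assumes "convex S" "Cb (Suc k) S f"
  shows "\<exists>L>0. \<forall>x\<in>S. \<forall>y\<in>S. norm (f x - f y) \<le> L * norm (x - y)"
proof -
  obtain f' where f': "\<forall>x\<in>S. (f has_derivative f' x) (at x)" "\<forall>v. Cb k S (\<lambda>x. f' x v)"
    using assms by auto
  obtain L where L: "L > 0" "\<forall>x\<in>S. \<forall>h. norm (f' x h) \<le> L * norm h"
    using Cb_derivative_bound[of S f f'] f' Cb_bounded by blast
  have "norm (f x - f y) \<le> L * norm (x - y)" if "x \<in> S" "y \<in> S" for x y
    using that f' L by (intro differentiable_bound[OF assms(1), of f f'] onorm_le)
      (auto intro: has_derivative_at_withinI)
  with L show ?thesis by blast
qed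

lemma Cb_derivative_lipschitz:
  assumes S: "convex S" "open S" and f: "Cb (Suc (Suc k)) S f"
  shows "\<exists>C>0. \<forall>x\<in>S. \<forall>y\<in>S. \<forall>h.
    norm (frechet_derivative f (at x) h - frechet_derivative f (at y) h) \<le> C * norm (x - y) * norm h"
proof -
  let ?f' = "\<lambda>x. frechet_derivative f (at x)"
  note f' = Cb_frechet[OF S(2) f]
  have "\<exists>B>0. \<forall>x\<in>S. \<forall>y\<in>S. norm (?f' x b - ?f' y b) \<le> B * norm (x - y)" for b
    using Cb_lipschitz[OF S(1) f'(2)] .
  then obtain B where B: "\<And>b. B b > 0" "\<And>b x y. x \<in> S \<Longrightarrow> y \<in> S \<Longrightarrow> norm (?f' x b - ?f' y b) \<le> B b * norm (x - y)"
    by metis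
  define C where "C = (\<Sum>b\<in>Basis. B b) + 1"
  have "norm (?f' x h - ?f' y h) \<le> C * norm (x - y) * norm h" if "x \<in> S" "y \<in> S" for x y h
  proof -
    have bl: "bounded_linear (\<lambda>h. ?f' x h - ?f' y h)"
      using f'(1) that by (intro bounded_linear_sub has_derivative_bounded_linear)
    then interpret bounded_linear "\<lambda>h. ?f' x h - ?f' y h" .
    have "?f' x h - ?f' y h = (\<Sum>b\<in>Basis. (h \<bullet> b) *\<^sub>R (?f' x b - ?f' y b))"
      using sum[of "\<lambda>b. (h \<bullet> b) *\<^sub>R b" Basis] by (simp only: euclidean_representation scaleR)
    also have "norm \<dots> \<le> (\<Sum>b\<in>Basis. norm h * (B b * norm (x - y)))"
      using B(2)[OF that] by (intro sum_norm_le) (auto intro!: mult_mono Basis_le_norm)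
    also have "\<dots> \<le> C * norm (x - y) * norm h"
      by (simp add: C_def sum_distrib_left[symmetric] sum_distrib_right[symmetric] algebra_simps)
    finally show ?thesis .
  qed
  moreover have "C > 0" unfolding C_def using B(1) by (smt (verit) sum_nonneg)
  ultimately show ?thesis by blast
qed

text \<open>
  The remainder is quadratic with one constant for the whole set. Taken pointwise along curves, this
  makes composition with \<open>f\<close> differentiable in the supremum norm.
\<close>
lemma Cb_taylor:
  assumes S: "convex S" "open S" and f: "Cb (Suc (Suc k)) S f"
  shows "\<exists>C>0. \<forall>x\<in>S. \<forall>y\<in>S.
    norm (f y - f x - frechet_derivative f (at x) (y - x)) \<le> C * (norm (y - x))\<^sup>2"
proof -
  let ?f' = "\<lambda>x. frechet_derivative f (at x)"
  note f' = Cb_frechet[OF S(2) f]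
  obtain C where C: "C > 0" "\<And>x y h. x \<in> S \<Longrightarrow> y \<in> S \<Longrightarrow> norm (?f' x h - ?f' y h) \<le> C * norm (x - y) * norm h"
    using Cb_derivative_lipschitz[OF assms] by blast
  have "norm (f y - f x - ?f' x (y - x)) \<le> C * (norm (y - x))\<^sup>2" if xy: "x \<in> S" "y \<in> S" for x y
  proof -
    have "norm (f y - f x - ?f' x (y - x)) \<le> norm (y - x) * (C * norm (y - x))"
    proof (rule differentiable_bound_linearization[where S="closed_segment x y"])
      show "x + t *\<^sub>R (y - x) \<in> closed_segment x y" if "t \<in> {0..1}" for t
        using that by (auto simp: in_segment algebra_simps)
      have sub: "closed_segment x y \<subseteq> S" using S(1) xy by (simp add: closed_segment_subset)
      show "(f has_derivative ?f' z) (at z within closed_segment x y)" if "z \<in> closed_segment x y" for z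
        using f'(1) sub that by (auto intro: has_derivative_at_withinI)
      show "onorm (?f' z - ?f' x) \<le> C * norm (y - x)" if "z \<in> closed_segment x y" for z
      proof (rule onorm_le)
        fix h
        have "norm ((?f' z - ?f' x) h) \<le> C * norm (z - x) * norm h"
          using C(2)[of z x h] sub that xy by auto
        also have "\<dots> \<le> C * norm (y - x) * norm h"
          using segment_bound1[OF that] C(1)
          by (intro mult_right_mono mult_left_mono) (auto simp: norm_minus_commute)
        finally show "norm ((?f' z - ?f' x) h) \<le> C * norm (y - x) * norm h" .
      qed
    qed auto
    then show ?thesis by (simp add: power2_eq_square algebra_simps)
  qed
  with C(1) show ?thesis by blast
qed

text \<open>
  The form in which all derivatives below are found: to first order \<open>F\<close> follows the increments of a
  function \<open>f\<close> whose derivative is known, up to a quadratic error.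
\<close>
lemma has_derivative_via_quadratic:
  assumes f: "(f has_derivative f') (at x)" and A: "bounded_linear A"
    and S: "open S" "x \<in> S"
    and q: "\<And>y. y \<in> S \<Longrightarrow> norm (F y - F x - A (f y - f x)) \<le> C * (norm (y - x))\<^sup>2"
  shows "(F has_derivative (\<lambda>h. A (f' h))) (at x)"
proof -
  interpret A: bounded_linear A by fact
  have *: "((\<lambda>y. F y - A (f y)) has_derivative (\<lambda>h. 0)) (at x)"
    unfolding has_derivative_at_within
  proof (intro conjI)
    have "((\<lambda>y. \<bar>C\<bar> * norm (y - x)) \<longlongrightarrow> \<bar>C\<bar> * norm (x - x)) (at x)" by (intro tendsto_intros)
    then have t: "((\<lambda>y. \<bar>C\<bar> * norm (y - x)) \<longlongrightarrow> 0) (at x)" by simp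
    have "\<forall>\<^sub>F y in at x. norm ((F y - A (f y) - (F x - A (f x)) - 0) /\<^sub>R norm (y - x)) \<le> \<bar>C\<bar> * norm (y - x)"
      using eventually_at_in_open[OF S]
    proof eventually_elim
      case (elim y)
      have "norm (F y - A (f y) - (F x - A (f x))) \<le> C * (norm (y - x))\<^sup>2"
        using q[of y] elim by (simp add: A.diff algebra_simps)
      also have "\<dots> \<le> \<bar>C\<bar> * (norm (y - x))\<^sup>2" by (intro mult_right_mono) auto
      finally have "norm (F y - A (f y) - (F x - A (f x))) / norm (y - x) \<le> \<bar>C\<bar> * norm (y - x)"
        using elim by (simp add: divide_simps power2_eq_square algebra_simps)
      then show ?case by (simp add: divide_inverse_commute)
    qed
    from Lim_null_comparison[OF this t]
    show "((\<lambda>y. (F y - A (f y) - (F x - A (f x)) - 0) /\<^sub>R norm (y - x)) \<longlongrightarrow> 0) (at x)" .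
  qed simp
  have "((\<lambda>y. (F y - A (f y)) + A (f y)) has_derivative (\<lambda>h. 0 + A (f' h))) (at x)"
    by (intro derivative_intros * A.has_derivative f)
  then show ?thesis by simp
qed

section \<open>Inverses of operator families\<close>

text \<open>
  Solving \<open>x = a x + y\<close> is a fixed point problem for a contraction when \<open>\<parallel>a\<parallel> \<le> 1/2\<close>; uniqueness of the
  fixed point makes the solution linear in \<open>y\<close>.
\<close>
lemma resolvent_exists:
  fixes a :: "'b::{real_normed_vector,complete_space} \<Rightarrow>\<^sub>L 'b"
  assumes a: "norm a \<le> 1/2"
  shows "\<exists>r::'b \<Rightarrow>\<^sub>L 'b. norm r \<le> 2 \<and> (\<forall>x y. x = blinfun_apply a x + y \<longleftrightarrow> x = blinfun_apply r y)"
proof -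
  have est: "norm (a x) \<le> 1/2 * norm x" for x
    using norm_blinfun[of a x] mult_right_mono[OF a, of "norm x"] by simp
  have "\<exists>!x. a x + y = x" for y
    using est by (intro banach_fix_type[of "1/2"])
      (auto simp: dist_norm blinfun.bilinear_simps[symmetric])
  then obtain r :: "'b \<Rightarrow> 'b" where r: "\<And>x y. a x + y = x \<longleftrightarrow> x = r y" by metis
  have bd: "norm (r y) \<le> 2 * norm y" for y
    using est[of "r y"] r[of "r y" y] norm_triangle_ineq[of "a (r y)" y] by simp
  have "bounded_linear r"
  proof (rule bounded_linear_intro)
    show "r (x + y) = r x + r y" for x y
      using r[of "r x + r y" "x + y"] r[of "r x" x] r[of "r y" y]
      by (simp add: blinfun.bilinear_simps algebra_simps) (metis add.assoc add.left_commute)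
    show "r (c *\<^sub>R x) = c *\<^sub>R r x" for c x
      using r[of "c *\<^sub>R r x" "c *\<^sub>R x"] r[of "r x" x]
      by (simp add: blinfun.bilinear_simps scaleR_add_right[symmetric])
    show "norm (r x) \<le> norm x * 2" for x using bd[of x] by simp
  qed
  then have ap: "blinfun_apply (Blinfun r) = r" by (rule bounded_linear_Blinfun_apply)
  have "norm (Blinfun r) \<le> 2" using bd by (intro norm_blinfun_bound) (auto simp: ap)
  then show ?thesis using r ap by metis
qed

definition resolvent :: "('b::{real_normed_vector,complete_space} \<Rightarrow>\<^sub>L 'b) \<Rightarrow> ('b \<Rightarrow>\<^sub>L 'b)" where
  "resolvent a = (SOME r. norm r \<le> 2 \<and> (\<forall>x y. x = blinfun_apply a x + y \<longleftrightarrow> x = blinfun_apply r y))"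

lemma resolvent:
  assumes "norm a \<le> 1/2"
  shows "norm (resolvent a) \<le> 2" and "x = blinfun_apply a x + y \<longleftrightarrow> x = blinfun_apply (resolvent a) y"
  using someI_ex[OF resolvent_exists[OF assms]] unfolding resolvent_def by blast+

lemma resolvent_identity:
  assumes "norm a \<le> 1/2" "norm b \<le> 1/2"
  shows "resolvent b - resolvent a = (resolvent b o\<^sub>L (b - a)) o\<^sub>L resolvent a"
proof (rule blinfun_eqI)
  fix y
  let ?x = "resolvent a y" and ?z = "resolvent b y"
  have "?x = a ?x + y" "?z = b ?z + y"
    using resolvent(2)[OF assms(1)] resolvent(2)[OF assms(2)] by blast+
  then have "?z - ?x = (b ?z + y) - (a ?x + y)" by presburger
  also have "\<dots> = b (?z - ?x) + (b - a) ?x"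
    by (simp add: blinfun.bilinear_simps)
  finally have "?z - ?x = b (?z - ?x) + (b - a) ?x" .
  then have "?z - ?x = resolvent b ((b - a) ?x)" using resolvent(2)[OF assms(2)] by blast
  then show "(resolvent b - resolvent a) y = ((resolvent b o\<^sub>L (b - a)) o\<^sub>L resolvent a) y"
    by (simp add: blinfun.bilinear_simps)
qed

text \<open>
  The hypothesis \<open>id\<close> is the resolvent identity \<open>R y - R z = R y (a y - a z) R z\<close>, written with two
  bilinear products so that it covers resolvents, inverse operators and inverse matrices alike (for
  inverses, \<open>a\<close> is the negative of the family that is inverted). Replacing \<open>R y\<close> by \<open>R x\<close> in it
  costs only a quadratic error.
\<close>
lemma has_derivative_inverse_family:
  fixes R :: "'p::euclidean_space \<Rightarrow> 'r::real_normed_vector"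
  assumes P: "bounded_bilinear P1" and Q: "bounded_bilinear P2"
    and S: "open S" "x \<in> S"
    and id: "\<And>y z. y \<in> S \<Longrightarrow> z \<in> S \<Longrightarrow> R y - R z = P2 (P1 (R y) (a y - a z)) (R z)"
    and R: "bounded (R ` S)"
    and lip: "\<And>y. y \<in> S \<Longrightarrow> norm (a y - a x) \<le> C * norm (y - x)"
    and a': "(a has_derivative a') (at x)"
  shows "(R has_derivative (\<lambda>h. P2 (P1 (R x) (a' h)) (R x))) (at x)"
proof -
  interpret P: bounded_bilinear P1 by fact
  interpret Q: bounded_bilinear P2 by fact
  obtain K1 where K1: "K1 > 0" "\<And>a b. norm (P1 a b) \<le> norm a * norm b * K1" using P.pos_bounded by blast
  obtain K2 where K2: "K2 > 0" "\<And>a b. norm (P2 a b) \<le> norm a * norm b * K2" using Q.pos_bounded by blast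
  obtain B where B: "B > 0" "\<And>y. y \<in> S \<Longrightarrow> norm (R y) \<le> B" using R unfolding bounded_pos by blast
  have tri: "norm (P2 (P1 r m) (R x)) \<le> norm r * norm m * K1 * B * K2" for r m
  proof -
    have "norm (P2 (P1 r m) (R x)) \<le> norm (P1 r m) * norm (R x) * K2" by (rule K2(2))
    also have "\<dots> \<le> (norm r * norm m * K1) * B * K2"
      using K1 K2(1) B(2)[OF S(2)] B(1) by (intro mult_right_mono mult_mono) auto
    finally show ?thesis .
  qed
  have lipR: "norm (R y - R x) \<le> B * (\<bar>C\<bar> * norm (y - x)) * K1 * B * K2" if "y \<in> S" for y
  proof -
    have "norm (R y - R x) \<le> norm (R y) * norm (a y - a x) * K1 * B * K2"
      using tri[of "R y" "a y - a x"] id[OF that S(2)] by simp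
    also have "\<dots> \<le> B * (\<bar>C\<bar> * norm (y - x)) * K1 * B * K2"
      using B(2)[OF that] K1(1) K2(1) B(1) order_trans[OF lip[OF that] mult_right_mono[OF abs_ge_self norm_ge_zero]]
      by (intro mult_right_mono mult_mono) auto
    finally show ?thesis .
  qed
  have A: "bounded_linear (\<lambda>m. P2 (P1 (R x) m) (R x))"
    by (rule bounded_linear_compose[OF Q.bounded_linear_left P.bounded_linear_right])
  show ?thesis
  proof (rule has_derivative_via_quadratic[OF a' A S])
    fix y assume y: "y \<in> S"
    have "R y - R x - P2 (P1 (R x) (a y - a x)) (R x) = P2 (P1 (R y - R x) (a y - a x)) (R x)"
      unfolding P.diff_left Q.diff_left id[OF y S(2), symmetric] by simp
    then have "norm (R y - R x - P2 (P1 (R x) (a y - a x)) (R x)) \<le> norm (R y - R x) * norm (a y - a x) * K1 * B * K2"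
      using tri by simp
    also have "\<dots> \<le> (B * (\<bar>C\<bar> * norm (y - x)) * K1 * B * K2) * (\<bar>C\<bar> * norm (y - x)) * K1 * B * K2"
      using lipR[OF y] K1(1) K2(1) B(1) order_trans[OF lip[OF y] mult_right_mono[OF abs_ge_self norm_ge_zero]]
      by (intro mult_right_mono mult_mono) auto
    also have "\<dots> = (B * \<bar>C\<bar> * K1 * B * K2 * \<bar>C\<bar> * K1 * B * K2) * (norm (y - x))\<^sup>2"
      by (simp add: power2_eq_square)
    finally show "norm (R y - R x - P2 (P1 (R x) (a y - a x)) (R x))
      \<le> (B * \<bar>C\<bar> * K1 * B * K2 * \<bar>C\<bar> * K1 * B * K2) * (norm (y - x))\<^sup>2" .
  qed
qed

text \<open>
  The derivative \<open>R a' R\<close> contains \<open>R\<close> itself and \<open>a'\<close>, both of which are known to be one order less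
  regular; this closes the induction.
\<close>
lemma Cb_inverse_family:
  fixes R :: "'p::euclidean_space \<Rightarrow> 'r::real_normed_vector"
  assumes P: "bounded_bilinear P1" and Q: "bounded_bilinear P2"
    and S: "open S"
    and id: "\<And>y z. y \<in> S \<Longrightarrow> z \<in> S \<Longrightarrow> R y - R z = P2 (P1 (R y) (a y - a z)) (R z)"
    and R: "bounded (R ` S)"
    and lip: "\<And>y z. y \<in> S \<Longrightarrow> z \<in> S \<Longrightarrow> norm (a y - a z) \<le> C * norm (y - z)"
    and a: "Cb k S a"
  shows "Cb k S R"
  using a
proof (induction k)
  case 0 show ?case using R by simp
next
  case (Suc k)
  note a' = Cb_frechet[OF S Suc.prems]
  note IH = Suc.IH[OF Cb_Suc_imp[OF Suc.prems]]
  show ?case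
  proof (rule Cb_SucI[OF R has_derivative_inverse_family[OF P Q S _ id R lip a'(1)]])
    show "Cb k S (\<lambda>x. P2 (P1 (R x) (frechet_derivative a (at x) v)) (R x))" for v
      by (intro Cb_bilinear[OF Q] Cb_bilinear[OF P] IH a'(2))
  qed auto
qed

section \<open>Expanding maps and perturbations of linear isomorphisms\<close>

lemma derivative_expand:
  assumes "bounded_linear D"
  shows "D h = (\<Sum>b\<in>Basis. (h \<bullet> b) *\<^sub>R D (b :: 'a::euclidean_space))"
proof -
  interpret bounded_linear D by fact
  show ?thesis
    by (subst euclidean_representation[of h, symmetric]) (simp only: sum scaleR)
qed

text \<open>
  Divide the expansion inequality by the length of a small step in direction \<open>h\<close>.
\<close>
lemma derivative_lower_bound:
  fixes H :: "'a::euclidean_space \<Rightarrow> 'b::real_normed_vector"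
  assumes S: "open S" "x \<in> S" and H': "(H has_derivative H') (at x)"
    and low: "\<And>y. y \<in> S \<Longrightarrow> m * norm (y - x) \<le> norm (H y - H x)"
  shows "m * norm h \<le> norm (H' h)"
proof (rule field_le_epsilon)
  fix e :: real assume e: "e > 0"
  interpret H': bounded_linear H' using H' by (rule has_derivative_bounded_linear)
  show "m * norm h \<le> norm (H' h) + e"
  proof (cases "h = 0")
    case True then show ?thesis using e by simp
  next
    case False
    then have eh: "e / norm h > 0" using e by simp
    obtain d where d: "d > 0" "\<And>y. norm (y - x) < d \<Longrightarrow> norm (H y - H x - H' (y - x)) \<le> e / norm h * norm (y - x)"
      using H' eh unfolding has_derivative_at_alt by blast
    obtain r where r: "r > 0" "ball x r \<subseteq> S" using S openE by blast
    \<comment> \<open>short enough to stay both in the ball inside \<open>S\<close> and where the first-order estimate holds\<close>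
    define t where "t = min d r / (2 * norm h)"
    have t: "t > 0" "t * norm h < d" "t * norm h < r"
      using d(1) r(1) False by (auto simp: t_def)
    let ?y = "x + t *\<^sub>R h"
    have yn: "norm (?y - x) = t * norm h" using t by simp
    have "?y \<in> S" using r(2) t yn by (auto simp: subset_iff dist_norm)
    then have "m * (t * norm h) \<le> norm (H ?y - H x)" using low[of ?y] yn by metis
    also have "\<dots> \<le> norm (H' (?y - x)) + norm (H ?y - H x - H' (?y - x))"
      using norm_triangle_ineq[of "H' (?y - x)" "H ?y - H x - H' (?y - x)"] by simp
    also have "\<dots> \<le> t * norm (H' h) + e / norm h * (t * norm h)"
      using d(2)[of ?y] yn t by (intro add_mono) (auto simp: H'.scaleR)
    also have "\<dots> = t * (norm (H' h) + e)" using False by (simp add: algebra_simps)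
    finally have "t * (m * norm h) \<le> t * (norm (H' h) + e)" by (simp add: ac_simps)
    then show ?thesis using t by simp
  qed
qed

text \<open>
  Expansion gives injectivity and, through the derivative, invertible differentials; the image is open
  by invariance of domain. Smoothness of the inverse \<open>G\<close> is a bootstrap. Its derivative at \<open>y\<close> is
  \<open>R y\<close>, the inverse of \<open>H' (G y)\<close>. If every smooth operator-valued function composed with \<open>G\<close> is \<open>C\<^sub>b\<^sup>k\<close>, then
  so is \<open>H' \<circ> G\<close>, hence so is \<open>R\<close>, and by the chain rule the compositions are \<open>C\<^sub>b\<close> of order \<open>k + 1\<close>.
\<close>
theorem diffeo_onto_image_if_expanding:
  fixes H :: "'a::euclidean_space \<Rightarrow> 'a"
  assumes S: "open S" "convex S" "bounded S" and H: "smooth_bdd S H"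
    and m: "m > 0" and low: "\<And>x y. x \<in> S \<Longrightarrow> y \<in> S \<Longrightarrow> m * norm (x - y) \<le> norm (H x - H y)"
  shows "diffeo_onto_image S H"
proof -
  let ?H' = "\<lambda>x. frechet_derivative H (at x)"
  note H' = smooth_bddD[OF S(1) H]
  have inj: "inj_on H S"
  proof (rule inj_onI)
    fix x y assume "x \<in> S" "y \<in> S" "H x = H y"
    then have "m * norm (x - y) \<le> 0" using low[of x y] by simp
    then show "x = y" using m by (simp add: mult_le_0_iff)
  qed
  have cont: "continuous_on S H"
    using H'(1) by (meson continuous_at_imp_continuous_on has_derivative_continuous)
  define T where "T = H ` S"
  have T: "open T" unfolding T_def by (rule invariance_of_domain[OF cont S(1) inj])
  define G where "G = inv_into S H"
  have GS: "G y \<in> S" "H (G y) = y" if "y \<in> T" for y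
    using that by (auto simp: G_def T_def inv_into_into f_inv_into_f)
  have lipG: "norm (G y - G z) \<le> (1 / m) * norm (y - z)" if "y \<in> T" "z \<in> T" for y z
    using low[OF GS(1) GS(1), OF that] GS(2) that m by (simp add: field_simps)
  \<comment> \<open>the derivative of \<open>H\<close> as a function with values in the normed space of operators\<close>
  define Hb where "Hb x = (\<Sum>b\<in>Basis. blinfun_scaleR_left (?H' x b) o\<^sub>L blinfun_inner_left b)" for x
  have smooth_Hb: "smooth_bdd S Hb"
    using H'(2) unfolding smooth_bdd_def Hb_def
    by (intro allI Cb_sum Cb_linear[OF bounded_bilinear.bounded_linear_left[OF bounded_bilinear_blinfun_compose]]
        Cb_linear[OF bounded_linear_blinfun_scaleR_left]) blast
  have Hb: "Hb x h = ?H' x h" if "x \<in> S" for x h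
    using derivative_expand[OF has_derivative_bounded_linear[OF H'(1)[OF that]], of h]
    by (simp add: Hb_def blinfun.sum_left blinfun_inner_left.rep_eq)
  have lowH': "m * norm h \<le> norm (?H' x h)" if "x \<in> S" for x h
    by (rule derivative_lower_bound[OF S(1) that H'(1)[OF that]]) (rule low[OF _ that])
  have "\<exists>r::'a \<Rightarrow>\<^sub>L 'a. (\<forall>h. blinfun_apply r (blinfun_apply (Hb (G y)) h) = h) \<and> (\<forall>k. blinfun_apply (Hb (G y)) (blinfun_apply r k) = k) \<and> norm r \<le> 1 / m"
    if y: "y \<in> T" for y
  proof -
    have x: "G y \<in> S" by (rule GS(1)[OF y])
    have lin: "linear (?H' (G y))" using has_derivative_bounded_linear[OF H'(1)[OF x]] bounded_linear.linear by blast
    have "inj (?H' (G y))"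
    proof (subst linear_injective_0[OF lin], intro allI impI)
      fix h assume "?H' (G y) h = 0"
      then show "h = 0" using lowH'[OF x, of h] m by (simp add: mult_le_0_iff)
    qed
    then obtain f where f: "linear f" "\<And>h. f (?H' (G y) h) = h" "\<And>k. ?H' (G y) (f k) = k"
      using linear_injective_isomorphism[OF lin] by blast
    have ap: "blinfun_apply (Blinfun f) = f"
      using f(1) linear_conv_bounded_linear bounded_linear_Blinfun_apply by blast
    have "norm (f k) \<le> 1 / m * norm k" for k
      using lowH'[OF x, of "f k"] f(3)[of k] m by (simp add: field_simps)
    then have "norm (Blinfun f) \<le> 1 / m" using m by (intro norm_blinfun_bound) (auto simp: ap)
    then show ?thesis using f ap Hb[OF x] by (intro exI[of _ "Blinfun f"]) auto
  qed
  then have "\<exists>R. \<forall>y\<in>T. (\<forall>h. blinfun_apply (R y) (Hb (G y) h) = h) \<and>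
      (\<forall>k. Hb (G y) (blinfun_apply (R y) k) = k) \<and> norm (R y) \<le> 1 / m"
    by (intro bchoice) blast
  then obtain R :: "'a \<Rightarrow> 'a \<Rightarrow>\<^sub>L 'a" where
    R: "\<And>y h. y \<in> T \<Longrightarrow> R y (Hb (G y) h) = h" "\<And>y k. y \<in> T \<Longrightarrow> Hb (G y) (R y k) = k"
       "\<And>y. y \<in> T \<Longrightarrow> norm (R y) \<le> 1 / m" by blast
  have bdR: "bounded (R ` T)" using R(3) unfolding bounded_iff by blast
  obtain CH where CH: "CH > 0" "\<And>x y. x \<in> S \<Longrightarrow> y \<in> S \<Longrightarrow> norm (Hb x - Hb y) \<le> CH * norm (x - y)"
    using Cb_lipschitz[OF S(2), of 0 Hb] smooth_Hb unfolding smooth_bdd_def by blast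
  have CbR: "Cb k T R" if "Cb k T (\<lambda>y. Hb (G y))" for k
  proof (rule Cb_inverse_family[OF bounded_bilinear_blinfun_compose bounded_bilinear_blinfun_compose T
        _ bdR _ Cb_minus[OF that]])
    fix y z assume yz: "y \<in> T" "z \<in> T"
    show "R y - R z = (R y o\<^sub>L (- Hb (G y) - - Hb (G z))) o\<^sub>L R z"
      by (rule blinfun_eqI) (simp add: blinfun.bilinear_simps R yz)
    have "norm (- Hb (G y) - - Hb (G z)) = norm (Hb (G y) - Hb (G z))"
      by (simp add: norm_minus_commute)
    also have "\<dots> \<le> CH * norm (G y - G z)" using CH(2) GS(1) yz by blast
    also have "\<dots> \<le> CH * (1 / m * norm (y - z))" using lipG[OF yz] CH(1) by (intro mult_left_mono) auto
    finally show "norm (- Hb (G y) - - Hb (G z)) \<le> (CH * (1 / m)) * norm (y - z)" by simp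
  qed
  obtain CT where CT: "CT > 0" "\<And>x y. x \<in> S \<Longrightarrow> y \<in> S \<Longrightarrow>
      norm (H y - H x - ?H' x (y - x)) \<le> CT * (norm (y - x))\<^sup>2"
    using Cb_taylor[OF S(2,1), of 0 H] H unfolding smooth_bdd_def by blast
  have G': "(G has_derivative blinfun_apply (R y)) (at y)" if y: "y \<in> T" for y
  proof (rule has_derivative_via_quadratic[OF has_derivative_ident blinfun.bounded_linear_right T y])
    fix y' assume y': "y' \<in> T"
    let ?x = "G y" and ?x' = "G y'"
    have xS: "?x \<in> S" "?x' \<in> S" using GS(1) y y' by auto
    have "?x' - ?x = R y (?H' ?x (?x' - ?x))" using R(1)[OF y] Hb[OF xS(1)] by simp
    moreover have "y' - y = H ?x' - H ?x" using GS(2) y y' by simp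
    ultimately have "?x' - ?x - R y (y' - y) = R y (- (H ?x' - H ?x - ?H' ?x (?x' - ?x)))"
      by (simp add: blinfun.bilinear_simps)
    then have "norm (?x' - ?x - R y (y' - y)) \<le> norm (R y) * norm (H ?x' - H ?x - ?H' ?x (?x' - ?x))"
      using norm_blinfun by (metis norm_minus_cancel)
    also have "\<dots> \<le> 1 / m * (CT * (1 / m * norm (y' - y))\<^sup>2)"
      using R(3)[OF y] m CT(1) lipG[OF y' y]
      by (intro mult_mono order_trans[OF CT(2)[OF xS]] mult_left_mono power_mono) auto
    finally show "norm (?x' - ?x - R y (y' - y)) \<le> (1 / m * CT * (1 / m)\<^sup>2) * (norm (y' - y))\<^sup>2"
      by (simp add: power_mult_distrib ac_simps power_divide)
  qed
  have comp: "Cb k T (\<lambda>y. f (G y))" if "smooth_bdd S f" for k and f :: "'a \<Rightarrow> 'a \<Rightarrow>\<^sub>L 'a"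
    using that
  proof (induction k arbitrary: f)
    case 0
    then have "bounded (f ` S)" using Cb_bounded unfolding smooth_bdd_def by blast
    then show ?case by (auto intro: bounded_subset simp: GS(1))
  next
    case (Suc k)
    note f' = smooth_bddD[OF S(1) Suc.prems]
    show ?case
    proof (rule Cb_SucI)
      show "bounded ((\<lambda>y. f (G y)) ` T)" using Cb_bounded[OF Suc.IH[OF Suc.prems]] .
      show "((\<lambda>y. f (G y)) has_derivative (\<lambda>h. frechet_derivative f (at (G y)) (R y h))) (at y)"
        if "y \<in> T" for y
        using diff_chain_at[OF G'[OF that] f'(1)[OF GS(1)[OF that]]] by (simp add: o_def)
      fix v
      have "Cb k T (\<lambda>y. \<Sum>b\<in>Basis. (R y v \<bullet> b) *\<^sub>R frechet_derivative f (at (G y)) b)"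
        by (intro Cb_sum Cb_bilinear[OF bounded_bilinear_scaleR] Cb_bilinear[OF bounded_bilinear_inner]
            Cb_const Cb_bilinear[OF bounded_bilinear_blinfun_apply] CbR Suc.IH smooth_Hb f'(2))
      then show "Cb k T (\<lambda>y. frechet_derivative f (at (G y)) (R y v))"
        by (rule Cb_cong[OF T, rotated])
          (use derivative_expand[OF has_derivative_bounded_linear[OF f'(1)[OF GS(1)]]] in metis)
    qed
  qed
  have bdG: "bounded (G ` T)" by (rule bounded_subset[OF S(3)]) (use GS(1) in auto)
  have "Cb (Suc k) T G" for k
  proof (rule Cb_SucI[OF bdG G'])
    show "Cb k T (\<lambda>y. R y v)" for v
      by (intro Cb_bilinear[OF bounded_bilinear_blinfun_apply] Cb_const CbR comp smooth_Hb)
  qed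
  then have "smooth_bdd T G" unfolding smooth_bdd_def using Cb_Suc_imp by blast
  then show ?thesis
    unfolding diffeo_onto_image_def
    using inj T smooth_bdd_imp_smooth_on[OF S(1) H] smooth_bdd_imp_smooth_on[OF T]
    by (simp add: T_def G_def)
qed

text \<open>
  A map within Lipschitz distance \<open>1 / (2 B)\<close> of an isomorphism whose inverse has norm at most \<open>B\<close>
  keeps half of its expansion.
\<close>
lemma perturbed_linear_expanding:
  fixes F :: "'a::real_normed_vector \<Rightarrow> 'b::real_normed_vector"
  assumes inv: "\<And>w. N (M w) = w" and B: "\<And>z. norm (N z) \<le> B * norm z" "B > 0"
    and close: "norm (F w - F w' - M (w - w')) \<le> 1 / (2 * B) * norm (w - w')"
  shows "norm (w - w') \<le> 2 * B * norm (F w - F w')"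
proof -
  have "norm (w - w') \<le> B * norm (M (w - w'))" using B(1)[of "M (w - w')"] by (simp add: inv)
  also have "norm (M (w - w')) \<le> norm (F w - F w') + norm (F w - F w' - M (w - w'))"
    using norm_triangle_ineq4[of "F w - F w'" "F w - F w' - M (w - w')"] by simp
  also have "\<dots> \<le> norm (F w - F w') + 1 / (2 * B) * norm (w - w')" using close by simp
  finally have "norm (w - w') \<le> B * (norm (F w - F w') + 1 / (2 * B) * norm (w - w'))"
    using B(2) by simp
  then show ?thesis using B(2) by (simp add: field_simps)
qed

text \<open>
  Solving \<open>F w = y\<close> means finding a fixed point of the Newton-type map \<open>w \<mapsto> w - N (F w - y)\<close>, which
  contracts by \<open>1/2\<close>.
\<close>
lemma perturbed_linear_image_contains_ball:
  fixes F :: "'a::euclidean_space \<Rightarrow> 'b::euclidean_space"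
  assumes N: "linear N" and inv: "\<And>w. N (M w) = w" "\<And>z. N z = 0 \<Longrightarrow> z = 0"
    and B: "\<And>z. norm (N z) \<le> B * norm z" "B > 0" and \<rho>: "\<rho> > 0"
    and close: "\<And>w w'. norm w \<le> \<rho> \<Longrightarrow> norm w' \<le> \<rho> \<Longrightarrow>
      norm (F w - F w' - M (w - w')) \<le> 1 / (2 * B) * norm (w - w')"
  shows "ball (F 0) (\<rho> / (2 * B)) \<subseteq> F ` cball 0 \<rho>"
proof
  fix y assume y: "y \<in> ball (F 0) (\<rho> / (2 * B))"
  interpret N: linear N by fact
  let ?T = "\<lambda>w. w - N (F w - y)"
  have lip: "norm (?T w - ?T w') \<le> 1/2 * norm (w - w')" if "norm w \<le> \<rho>" "norm w' \<le> \<rho>" for w w'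
  proof -
    have "?T w - ?T w' = - N (F w - F w' - M (w - w'))"
      by (simp add: N.diff inv(1))
    then have "norm (?T w - ?T w') \<le> B * norm (F w - F w' - M (w - w'))" using B(1) by simp
    also have "\<dots> \<le> B * (1 / (2 * B) * norm (w - w'))" using close[OF that] B(2) by (intro mult_left_mono) auto
    finally show ?thesis using B(2) by simp
  qed
  have "\<exists>!w\<in>cball 0 \<rho>. ?T w = w"
  proof (rule Banach_fix[where c="1/2"])
    show "complete (cball (0::'a) \<rho>)" by (simp add: complete_eq_closed)
    show "?T ` cball 0 \<rho> \<subseteq> cball 0 \<rho>"
    proof clarsimp
      fix w :: 'a assume w: "norm w \<le> \<rho>"
      have "norm (?T w) \<le> norm (?T w - ?T 0) + norm (?T 0)" using norm_triangle_ineq[of "?T w - ?T 0" "?T 0"] by simp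
      moreover have "norm (?T w - ?T 0) \<le> 1/2 * \<rho>" using lip[of w 0] w \<rho> by simp
      moreover have "norm (?T 0) \<le> B * norm (F 0 - y)" using B(1) by simp
      moreover have "B * norm (F 0 - y) \<le> B * (\<rho> / (2 * B))" using y B(2) by (intro mult_left_mono) (auto simp: dist_norm)
      ultimately show "norm (w - N (F w - y)) \<le> \<rho>" using B(2) by simp
    qed
    show "dist (?T w) (?T w') \<le> 1/2 * dist w w'" if "w \<in> cball 0 \<rho>" "w' \<in> cball 0 \<rho>" for w w'
      using lip[of w w'] that by (simp add: dist_norm)
  qed (use \<rho> in auto)
  then obtain w where "w \<in> cball 0 \<rho>" "N (F w - y) = 0" by auto
  with inv(2) show "y \<in> F ` cball 0 \<rho>" by force
qed

section \<open>Smooth dependence of short-time flows on the initial value\<close>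

text \<open>
  Trajectories are points of the complete space of bounded continuous curves on the whole real line;
  a curve on \<open>[0, \<delta>]\<close> is represented by extending it with its end values.
\<close>
type_synonym 'e curve = "real \<Rightarrow>\<^sub>C 'e"

definition curve_mul :: "'e::euclidean_space \<Rightarrow> 'e curve \<Rightarrow> 'e curve \<Rightarrow> 'e curve" where
  "curve_mul b w h = Bcontfun (\<lambda>s. (h s \<bullet> b) *\<^sub>R w s)"

lemma curve_mul_apply [simp]: "apply_bcontfun (curve_mul b w h) s = (h s \<bullet> b) *\<^sub>R w s"
proof -
  have "norm ((h s \<bullet> b) *\<^sub>R w s) \<le> (norm h * norm b) * norm w" for s
    using Cauchy_Schwarz_ineq2[of "h s" b] norm_bounded[of h s] norm_bounded[of w s]
    by (auto intro!: mult_mono order_trans[OF Cauchy_Schwarz_ineq2])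
  then have "(\<lambda>s. (h s \<bullet> b) *\<^sub>R w s) \<in> bcontfun"
    by (intro bcontfun_normI) (auto intro!: continuous_intros)
  then show ?thesis by (simp add: curve_mul_def Bcontfun_inverse)
qed

lemma bounded_bilinear_curve_mul: "bounded_bilinear (curve_mul b)"
proof
  show "\<exists>K. \<forall>w h. norm (curve_mul b w h) \<le> norm w * norm h * K"
  proof (intro exI allI norm_bound)
    fix w h s
    have "norm (apply_bcontfun (curve_mul b w h) s) \<le> (norm h * norm b) * norm w"
      using Cauchy_Schwarz_ineq2[of "h s" b] norm_bounded[of h s] norm_bounded[of w s]
      by (auto intro!: mult_mono order_trans[OF Cauchy_Schwarz_ineq2])
    then show "norm (apply_bcontfun (curve_mul b w h) s) \<le> norm w * norm h * norm b" by (simp add: ac_simps)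
  qed
qed (auto intro!: bcontfun_eqI simp: algebra_simps inner_add_left)

lemma bounded_linear_curve_eval: "bounded_linear (\<lambda>u::'e::real_normed_vector curve. apply_bcontfun u s)"
  by (rule bounded_linear_intro[where K=1]) (auto simp: norm_bounded)

lemma bounded_linear_const_curve: "bounded_linear (const_bcontfun :: 'e::real_normed_vector \<Rightarrow> 'e curve)"
  by (rule bounded_linear_intro[where K=1]) (auto intro!: bcontfun_eqI norm_bound)

text \<open>
  The superposition (Nemytskii) operator of \<open>f\<close>. It has a meaning for curves in a set on which \<open>f\<close> is
  continuous and bounded.
\<close>
definition nemytskii :: "('e::euclidean_space \<Rightarrow> 'e) \<Rightarrow> 'e curve \<Rightarrow> 'e curve" where
  "nemytskii f u = Bcontfun (\<lambda>s. f (u s))"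

text \<open>
  The quantitative setting of Picard iteration: initial values in \<open>K1\<close>, trajectories in \<open>K\<close>, regularity
  and uniform bounds for \<open>V\<close> on \<open>U\<close>, and a time \<open>\<delta>\<close> so short that trajectories move by at most \<open>1/2\<close>
  and the integral operator contracts by \<open>1/2\<close>.
\<close>
locale flow_setup =
  fixes V :: "'e::euclidean_space \<Rightarrow> 'e" and U K K1 :: "'e set" and \<delta> L :: real
  assumes U: "open U" "convex U" and K: "closed K" "K \<subseteq> U"
    and near: "\<And>z z'. z \<in> K1 \<Longrightarrow> norm (z' - z) \<le> 1/2 \<Longrightarrow> z' \<in> K"
    and V: "smooth_bdd U V"
    and \<delta>: "0 < \<delta>" "0 < L" "\<delta> * L \<le> 1/2"
    and V_bound: "\<And>x. x \<in> U \<Longrightarrow> norm (V x) \<le> L"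
    and V_lip: "\<And>x y. x \<in> U \<Longrightarrow> y \<in> U \<Longrightarrow> norm (V x - V y) \<le> L * norm (x - y)"
    and V_deriv: "\<And>x h. x \<in> U \<Longrightarrow> norm (frechet_derivative V (at x) h) \<le> L * norm h"
begin

definition clamp_time :: "real \<Rightarrow> real" where "clamp_time t = max 0 (min \<delta> t)"

lemma clamp_time: "0 \<le> clamp_time t" "clamp_time t \<le> \<delta>" "t \<in> {0..\<delta>} \<Longrightarrow> clamp_time t = t" "clamp_time 0 = 0" "clamp_time \<delta> = \<delta>"
  using \<delta> by (auto simp: clamp_time_def)

lemma continuous_clamp_time: "continuous_on S clamp_time"
  unfolding clamp_time_def by (intro continuous_intros)

definition antideriv :: "'e curve \<Rightarrow> 'e curve" where
  "antideriv w = Bcontfun (\<lambda>t. integral {0..clamp_time t} (apply_bcontfun w))"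

lemma integrable_curve: "apply_bcontfun w integrable_on {a..b}" for w :: "'e curve"
  by (rule integrable_continuous_interval) simp

lemma integral_curve_bound:
  assumes "\<And>s. norm (apply_bcontfun w s) \<le> B"
  shows "norm (integral {0..clamp_time t} (apply_bcontfun (w::'e curve))) \<le> \<delta> * B"
proof -
  have B: "0 \<le> B" using order_trans[OF norm_ge_zero assms] .
  have "norm (integral {0..clamp_time t} (apply_bcontfun w)) \<le> B * (clamp_time t - 0)"
    using assms by (intro integral_bound) (auto simp: clamp_time)
  also have "\<dots> \<le> \<delta> * B" using mult_left_mono[OF clamp_time(2)[of t] B] by (simp add: mult.commute)
  finally show ?thesis .
qed

lemma antideriv_apply: "apply_bcontfun (antideriv w) t = integral {0..clamp_time t} (apply_bcontfun w)"
proof -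
  have "continuous_on {0..\<delta>} (\<lambda>t. integral {0..t} (apply_bcontfun w))"
    by (intro indefinite_integral_continuous_1 integrable_curve)
  then have "continuous_on UNIV (\<lambda>t. integral {0..clamp_time t} (apply_bcontfun w))"
    by (rule continuous_on_compose2[OF _ continuous_clamp_time]) (auto simp: clamp_time)
  then have "(\<lambda>t. integral {0..clamp_time t} (apply_bcontfun w)) \<in> bcontfun"
    by (rule bcontfun_normI[OF _ integral_curve_bound[OF norm_bounded]])
  then show ?thesis by (simp add: antideriv_def Bcontfun_inverse)
qed

lemma norm_antideriv_le: "norm (antideriv w) \<le> \<delta> * norm w"
  by (rule norm_bound) (simp add: antideriv_apply integral_curve_bound norm_bounded)

lemma bounded_linear_antideriv: "bounded_linear antideriv"
proof (rule bounded_linear_intro[where K=\<delta>])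
  show "antideriv (x + y) = antideriv x + antideriv y" for x y
    by (rule bcontfun_eqI) (simp add: antideriv_apply integral_add integrable_curve)
  show "antideriv (c *\<^sub>R x) = c *\<^sub>R antideriv x" for c x
    by (rule bcontfun_eqI) (simp add: antideriv_apply)
  show "norm (antideriv x) \<le> norm x * \<delta>" for x using norm_antideriv_le[of x] by (simp add: mult.commute)
qed

sublocale antideriv: bounded_linear antideriv by (rule bounded_linear_antideriv)

lemma nemytskii_apply:
  assumes "smooth_bdd U f" "\<And>s. apply_bcontfun u s \<in> U"
  shows "apply_bcontfun (nemytskii f u) s = f (u s)"
proof -
  have "continuous_on U f"
    using smooth_bddD(1)[OF U(1) assms(1)]
    by (meson continuous_at_imp_continuous_on has_derivative_continuous)
  then have c: "continuous_on UNIV (\<lambda>s. f (u s))"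
    by (rule continuous_on_compose2) (use assms in auto)
  have "bounded (f ` U)" using assms(1) Cb_bounded unfolding smooth_bdd_def by blast
  then have "bounded (range (\<lambda>s. f (u s)))" by (rule bounded_subset) (use assms in auto)
  then have "(\<lambda>s. f (u s)) \<in> bcontfun" using c by (simp add: bcontfun_def)
  then show ?thesis by (simp add: nemytskii_def Bcontfun_inverse)
qed

text \<open>
  Banach's fixed point theorem for the integral form of the differential equation on the closed set of
  curves with values in \<open>K\<close>.
\<close>
lemma sol_exists:
  assumes "z \<in> K1"
  shows "\<exists>u. (\<forall>s. apply_bcontfun u s \<in> K) \<and> u = const_bcontfun z + antideriv (nemytskii V u)"
proof -
  let ?S = "PiC UNIV (\<lambda>_. K) :: 'e curve set"
  let ?F = "\<lambda>u. const_bcontfun z + antideriv (nemytskii V u)"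
  have S: "u \<in> ?S \<longleftrightarrow> (\<forall>s. apply_bcontfun u s \<in> K)" for u by (auto simp: mem_PiC_iff Pi_iff)
  have zK: "z \<in> K" using near[OF assms, of z] by simp
  have "\<exists>!u\<in>?S. ?F u = u"
  proof (rule Banach_fix[where c="1/2"])
    show "complete ?S" unfolding complete_eq_closed by (intro closed_PiC) (rule K)
    show "?S \<noteq> {}" using S[of "const_bcontfun z"] zK by auto
    show "?F ` ?S \<subseteq> ?S"
    proof (clarsimp simp: S)
      fix u :: "'e curve" and s assume u: "\<forall>s. apply_bcontfun u s \<in> K"
      have uU: "apply_bcontfun u s \<in> U" for s using u K(2) by blast
      have "norm (antideriv (nemytskii V u)) \<le> \<delta> * norm (nemytskii V u)" by (rule norm_antideriv_le)
      also have "\<dots> \<le> \<delta> * L"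
        using \<delta> V_bound[OF uU] by (intro mult_left_mono norm_bound) (auto simp: nemytskii_apply[OF V uU])
      finally have "norm (antideriv (nemytskii V u) s) \<le> 1/2"
        using \<delta>(3) norm_bounded[of "antideriv (nemytskii V u)" s] by linarith
      then show "z + antideriv (nemytskii V u) s \<in> K" by (intro near[OF assms]) simp
    qed
    show "dist (?F u) (?F v) \<le> 1/2 * dist u v" if "u \<in> ?S" "v \<in> ?S" for u v
    proof -
      have uv: "apply_bcontfun u s \<in> U" "apply_bcontfun v s \<in> U" for s using that K(2) by (auto simp: S)
      have "dist (?F u) (?F v) = norm (antideriv (nemytskii V u - nemytskii V v))" by (simp add: dist_norm antideriv.diff)
      also have "\<dots> \<le> \<delta> * norm (nemytskii V u - nemytskii V v)" by (rule norm_antideriv_le)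
      also have "\<dots> \<le> \<delta> * (L * norm (u - v))"
      proof (intro mult_left_mono norm_bound)
        fix s
        have "norm (V (u s) - V (v s)) \<le> L * norm ((u - v) s)" using V_lip[OF uv] by simp
        also have "\<dots> \<le> L * norm (u - v)" using \<delta> by (intro mult_left_mono norm_bounded) simp
        finally show "norm (apply_bcontfun (nemytskii V u - nemytskii V v) s) \<le> L * norm (u - v)"
          using uv by (simp add: nemytskii_apply[OF V])
      qed (use \<delta> in auto)
      also have "\<dots> \<le> 1/2 * dist u v"
        using mult_right_mono[OF \<delta>(3), of "norm (u - v)"] by (simp add: dist_norm)
      finally show ?thesis .
    qed
  qed auto
  then show ?thesis using S by metis
qed

definition sol :: "'e \<Rightarrow> 'e curve" where
  "sol z = (SOME u. (\<forall>s. apply_bcontfun u s \<in> K) \<and> u = const_bcontfun z + antideriv (nemytskii V u))"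

lemma sol:
  assumes "z \<in> K1"
  shows "apply_bcontfun (sol z) s \<in> K" "apply_bcontfun (sol z) s \<in> U"
    "sol z = const_bcontfun z + antideriv (nemytskii V (sol z))"
  using someI_ex[OF sol_exists[OF assms]] K(2) unfolding sol_def by blast+

lemma sol_apply:
  assumes z: "z \<in> K1"
  shows "apply_bcontfun (sol z) t = z + integral {0..clamp_time t} (apply_bcontfun (nemytskii V (sol z)))"
proof -
  have "apply_bcontfun (sol z) t = apply_bcontfun (const_bcontfun z + antideriv (nemytskii V (sol z))) t"
    using sol(3)[OF z] by (rule arg_cong)
  also have "\<dots> = z + integral {0..clamp_time t} (apply_bcontfun (nemytskii V (sol z)))"
    by (simp add: antideriv_apply)
  finally show ?thesis .
qed

lemma sol_0: "z \<in> K1 \<Longrightarrow> apply_bcontfun (sol z) 0 = z"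
  by (subst sol_apply) (simp_all add: clamp_time)

lemma sol_has_vector_derivative:
  assumes z: "z \<in> K1" and t: "t \<in> {0..\<delta>}"
  shows "(apply_bcontfun (sol z) has_vector_derivative V (sol z t)) (at t within {0..\<delta>})"
proof -
  let ?N = "apply_bcontfun (nemytskii V (sol z))"
  have "((\<lambda>t. integral {0..t} ?N) has_vector_derivative ?N t) (at t within {0..\<delta>})"
    using t by (intro integral_has_vector_derivative) simp_all
  from has_vector_derivative_add[OF has_vector_derivative_const[of z] this]
  have d: "((\<lambda>t. z + integral {0..t} ?N) has_vector_derivative ?N t) (at t within {0..\<delta>})" by simp
  have e: "apply_bcontfun (sol z) s = z + integral {0..s} ?N" if "s \<in> {0..\<delta>}" for s
    using sol_apply[OF z, of s] clamp_time(3)[OF that] by simp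
  have N: "?N t = V (sol z t)" by (rule nemytskii_apply[OF V sol(2)[OF z]])
  show ?thesis
    using has_vector_derivative_transform[OF t e d] unfolding N .
qed

text \<open>
  Stated for arbitrary solutions of the integral equation, so that it also gives uniqueness: a solution
  found by other means, such as a constant one, is the one selected by \<open>sol\<close>.
\<close>
lemma fixed_point_lipschitz:
  assumes u: "\<And>s. apply_bcontfun u s \<in> U" "u = const_bcontfun z + antideriv (nemytskii V u)"
    and v: "\<And>s. apply_bcontfun v s \<in> U" "v = const_bcontfun z' + antideriv (nemytskii V v)"
  shows "norm (u - v) \<le> 2 * norm (z - z')"
proof -
  have "u - v = (const_bcontfun z + antideriv (nemytskii V u)) - (const_bcontfun z' + antideriv (nemytskii V v))"
    using u(2) v(2) by metis
  also have "\<dots> = const_bcontfun (z - z') + antideriv (nemytskii V u - nemytskii V v)"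
    by (auto intro!: bcontfun_eqI simp: antideriv.diff)
  finally have "norm (u - v) \<le> norm (const_bcontfun (z - z') :: 'e curve) + norm (antideriv (nemytskii V u - nemytskii V v))"
    using norm_triangle_ineq by metis
  moreover have "norm (const_bcontfun (z - z') :: 'e curve) \<le> norm (z - z')" by (rule norm_bound) simp
  moreover have "norm (antideriv (nemytskii V u - nemytskii V v)) \<le> \<delta> * (L * norm (u - v))"
  proof (rule order_trans[OF norm_antideriv_le], intro mult_left_mono norm_bound)
    fix s
    have "norm (V (u s) - V (v s)) \<le> L * norm ((u - v) s)" using V_lip u v by simp
    also have "\<dots> \<le> L * norm (u - v)" using \<delta> by (intro mult_left_mono norm_bounded) simp
    finally show "norm (apply_bcontfun (nemytskii V u - nemytskii V v) s) \<le> L * norm (u - v)"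
      using u v by (simp add: nemytskii_apply[OF V])
  qed (use \<delta> in auto)
  moreover have "\<delta> * (L * norm (u - v)) \<le> 1/2 * norm (u - v)"
    using mult_right_mono[OF \<delta>(3), of "norm (u - v)"] by simp
  ultimately show ?thesis by linarith
qed

lemma sol_lipschitz:
  assumes "z \<in> K1" "z' \<in> K1"
  shows "norm (sol z - sol z') \<le> 2 * norm (z - z')"
  by (rule fixed_point_lipschitz) (rule sol assms)+

text \<open>
  The derivative of the superposition operator, that is, multiplication by \<open>f' (u s)\<close>. Writing it in coordinates
  reduces it to the superposition operators of the partial derivatives of \<open>f\<close>, which are of the same kind as
  that of \<open>f\<close>; the induction in \<open>Cb_nemytskii_sol\<close> depends on this.
\<close>
definition nemytskii_deriv :: "('e \<Rightarrow> 'e) \<Rightarrow> 'e curve \<Rightarrow> 'e curve \<Rightarrow>\<^sub>L 'e curve" where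
  "nemytskii_deriv f u = (\<Sum>b\<in>Basis. bounded_bilinear.prod_right (curve_mul b)
     (nemytskii (\<lambda>x. frechet_derivative f (at x) b) u))"

lemma nemytskii_deriv_apply:
  assumes f: "smooth_bdd U f" and u: "\<And>s. apply_bcontfun u s \<in> U"
  shows "apply_bcontfun (nemytskii_deriv f u h) s = frechet_derivative f (at (u s)) (h s)"
proof -
  interpret D: bounded_linear "frechet_derivative f (at (u s))"
    using smooth_bddD(1)[OF U(1) f u] by (rule has_derivative_bounded_linear)
  interpret ev: bounded_linear "\<lambda>u::'e curve. apply_bcontfun u s" by (rule bounded_linear_curve_eval)
  have "apply_bcontfun (nemytskii_deriv f u h) s = (\<Sum>b\<in>Basis. (h s \<bullet> b) *\<^sub>R frechet_derivative f (at (u s)) b)"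
    by (simp add: nemytskii_deriv_def blinfun.sum_left ev.sum nemytskii_apply[OF smooth_bddD(2)[OF U(1) f] u]
        bounded_bilinear.prod_right.rep_eq[OF bounded_bilinear_curve_mul])
  also have "\<dots> = frechet_derivative f (at (u s)) (h s)"
    by (subst (2) euclidean_representation[of "h s", symmetric]) (simp only: D.sum D.scaleR)
  finally show ?thesis .
qed

lemma nemytskii_taylor:
  assumes f: "smooth_bdd U f"
  shows "\<exists>C>0. \<forall>u v. (\<forall>s. apply_bcontfun u s \<in> U) \<longrightarrow> (\<forall>s. apply_bcontfun v s \<in> U) \<longrightarrow>
    norm (nemytskii f v - nemytskii f u - nemytskii_deriv f u (v - u)) \<le> C * (norm (v - u))\<^sup>2"
proof -
  obtain C where C: "C > 0" "\<And>x y. x \<in> U \<Longrightarrow> y \<in> U \<Longrightarrow>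
      norm (f y - f x - frechet_derivative f (at x) (y - x)) \<le> C * (norm (y - x))\<^sup>2"
    using Cb_taylor[OF U(2,1), of 0 f] f unfolding smooth_bdd_def by blast
  have "norm (nemytskii f v - nemytskii f u - nemytskii_deriv f u (v - u)) \<le> C * (norm (v - u))\<^sup>2"
    if uv: "\<forall>s. apply_bcontfun u s \<in> U" "\<forall>s. apply_bcontfun v s \<in> U" for u v
  proof (rule norm_bound)
    fix s
    have "norm (f (v s) - f (u s) - frechet_derivative f (at (u s)) (v s - u s)) \<le> C * (norm ((v - u) s))\<^sup>2"
      using C(2) uv by simp
    also have "\<dots> \<le> C * (norm (v - u))\<^sup>2"
      using C(1) by (intro mult_left_mono power_mono norm_bounded) auto
    finally show "norm (apply_bcontfun (nemytskii f v - nemytskii f u - nemytskii_deriv f u (v - u)) s) \<le> C * (norm (v - u))\<^sup>2"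
      using uv by (simp add: nemytskii_apply[OF f] nemytskii_deriv_apply[OF f])
  qed
  with C(1) show ?thesis by blast
qed

text \<open>
  The integral operator of the variational equation along \<open>u\<close>. Solutions of the variational equation are
  values of its resolvent.
\<close>
definition linearization :: "'e curve \<Rightarrow> 'e curve \<Rightarrow>\<^sub>L 'e curve" where
  "linearization u = Blinfun antideriv o\<^sub>L nemytskii_deriv V u"

lemma linearization_apply: "linearization u h = antideriv (nemytskii_deriv V u h)"
  by (simp add: linearization_def bounded_linear_Blinfun_apply[OF bounded_linear_antideriv])

lemma norm_linearization:
  assumes u: "\<And>s. apply_bcontfun u s \<in> U"
  shows "norm (linearization u) \<le> 1/2"
proof (rule norm_blinfun_bound)
  fix h
  have "norm (linearization u h) \<le> \<delta> * norm (nemytskii_deriv V u h)" by (simp add: linearization_apply norm_antideriv_le)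
  also have "\<dots> \<le> \<delta> * (L * norm h)"
  proof (intro mult_left_mono norm_bound)
    fix s show "norm (apply_bcontfun (nemytskii_deriv V u h) s) \<le> L * norm h"
      using order_trans[OF V_deriv[OF u, of s "h s"] mult_left_mono[OF norm_bounded[of h s], of L]] \<delta>
      by (simp add: nemytskii_deriv_apply[OF V u])
  qed (use \<delta> in auto)
  also have "\<dots> \<le> 1/2 * norm h" using mult_right_mono[OF \<delta>(3), of "norm h"] by simp
  finally show "norm (linearization u h) \<le> 1/2 * norm h" .
qed simp

lemma linearization_lipschitz:
  "\<exists>C>0. \<forall>u v. (\<forall>s. apply_bcontfun u s \<in> U) \<longrightarrow> (\<forall>s. apply_bcontfun v s \<in> U) \<longrightarrow>
    norm (linearization v - linearization u) \<le> C * norm (v - u)"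
proof -
  obtain C where C: "C > 0" "\<And>x y h. x \<in> U \<Longrightarrow> y \<in> U \<Longrightarrow>
      norm (frechet_derivative V (at x) h - frechet_derivative V (at y) h) \<le> C * norm (x - y) * norm h"
    using Cb_derivative_lipschitz[OF U(2,1), of 0 V] V unfolding smooth_bdd_def by blast
  have "norm (linearization v - linearization u) \<le> (\<delta> * C) * norm (v - u)"
    if uv: "\<forall>s. apply_bcontfun u s \<in> U" "\<forall>s. apply_bcontfun v s \<in> U" for u v
  proof (rule norm_blinfun_bound)
    fix h
    have "norm ((linearization v - linearization u) h) \<le> \<delta> * norm (nemytskii_deriv V v h - nemytskii_deriv V u h)"
      by (simp add: blinfun.bilinear_simps linearization_apply antideriv.diff[symmetric] norm_antideriv_le)
    also have "\<dots> \<le> \<delta> * (C * norm (v - u) * norm h)"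
    proof (intro mult_left_mono norm_bound)
      fix s
      have "norm (frechet_derivative V (at (v s)) (h s) - frechet_derivative V (at (u s)) (h s))
         \<le> C * norm ((v - u) s) * norm (h s)" using C(2) uv by simp
      also have "\<dots> \<le> C * norm (v - u) * norm h"
        using C(1) by (intro mult_mono mult_left_mono norm_bounded) auto
      finally show "norm (apply_bcontfun (nemytskii_deriv V v h - nemytskii_deriv V u h) s) \<le> C * norm (v - u) * norm h"
        using uv by (simp add: nemytskii_deriv_apply[OF V])
    qed (use \<delta> in auto)
    finally show "norm ((linearization v - linearization u) h) \<le> (\<delta> * C) * norm (v - u) * norm h" by (simp add: ac_simps)
  qed (use \<delta> C in auto)
  moreover have "\<delta> * C > 0" using \<delta> C by simp
  ultimately show ?thesis by blast
qed

text \<open>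
  Subtracting the two integral equations and moving the linear part to the left leaves the resolvent of the
  linearisation applied to the change of the initial value and to a quadratic remainder.
\<close>
lemma sol_difference:
  assumes "z \<in> K1" "z' \<in> K1"
  shows "sol z' - sol z = resolvent (linearization (sol z)) (const_bcontfun (z' - z) +
     antideriv (nemytskii V (sol z') - nemytskii V (sol z) - nemytskii_deriv V (sol z) (sol z' - sol z)))"
proof -
  let ?u = "sol z" and ?v = "sol z'"
  have "?v - ?u = const_bcontfun (z' - z) + antideriv (nemytskii V ?v - nemytskii V ?u)"
    by (subst sol(3)[OF assms(1)], subst sol(3)[OF assms(2)])
      (auto intro!: bcontfun_eqI simp: antideriv.diff)
  then have "?v - ?u = linearization ?u (?v - ?u) + (const_bcontfun (z' - z) +
     antideriv (nemytskii V ?v - nemytskii V ?u - nemytskii_deriv V ?u (?v - ?u)))"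
    by (simp add: linearization_apply antideriv.diff)
  then show ?thesis using resolvent(2)[OF norm_linearization[OF sol(2)[OF assms(1)]]] by blast
qed

context
  fixes S :: "'p::euclidean_space set" and \<iota> :: "'p \<Rightarrow> 'e" and \<l> :: "'p \<Rightarrow> 'e"
  assumes S: "open S" and \<iota>: "\<And>w. w \<in> S \<Longrightarrow> \<iota> w \<in> K1"
    and \<l>: "bounded_linear \<l>" "\<And>w w'. \<iota> w' - \<iota> w = \<l> (w' - w)"
begin

lemma sol_param_lipschitz:
  "\<exists>C>0. \<forall>w\<in>S. \<forall>w'\<in>S. norm (sol (\<iota> w') - sol (\<iota> w)) \<le> C * norm (w' - w)"
proof -
  obtain B where B: "B > 0" "\<And>w. norm (\<l> w) \<le> norm w * B"
    using bounded_linear.pos_bounded[OF \<l>(1)] by blast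
  have "norm (sol (\<iota> w') - sol (\<iota> w)) \<le> (2 * B) * norm (w' - w)" if "w \<in> S" "w' \<in> S" for w w'
    using sol_lipschitz[OF \<iota>[OF that(2)] \<iota>[OF that(1)]] B(2)[of "w' - w"] \<l>(2)[of w' w]
    by (simp add: mult.commute mult.left_commute)
  moreover have "2 * B > 0" using B by simp
  ultimately show ?thesis by blast
qed

text \<open>
  The trajectory is Lipschitz in the initial value, so the remainder in \<open>sol_difference\<close> is quadratic in
  the parameter increment.
\<close>
lemma sol_has_derivative:
  assumes w: "w \<in> S"
  shows "((\<lambda>w. sol (\<iota> w)) has_derivative
    (\<lambda>h. resolvent (linearization (sol (\<iota> w))) (const_bcontfun (\<l> h)))) (at w)"
proof -
  let ?u = "sol (\<iota> w)" let ?R = "resolvent (linearization ?u)"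
  obtain B where B: "B > 0" "\<And>w'. w' \<in> S \<Longrightarrow> norm (sol (\<iota> w') - ?u) \<le> B * norm (w' - w)"
    using sol_param_lipschitz w by blast
  obtain C where C: "C > 0" "\<And>v. (\<forall>s. apply_bcontfun v s \<in> U) \<Longrightarrow>
    norm (nemytskii V v - nemytskii V ?u - nemytskii_deriv V ?u (v - ?u)) \<le> C * (norm (v - ?u))\<^sup>2"
    using nemytskii_taylor[OF V] sol(2)[OF \<iota>[OF w]] by blast
  have R: "norm (?R x) \<le> 2 * norm x" for x
    using norm_blinfun[of ?R x] mult_right_mono[OF resolvent(1)[OF norm_linearization[OF sol(2)[OF \<iota>[OF w]]]], of "norm x"]
    by simp
  have A: "bounded_linear (\<lambda>h. ?R (const_bcontfun (\<l> h)))"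
    by (intro bounded_linear_compose[OF blinfun.bounded_linear_right]
        bounded_linear_compose[OF bounded_linear_const_curve] \<l>(1))
  show ?thesis
  proof (rule has_derivative_via_quadratic[OF has_derivative_ident A S w])
    fix y assume y: "y \<in> S"
    let ?v = "sol (\<iota> y)"
    let ?r = "nemytskii V ?v - nemytskii V ?u - nemytskii_deriv V ?u (?v - ?u)"
    have "?v - ?u = ?R (const_bcontfun (\<l> (y - w)) + antideriv ?r)"
      using sol_difference[OF \<iota>[OF w] \<iota>[OF y]] unfolding \<l>(2) .
    then have "?v - ?u - ?R (const_bcontfun (\<l> (y - w)))
      = ?R (const_bcontfun (\<l> (y - w)) + antideriv ?r) - ?R (const_bcontfun (\<l> (y - w)))"
      by (rule arg_cong)
    also have "\<dots> = ?R (antideriv ?r)" by (simp only: blinfun.add_right add_diff_cancel_left')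
    finally have "?v - ?u - ?R (const_bcontfun (\<l> (y - w))) = ?R (antideriv ?r)" .
    then have "norm (?v - ?u - ?R (const_bcontfun (\<l> (y - w)))) \<le> 2 * norm (antideriv ?r)" using R by simp
    also have "\<dots> \<le> 2 * (\<delta> * norm ?r)" using norm_antideriv_le by (intro mult_left_mono) auto
    also have "\<dots> \<le> 2 * (\<delta> * (C * (norm (?v - ?u))\<^sup>2))"
      using C(2) sol(2)[OF \<iota>[OF y]] \<delta> by (intro mult_left_mono) auto
    also have "\<dots> \<le> 2 * (\<delta> * (C * (B * norm (y - w))\<^sup>2))"
      using B(2)[OF y] \<delta> C by (intro mult_left_mono power_mono) auto
    finally show "norm (?v - ?u - ?R (const_bcontfun (\<l> (y - w)))) \<le> (2 * \<delta> * C * B\<^sup>2) * (norm (y - w))\<^sup>2"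
      by (simp add: power_mult_distrib ac_simps)
  qed
qed

lemma Cb_resolvent_linearization:
  assumes N: "\<And>f. smooth_bdd U f \<Longrightarrow> Cb k S (\<lambda>w. nemytskii f (sol (\<iota> w)))"
  shows "Cb k S (\<lambda>w. resolvent (linearization (sol (\<iota> w))))"
proof -
  have lin: "Cb k S (\<lambda>w. linearization (sol (\<iota> w)))"
    unfolding linearization_def nemytskii_deriv_def
    by (intro Cb_linear[OF bounded_bilinear.bounded_linear_right[OF bounded_bilinear_blinfun_compose]]
        Cb_sum Cb_linear[OF bounded_bilinear.bounded_linear_prod_right[OF bounded_bilinear_curve_mul]]
        N smooth_bddD(2)[OF U(1) V])
  have nl: "norm (linearization (sol (\<iota> w))) \<le> 1/2" if "w \<in> S" for w
    by (rule norm_linearization[OF sol(2)[OF \<iota>[OF that]]])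
  obtain C where C: "C > 0" "\<And>u v. (\<forall>s. apply_bcontfun u s \<in> U) \<Longrightarrow> (\<forall>s. apply_bcontfun v s \<in> U) \<Longrightarrow>
    norm (linearization v - linearization u) \<le> C * norm (v - u)" using linearization_lipschitz by blast
  obtain B where B: "B > 0" "\<And>w w'. w \<in> S \<Longrightarrow> w' \<in> S \<Longrightarrow> norm (sol (\<iota> w') - sol (\<iota> w)) \<le> B * norm (w' - w)"
    using sol_param_lipschitz by blast
  show ?thesis
  proof (rule Cb_inverse_family[OF bounded_bilinear_blinfun_compose bounded_bilinear_blinfun_compose S
        resolvent_identity[OF nl nl] _ _ lin])
    show "bounded ((\<lambda>w. resolvent (linearization (sol (\<iota> w)))) ` S)"
      unfolding bounded_iff using resolvent(1)[OF nl] by blast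
    fix y z assume yz: "y \<in> S" "z \<in> S"
    have "norm (linearization (sol (\<iota> y)) - linearization (sol (\<iota> z))) \<le> C * norm (sol (\<iota> y) - sol (\<iota> z))"
      using C(2) sol(2) \<iota> yz by blast
    also have "\<dots> \<le> C * (B * norm (y - z))" using B(2) C(1) yz by (intro mult_left_mono) auto
    finally show "norm (linearization (sol (\<iota> y)) - linearization (sol (\<iota> z))) \<le> (C * B) * norm (y - z)" by simp
  qed
qed

text \<open>
  The bootstrap for the flow. The derivative of \<open>f \<circ> u\<close> is a sum of products of superposition operators
  of partial derivatives of \<open>f\<close> with the resolvent of the linearisation, and the latter is built from
  the superposition operators of the partial derivatives of \<open>V\<close>. Hence regularity of order \<open>k\<close> for all
  smooth \<open>f\<close> at once implies regularity of order \<open>k + 1\<close>.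
\<close>
lemma Cb_nemytskii_sol: "smooth_bdd U f \<Longrightarrow> Cb k S (\<lambda>w. nemytskii f (sol (\<iota> w)))"
proof (induction k arbitrary: f)
  case 0
  have "bounded (f ` U)" using 0 Cb_bounded unfolding smooth_bdd_def by blast
  then obtain B where B: "\<And>x. x \<in> U \<Longrightarrow> norm (f x) \<le> B" unfolding bounded_iff by blast
  have "norm (nemytskii f (sol (\<iota> w))) \<le> B" if "w \<in> S" for w
    using B sol(2)[OF \<iota>[OF that]] by (intro norm_bound) (simp add: nemytskii_apply[OF 0])
  then show ?case by (auto simp: bounded_iff)
next
  case (Suc k)
  note f = Suc.prems
  let ?u = "\<lambda>w. sol (\<iota> w)"
  have bd: "bounded ((\<lambda>w. nemytskii f (?u w)) ` S)" using Cb_bounded[OF Suc.IH[OF f]] .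
  obtain B where B: "B > 0" "\<And>w w'. w \<in> S \<Longrightarrow> w' \<in> S \<Longrightarrow> norm (?u w' - ?u w) \<le> B * norm (w' - w)"
    using sol_param_lipschitz by blast
  obtain C where C: "C > 0" "\<And>u v. (\<forall>s. apply_bcontfun u s \<in> U) \<Longrightarrow> (\<forall>s. apply_bcontfun v s \<in> U) \<Longrightarrow>
    norm (nemytskii f v - nemytskii f u - nemytskii_deriv f u (v - u)) \<le> C * (norm (v - u))\<^sup>2"
    using nemytskii_taylor[OF f] by blast
  show ?case
  proof (rule Cb_SucI[OF bd])
    show "((\<lambda>w. nemytskii f (?u w)) has_derivative
       (\<lambda>h. nemytskii_deriv f (?u w) (resolvent (linearization (?u w)) (const_bcontfun (\<l> h))))) (at w)" if w: "w \<in> S" for w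
    proof (rule has_derivative_via_quadratic[OF sol_has_derivative[OF w] blinfun.bounded_linear_right S w])
      fix y assume y: "y \<in> S"
      have "norm (nemytskii f (?u y) - nemytskii f (?u w) - nemytskii_deriv f (?u w) (?u y - ?u w)) \<le> C * (norm (?u y - ?u w))\<^sup>2"
        using C(2) sol(2) \<iota> w y by blast
      also have "\<dots> \<le> C * (B * norm (y - w))\<^sup>2"
        using B(2)[OF w y] C(1) by (intro mult_left_mono power_mono) auto
      finally show "norm (nemytskii f (?u y) - nemytskii f (?u w) - nemytskii_deriv f (?u w) (?u y - ?u w)) \<le> (C * B\<^sup>2) * (norm (y - w))\<^sup>2"
        by (simp add: power_mult_distrib ac_simps)
    qed
    show "Cb k S (\<lambda>w. nemytskii_deriv f (?u w) (resolvent (linearization (?u w)) (const_bcontfun (\<l> v))))" for v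
      unfolding nemytskii_deriv_def
      by (intro Cb_bilinear[OF bounded_bilinear_blinfun_apply] Cb_sum Cb_const Cb_resolvent_linearization Suc.IH
        Cb_linear[OF bounded_bilinear.bounded_linear_prod_right[OF bounded_bilinear_curve_mul]]
        smooth_bddD(2)[OF U(1) f])
  qed
qed

lemma smooth_bdd_sol:
  assumes "bounded (\<iota> ` S)"
  shows "smooth_bdd S (\<lambda>w. apply_bcontfun (sol (\<iota> w)) t)"
proof -
  have bd: "bounded ((\<lambda>w. sol (\<iota> w)) ` S)"
  proof -
    obtain B where B: "\<And>w. w \<in> S \<Longrightarrow> norm (\<iota> w) \<le> B" using assms unfolding bounded_iff by blast
    have "norm (sol (\<iota> w)) \<le> B + \<delta> * L" if w: "w \<in> S" for w
    proof -
      have "norm (sol (\<iota> w)) \<le> norm (const_bcontfun (\<iota> w) :: 'e curve) + norm (antideriv (nemytskii V (sol (\<iota> w))))"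
        using norm_triangle_ineq sol(3)[OF \<iota>[OF w]] by metis
      moreover have "norm (const_bcontfun (\<iota> w) :: 'e curve) \<le> B" using B[OF w] by (intro norm_bound) simp
      moreover have "norm (antideriv (nemytskii V (sol (\<iota> w)))) \<le> \<delta> * L"
        using \<delta> V_bound sol(2)[OF \<iota>[OF w]]
        by (intro order_trans[OF norm_antideriv_le] mult_left_mono norm_bound) (auto simp: nemytskii_apply[OF V])
      ultimately show ?thesis by linarith
    qed
    then show ?thesis unfolding bounded_iff by blast
  qed
  have "Cb (Suc k) S (\<lambda>w. sol (\<iota> w))" for k
  proof (rule Cb_SucI[OF bd sol_has_derivative])
    show "Cb k S (\<lambda>w. resolvent (linearization (sol (\<iota> w))) (const_bcontfun (\<l> v)))" for v
      by (intro Cb_bilinear[OF bounded_bilinear_blinfun_apply] Cb_const Cb_resolvent_linearization Cb_nemytskii_sol)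
  qed
  then have "Cb k S (\<lambda>w. sol (\<iota> w))" for k using Cb_Suc_imp by blast
  then show ?thesis unfolding smooth_bdd_def using Cb_linear[OF bounded_linear_curve_eval] by blast
qed

end

end

context flow_setup
begin

lemma sol_equilibrium:
  assumes z: "z \<in> K1" and V0: "V z = 0"
  shows "sol z = const_bcontfun z"
proof -
  have zU: "apply_bcontfun (const_bcontfun z :: 'e curve) s \<in> U" for s using near[OF z, of z] K by auto
  have "nemytskii V (const_bcontfun z) = 0"
    by (rule bcontfun_eqI) (simp add: nemytskii_apply[OF V zU] V0)
  then have "const_bcontfun z = const_bcontfun z + antideriv (nemytskii V (const_bcontfun z))"
    by (simp add: antideriv.zero)
  from fixed_point_lipschitz[OF sol(2)[OF z] sol(3)[OF z] zU this] show ?thesis by simp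
qed

text \<open>
  Near an equilibrium \<open>zc\<close> two trajectories separate as the linearisation at \<open>zc\<close> predicts. Both the
  difference of the trajectories and the linear prediction \<open>P\<close> satisfy linear integral equations with the same
  contracting operator, up to the error \<open>V u - V v - V'(zc) (u - v)\<close>, whose Lipschitz constant is
  proportional to the distance \<open>\<rho>\<close> from \<open>zc\<close>.
\<close>
lemma sol_difference_near_equilibrium:
  shows "\<exists>C>0. \<forall>zc z z' P \<rho>. zc \<in> K1 \<longrightarrow> z \<in> K1 \<longrightarrow> z' \<in> K1 \<longrightarrow> V zc = 0 \<longrightarrow>
     norm (z - zc) \<le> \<rho> \<longrightarrow> norm (z' - zc) \<le> \<rho> \<longrightarrow> P 0 = z - z' \<longrightarrow>
     (\<forall>s\<in>{0..\<delta>}. (P has_vector_derivative frechet_derivative V (at zc) (P s)) (at s within {0..\<delta>})) \<longrightarrow>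
     norm (sol z \<delta> - sol z' \<delta> - P \<delta>) \<le> C * \<rho> * norm (z - z')"
proof -
  obtain C where C: "C > 0" "\<And>x y h. x \<in> U \<Longrightarrow> y \<in> U \<Longrightarrow>
      norm (frechet_derivative V (at x) h - frechet_derivative V (at y) h) \<le> C * norm (x - y) * norm h"
    using Cb_derivative_lipschitz[OF U(2,1), of 0 V] V unfolding smooth_bdd_def by blast
  have "norm (sol z \<delta> - sol z' \<delta> - P \<delta>) \<le> (8 * \<delta> * C) * \<rho> * norm (z - z')"
    if zc: "zc \<in> K1" "V zc = 0" and z: "z \<in> K1" "z' \<in> K1" and \<rho>: "norm (z - zc) \<le> \<rho>" "norm (z' - zc) \<le> \<rho>"
      and P: "P 0 = z - z'" "\<And>s. s \<in> {0..\<delta>} \<Longrightarrow> (P has_vector_derivative frechet_derivative V (at zc) (P s)) (at s within {0..\<delta>})"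
    for zc z z' P \<rho>
  proof -
    let ?u = "sol z" and ?v = "sol z'" and ?c = "const_bcontfun zc :: 'e curve"
    let ?D = "frechet_derivative V (at zc)"
    have cU: "apply_bcontfun ?c s \<in> U" for s using near[OF zc(1), of zc] K by auto
    have zcU: "zc \<in> U" using cU by simp
    interpret D: bounded_linear ?D
      using smooth_bddD(1)[OF U(1) V zcU] by (rule has_derivative_bounded_linear)
    have contP: "continuous_on {0..\<delta>} P"
      using P(2) by (meson continuous_on_eq_continuous_within has_vector_derivative_continuous)
    have "continuous_on UNIV (\<lambda>s. P (clamp_time s))"
      by (rule continuous_on_compose2[OF contP continuous_clamp_time]) (auto simp: clamp_time)
    moreover have "bounded (range (\<lambda>s. P (clamp_time s)))"
      by (rule bounded_subset[OF compact_imp_bounded[OF compact_continuous_image[OF contP]]]) (auto simp: clamp_time)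
    ultimately have "(\<lambda>s. P (clamp_time s)) \<in> bcontfun" by (simp add: bcontfun_def)
    define Ph where "Ph = Bcontfun (\<lambda>s. P (clamp_time s))"
    have Ph: "apply_bcontfun Ph s = P (clamp_time s)" for s
      using \<open>_ \<in> bcontfun\<close> by (simp add: Ph_def Bcontfun_inverse)
    \<comment> \<open>the variational equation for \<open>P\<close> in integral form\<close>
    have Pfix: "Ph = const_bcontfun (z - z') + antideriv (nemytskii_deriv V ?c Ph)"
    proof (rule bcontfun_eqI)
      fix t
      have "((\<lambda>s. ?D (P s)) has_integral P (clamp_time t) - P 0) {0..clamp_time t}"
      proof (rule fundamental_theorem_of_calculus)
        show "(P has_vector_derivative ?D (P s)) (at s within {0..clamp_time t})" if "s \<in> {0..clamp_time t}" for s
          by (rule has_vector_derivative_within_subset[OF P(2)]) (use that clamp_time(2)[of t] in auto)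
      qed (rule clamp_time)
      then have "integral {0..clamp_time t} (\<lambda>s. ?D (P s)) = P (clamp_time t) - (z - z')" by (simp add: P(1) integral_unique)
      moreover have "integral {0..clamp_time t} (\<lambda>s. ?D (P s)) = integral {0..clamp_time t} (apply_bcontfun (nemytskii_deriv V ?c Ph))"
        by (rule integral_cong) (use clamp_time(2)[of t] in \<open>auto simp: nemytskii_deriv_apply[OF V cU] Ph clamp_time(3)\<close>)
      ultimately show "apply_bcontfun Ph t = apply_bcontfun (const_bcontfun (z - z') + antideriv (nemytskii_deriv V ?c Ph)) t"
        by (simp add: antideriv_apply Ph)
    qed
    define r where "r = nemytskii V ?u - nemytskii V ?v - nemytskii_deriv V ?c (?u - ?v)"
    define e where "e = ?u - ?v - Ph"
    have "?u - ?v = const_bcontfun (z - z') + antideriv (nemytskii V ?u - nemytskii V ?v)"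
      using arg_cong2[OF sol(3)[OF z(1)] sol(3)[OF z(2)], of "(-)"]
      by (auto intro!: bcontfun_eqI simp: antideriv.diff fun_eq_iff)
    then have "e = (const_bcontfun (z - z') + antideriv (nemytskii V ?u - nemytskii V ?v)) - (const_bcontfun (z - z') + antideriv (nemytskii_deriv V ?c Ph))"
      unfolding e_def using Pfix by metis
    also have "\<dots> = antideriv r + linearization ?c e"
      by (simp add: e_def r_def linearization_apply antideriv.diff antideriv.add blinfun.bilinear_simps)
    finally have "norm e \<le> norm (antideriv r) + norm (linearization ?c e)" using norm_triangle_ineq by metis
    moreover have "norm (linearization ?c e) \<le> 1/2 * norm e"
      using norm_blinfun[of "linearization ?c" e] mult_right_mono[OF norm_linearization[OF cU], of "norm e"] by simp
    ultimately have e1: "norm e \<le> 2 * (\<delta> * norm r)" using norm_antideriv_le[of r] by linarith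
    have close: "norm (sol w s - zc) \<le> 2 * \<rho>" if "w \<in> K1" "norm (w - zc) \<le> \<rho>" for w s
    proof -
      have "norm (sol w s - zc) \<le> norm (sol w - sol zc)"
        using norm_bounded[of "sol w - sol zc" s] by (simp add: sol_equilibrium[OF zc])
      also have "\<dots> \<le> 2 * \<rho>" using sol_lipschitz[OF that(1) zc(1)] that(2) by simp
      finally show ?thesis .
    qed
    have "norm r \<le> C * (2 * \<rho>) * (2 * norm (z - z'))"
    proof (rule norm_bound)
      fix s
      let ?B = "U \<inter> cball zc (2 * \<rho>)"
      have m: "?u s \<in> ?B" "?v s \<in> ?B"
        using sol(2) z close[OF z(1) \<rho>(1), of s] close[OF z(2) \<rho>(2), of s]
        by (auto simp: dist_norm norm_minus_commute)
      have "norm ((V (?u s) - ?D (?u s)) - (V (?v s) - ?D (?v s))) \<le> C * (2 * \<rho>) * norm (?u s - ?v s)"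
      proof (rule differentiable_bound[OF _ _ _ m, where f'="\<lambda>x h. frechet_derivative V (at x) h - ?D h"])
        show "convex ?B" using U(2) by (intro convex_Int) auto
        show "((\<lambda>x. V x - ?D x) has_derivative (\<lambda>h. frechet_derivative V (at x) h - ?D h)) (at x within ?B)"
          if "x \<in> ?B" for x
          using has_derivative_at_withinI[OF smooth_bddD(1)[OF U(1) V]] that
            bounded_linear_imp_has_derivative[OF D.bounded_linear_axioms]
          by (intro has_derivative_diff) auto
        show "onorm (\<lambda>h. frechet_derivative V (at x) h - ?D h) \<le> C * (2 * \<rho>)" if "x \<in> ?B" for x
        proof (rule onorm_le)
          fix h
          have "norm (frechet_derivative V (at x) h - ?D h) \<le> C * norm (x - zc) * norm h" using C(2) that zcU by blast
          also have "\<dots> \<le> C * (2 * \<rho>) * norm h"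
            using that C(1) by (intro mult_right_mono mult_left_mono) (auto simp: dist_norm norm_minus_commute)
          finally show "norm (frechet_derivative V (at x) h - ?D h) \<le> C * (2 * \<rho>) * norm h" .
        qed
      qed
      also have "\<dots> \<le> C * (2 * \<rho>) * (2 * norm (z - z'))"
        using norm_bounded[of "?u - ?v" s] sol_lipschitz[OF z] C(1) order_trans[OF norm_ge_zero \<rho>(1)]
        by (intro mult_left_mono) auto
      finally show "norm (apply_bcontfun r s) \<le> C * (2 * \<rho>) * (2 * norm (z - z'))"
        using sol(2) z by (simp add: r_def nemytskii_apply[OF V] nemytskii_deriv_apply[OF V cU] D.diff algebra_simps)
    qed
    then have "2 * (\<delta> * norm r) \<le> 2 * (\<delta> * (C * (2 * \<rho>) * (2 * norm (z - z'))))"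
      using \<delta> by (intro mult_left_mono) auto
    with e1 have "norm e \<le> (8 * \<delta> * C) * \<rho> * norm (z - z')" by (simp add: mult.assoc mult.left_commute)
    moreover have "norm (sol z \<delta> - sol z' \<delta> - P \<delta>) \<le> norm e"
      using norm_bounded[of e \<delta>] by (simp add: e_def Ph clamp_time)
    ultimately show ?thesis by linarith
  qed
  moreover have "8 * \<delta> * C > 0" using \<delta> C by simp
  ultimately show ?thesis by blast
qed

end

text \<open>
  Gronwall's argument in differential form: \<open>exp (-2 L s)\<close> times the squared distance does not increase.
\<close>
lemma ode_unique:
  fixes z1 z2 :: "real \<Rightarrow> 'e::euclidean_space"
  assumes T: "0 \<le> T"
    and d1: "\<And>s. s \<in> {0..T} \<Longrightarrow> (z1 has_vector_derivative V (z1 s)) (at s within {0..T})"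
    and d2: "\<And>s. s \<in> {0..T} \<Longrightarrow> (z2 has_vector_derivative V (z2 s)) (at s within {0..T})"
    and lip: "\<And>s. s \<in> {0..T} \<Longrightarrow> norm (V (z1 s) - V (z2 s)) \<le> L * norm (z1 s - z2 s)"
    and init: "z1 0 = z2 0"
  shows "z1 T = z2 T"
proof -
  let ?d = "\<lambda>s. z1 s - z2 s" and ?dV = "\<lambda>s. V (z1 s) - V (z2 s)"
  define f where "f s = exp (- 2 * L * s) * (?d s \<bullet> ?d s)" for s
  have d': "(?d has_vector_derivative ?dV s) (at s within {0..T})" if "s \<in> {0..T}" for s
    by (intro has_vector_derivative_diff d1 d2 that)
  have i': "((\<lambda>s. ?d s \<bullet> ?d s) has_real_derivative 2 * (?d s \<bullet> ?dV s)) (at s within {0..T})"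
    if "s \<in> {0..T}" for s
    using bounded_bilinear.has_vector_derivative[OF bounded_bilinear_inner d'[OF that] d'[OF that]]
    by (simp add: has_real_derivative_iff_has_vector_derivative inner_commute)
  have f': "(f has_real_derivative exp (- 2 * L * s) * (2 * (?d s \<bullet> ?dV s) - 2 * L * (?d s \<bullet> ?d s)))
      (at s within {0..T})" if "s \<in> {0..T}" for s
    unfolding f_def[abs_def]
    by (rule derivative_eq_intros i'[OF that] refl)+ (simp add: algebra_simps)
  have "f T \<le> f 0"
  proof (rule DERIV_nonpos_imp_decreasing_open[OF T])
    fix s assume s: "0 < s" "s < T"
    have "?d s \<bullet> ?dV s \<le> norm (?d s) * norm (?dV s)" by (rule norm_cauchy_schwarz)
    also have "\<dots> \<le> norm (?d s) * (L * norm (?d s))" using lip[of s] s by (intro mult_left_mono) auto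
    also have "\<dots> = L * (?d s \<bullet> ?d s)" by (simp add: power2_norm_eq_inner[symmetric] power2_eq_square)
    finally have "exp (- 2 * L * s) * (2 * (?d s \<bullet> ?dV s) - 2 * L * (?d s \<bullet> ?d s)) \<le> 0"
      by (intro mult_nonneg_nonpos) auto
    moreover have "(f has_real_derivative exp (- 2 * L * s) * (2 * (?d s \<bullet> ?dV s) - 2 * L * (?d s \<bullet> ?d s))) (at s)"
      using f'[of s] s by (simp add: at_within_Icc_at)
    ultimately show "\<exists>y. (f has_real_derivative y) (at s) \<and> y \<le> 0" by blast
  next
    show "continuous_on {0..T} f"
      using f' by (meson DERIV_continuous continuous_on_eq_continuous_within)
  qed
  then have "exp (- 2 * L * T) * (?d T \<bullet> ?d T) \<le> 0" by (simp add: f_def init)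
  then have "?d T \<bullet> ?d T \<le> 0" by (simp add: mult_le_0_iff)
  then have "?d T \<bullet> ?d T = 0" by (intro antisym) auto
  then show ?thesis by simp
qed

section \<open>The Hamiltonian vector field\<close>

lemma bounded_bilinear_matrix_vector: "bounded_bilinear (\<lambda>(A::real^'n^'m) v. A *v v)"
  unfolding bilinear_conv_bounded_bilinear[symmetric] bilinear_def
  by (auto intro!: linearI simp: matrix_vector_mult_add_rdistrib matrix_vector_right_distrib
      matrix_vector_mult_scaleR scaleR_matrix_vector_assoc)

lemma bounded_bilinear_matrix_matrix: "bounded_bilinear (\<lambda>(A::real^'n^'m) (B::real^'k^'n). A ** B)"
  unfolding bilinear_conv_bounded_bilinear[symmetric] bilinear_def
  by (auto intro!: linearI simp: matrix_matrix_mult_def vec_eq_iff sum.distrib algebra_simps sum_distrib_left)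

lemma bounded_linear_transpose: "bounded_linear (transpose :: real^'n^'m \<Rightarrow> real^'m^'n)"
  unfolding linear_conv_bounded_linear[symmetric]
  by (auto intro!: linearI simp: transpose_def vec_eq_iff)

lemma Cb_Pair: "Cb k S f \<Longrightarrow> Cb k S h \<Longrightarrow> Cb k S (\<lambda>z. (f z, h z))"
proof -
  assume f: "Cb k S f" and h: "Cb k S h"
  have "bounded_linear (\<lambda>x. (x, 0::'c))" "bounded_linear (\<lambda>y. (0::'b, y))"
    by (auto intro!: bounded_linear_intro[where K=1])
  from Cb_add[OF Cb_linear[OF this(1) f] Cb_linear[OF this(2) h]] show ?thesis by simp
qed

text \<open>
  The derivatives of the inverse come from those of \<open>g\<close> by \<open>h' = - h g' h\<close>, so a bound on \<open>h\<close> and bounds on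
  the derivatives of \<open>g\<close> bound them all.
\<close>
lemma smooth_bdd_inverse_matrix:
  fixes g :: "'a::euclidean_space \<Rightarrow> real^'n^'n"
  assumes S: "open S" "convex S" and g: "smooth_bdd S g"
    and inv: "\<And>x. x \<in> S \<Longrightarrow> h x ** g x = mat 1" "\<And>x. x \<in> S \<Longrightarrow> g x ** h x = mat 1"
    and bd: "bounded (h ` S)"
  shows "smooth_bdd S h"
  unfolding smooth_bdd_def
proof
  fix k
  have mg: "Cb j S (\<lambda>x. - g x)" for j using g Cb_minus unfolding smooth_bdd_def by blast
  obtain C where C: "\<And>x y. x \<in> S \<Longrightarrow> y \<in> S \<Longrightarrow> norm (- g x - - g y) \<le> C * norm (x - y)"
    using Cb_lipschitz[OF S(2) mg[of "Suc 0"]] by blast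
  show "Cb k S h"
  proof (rule Cb_inverse_family[OF bounded_bilinear_matrix_matrix bounded_bilinear_matrix_matrix S(1) _ bd C mg])
    fix x y assume xy: "x \<in> S" "y \<in> S"
    interpret M: bounded_bilinear "\<lambda>(A::real^'n^'n) (B::real^'n^'n). A ** B" by (rule bounded_bilinear_matrix_matrix)
    have "h x ** (- g x - - g y) ** h y = h x ** (g y ** h y) - (h x ** g x) ** h y"
      by (simp add: M.diff_right M.diff_left M.minus_right M.minus_left matrix_mul_assoc)
    then show "h x - h y = h x ** (- g x - - g y) ** h y" using inv xy by simp
  qed
qed

lemma pos_def_matrix_inv:
  fixes A :: "real^'n^'n"
  assumes A: "pos_def_matrix A"
  shows "matrix_inv A ** A = mat 1" "A ** matrix_inv A = mat 1" "transpose (matrix_inv A) = matrix_inv A"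
proof -
  have tA: "transpose A = A" using A by (simp add: pos_def_matrix_def)
  have "v = 0" if "A *v v = 0" for v
    using A that unfolding pos_def_matrix_def by (metis inner_zero_left less_irrefl)
  then have "\<exists>B. B ** A = mat 1" using matrix_left_invertible_ker by blast
  then have I: "invertible A" using invertible_left_inverse by blast
  show L: "matrix_inv A ** A = mat 1" and R: "A ** matrix_inv A = mat 1"
    using someI_ex[OF I[unfolded invertible_def]] unfolding matrix_inv_def by blast+
  have "transpose (matrix_inv A) ** A = mat 1"
    using arg_cong[OF R, of transpose] by (simp add: matrix_transpose_mul tA transpose_mat)
  then have "transpose (matrix_inv A) ** A ** matrix_inv A = matrix_inv A" by simp
  then show "transpose (matrix_inv A) = matrix_inv A"
    by (simp add: matrix_mul_assoc[symmetric] R)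
qed

lemma grad_eqI:
  assumes "(f has_derivative (\<lambda>h. w \<bullet> h)) (at x)"
  shows "grad f x = w"
  unfolding grad_def frechet_derivative_at[OF assms, symmetric]
  by (simp add: vec_eq_iff inner_axis)

definition pdiff :: "(real^'n \<Rightarrow> 'b::real_normed_vector) \<Rightarrow> 'n \<Rightarrow> real^'n \<Rightarrow> 'b" where
  "pdiff f i x = frechet_derivative f (at x) (axis i 1)"

type_synonym 'n phase = "(real^'n) \<times> (real^'n) \<times> (real^'n) \<times> (real^'n)"

text \<open>
  The right-hand side of the Hamiltonian system with all gradients carried out; \<open>G\<close> stands for the
  pointwise inverse of \<open>g\<close>.
\<close>
definition ham_field :: "(real^'n \<Rightarrow> real^'n^'n) \<Rightarrow> (real^'n \<Rightarrow> real^'n^'n) \<Rightarrow> 'n phase \<Rightarrow> 'n phase" where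
  "ham_field g G = (\<lambda>(x, y, q, p).
     (- (G x *v y),
      g x *v q + (1/2) *\<^sub>R (\<Sum>i\<in>UNIV. ((pdiff G i x *v y) \<bullet> y) *\<^sub>R axis i 1),
      G x *v p - (\<Sum>i\<in>UNIV. (q $ i) *\<^sub>R (pdiff G i x *v y)),
      (\<Sum>i\<in>UNIV. ((pdiff G i x *v y) \<bullet> p - 1/2 * ((pdiff g i x *v q) \<bullet> q)
         - 1/2 * (\<Sum>j\<in>UNIV. q $ j * ((pdiff (pdiff G j) i x *v y) \<bullet> y))) *\<^sub>R axis i 1)))"

definition slab :: "real \<Rightarrow> 'n::finite phase set" where
  "slab R = UNIV \<times> ball 0 R \<times> ball 0 R \<times> ball 0 R"

lemma open_slab: "open (slab R)" unfolding slab_def by (intro open_Times) auto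
lemma convex_slab: "convex (slab R)" unfolding slab_def by (intro convex_Times) auto

lemma smooth_bdd_pdiff: "smooth_bdd UNIV f \<Longrightarrow> smooth_bdd UNIV (pdiff f i)"
  using smooth_bddD(2)[of UNIV f "axis i 1"] unfolding pdiff_def[abs_def] by simp

lemma smooth_bdd_ham_field:
  fixes g G :: "real^'n \<Rightarrow> real^'n^'n"
  assumes g: "smooth_bdd UNIV g" and G: "smooth_bdd UNIV G"
  shows "smooth_bdd (slab R) (ham_field g G)"
  unfolding smooth_bdd_def
proof
  fix k
  let ?S = "slab R :: 'n phase set"
  have x: "Cb k ?S (\<lambda>z. f (fst z))" if "smooth_bdd UNIV f" for f :: "real^'n \<Rightarrow> real^'n^'n"
    using that unfolding smooth_bdd_def
    by (intro Cb_compose_linear[OF bounded_linear_fst, where T=UNIV]) auto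
  have y: "Cb k ?S (\<lambda>z. fst (snd z))"
    by (intro Cb_restrict_linear bounded_linear_compose[OF bounded_linear_fst] bounded_linear_snd)
       (rule bounded_subset[OF bounded_ball[of 0 R]], auto simp: slab_def)
  have q: "Cb k ?S (\<lambda>z. fst (snd (snd z)))"
    by (intro Cb_restrict_linear bounded_linear_compose[OF bounded_linear_fst]
         bounded_linear_compose[OF bounded_linear_snd] bounded_linear_snd)
       (rule bounded_subset[OF bounded_ball[of 0 R]], auto simp: slab_def)
  have p: "Cb k ?S (\<lambda>z. snd (snd (snd z)))"
    by (intro Cb_restrict_linear bounded_linear_compose[OF bounded_linear_snd] bounded_linear_snd)
       (rule bounded_subset[OF bounded_ball[of 0 R]], auto simp: slab_def)
  show "Cb k ?S (ham_field g G)"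
    unfolding ham_field_def split_beta
    by (intro Cb_Pair Cb_add Cb_diff Cb_minus Cb_sum Cb_const
       Cb_bilinear[OF bounded_bilinear_scaleR] Cb_bilinear[OF bounded_bilinear_inner]
       Cb_bilinear[OF bounded_bilinear_mult] Cb_bilinear[OF bounded_bilinear_matrix_vector]
       Cb_linear[OF bounded_linear_vec_nth] x y q p g G smooth_bdd_pdiff)
qed

text \<open>
  Quasi-homogeneity, the source of the scaling invariance of the whole problem.
\<close>
lemma ham_field_scaling:
  "ham_field g G (x, \<mu> *\<^sub>R y, \<mu>^2 *\<^sub>R q, \<mu>^3 *\<^sub>R p) =
    (case ham_field g G (x, y, q, p) of (a, b, c, d) \<Rightarrow> (\<mu> *\<^sub>R a, \<mu>^2 *\<^sub>R b, \<mu>^3 *\<^sub>R c, \<mu>^4 *\<^sub>R d))"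
  by (simp add: ham_field_def matrix_vector_mult_scaleR scaleR_sum_right sum_distrib_left
      algebra_simps power2_eq_square power3_eq_cube power4_eq_xxxx scaleR_add_right scaleR_diff_right)

text \<open>
  The unknown derivative of \<open>f\<close> drops out where the other factor vanishes. On the zero section this
  removes every derivative of the metric from the linearisation.
\<close>
lemma has_derivative_bilinear_zero:
  assumes "bounded_bilinear pr" "(f has_derivative f') (at z)" "(h has_derivative h') (at z)" "h z = 0"
  shows "((\<lambda>z. pr (f z) (h z)) has_derivative (\<lambda>k. pr (f z) (h' k))) (at z)"
proof -
  interpret bounded_bilinear pr by fact
  show ?thesis using FDERIV[OF assms(2,3)] by (simp add: assms(4) zero_right)
qed

text \<open>
  At \<open>y = q = p = 0\<close> only the terms linear in \<open>(y, q, p)\<close> survive, and the linear system is nilpotent.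
\<close>
lemma ham_field_derivative_zero_section:
  fixes g G :: "real^'n \<Rightarrow> real^'n^'n"
  assumes g: "smooth_bdd UNIV g" and G: "smooth_bdd UNIV G"
  shows "(ham_field g G has_derivative
    (\<lambda>(hx, hy, hq, hp). (- (G x *v hy), g x *v hq, G x *v hp, 0))) (at (x, 0, 0, 0))"
proof -
  let ?z = "(x, 0, 0, 0) :: 'n phase"
  have x: "\<exists>f'. ((\<lambda>z::'n phase. f (fst z)) has_derivative f') (at ?z)"
    if "smooth_bdd UNIV f" for f :: "real^'n \<Rightarrow> real^'n^'n"
    using diff_chain_at[OF bounded_linear_imp_has_derivative[OF bounded_linear_fst], of f _ ?z]
      smooth_bddD(1)[OF open_UNIV that] by (auto simp: o_def)
  have y: "((\<lambda>z::'n phase. fst (snd z)) has_derivative (\<lambda>h. fst (snd h))) (at ?z)"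
   and q: "((\<lambda>z::'n phase. fst (snd (snd z))) has_derivative (\<lambda>h. fst (snd (snd h)))) (at ?z)"
   and p: "((\<lambda>z::'n phase. snd (snd (snd z))) has_derivative (\<lambda>h. snd (snd (snd h)))) (at ?z)"
    by (auto intro!: derivative_eq_intros)
  have mv: "((\<lambda>z. f (fst z) *v h z) has_derivative (\<lambda>k. f x *v h' k)) (at ?z)"
    if "smooth_bdd UNIV f" "(h has_derivative h') (at ?z)" "h ?z = 0"
    for f :: "real^'n \<Rightarrow> real^'n^'n" and h h'
    using x[OF that(1)] has_derivative_bilinear_zero[OF bounded_bilinear_matrix_vector _ that(2,3)] by fastforce
  have in0: "((\<lambda>z. (f (fst z) *v h z) \<bullet> l z) has_derivative (\<lambda>k. 0)) (at ?z)"
    if "smooth_bdd UNIV f" "(h has_derivative h') (at ?z)" "h ?z = 0" "(l has_derivative l') (at ?z)" "l ?z = 0"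
    for f :: "real^'n \<Rightarrow> real^'n^'n" and h h' l l'
    using has_derivative_bilinear_zero[OF bounded_bilinear_inner mv[OF that(1-3)] that(4,5)] that(3) by simp
  have sc0: "((\<lambda>z. (fst (snd (snd z)) $ j) *\<^sub>R (f (fst z) *v fst (snd z))) has_derivative (\<lambda>k. 0)) (at ?z)"
    if "smooth_bdd UNIV f" for f :: "real^'n \<Rightarrow> real^'n^'n" and j
    using has_derivative_bilinear_zero[OF bounded_bilinear_scaleR
      bounded_linear.has_derivative[OF bounded_linear_vec_nth q] mv[OF that y]] by simp
  have mu0: "((\<lambda>z. fst (snd (snd z)) $ j * ((f (fst z) *v fst (snd z)) \<bullet> fst (snd z))) has_derivative (\<lambda>k. 0)) (at ?z)"
    if "smooth_bdd UNIV f" for f :: "real^'n \<Rightarrow> real^'n^'n" and j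
    using has_derivative_bilinear_zero[OF bounded_bilinear_mult
      bounded_linear.has_derivative[OF bounded_linear_vec_nth q] in0[OF that y _ y]] by simp
  note G1 = smooth_bdd_pdiff[OF G] and g1 = smooth_bdd_pdiff[OF g]
  note G2 = smooth_bdd_pdiff[OF G1]
  show ?thesis
    unfolding ham_field_def split_beta
    by (rule has_derivative_eq_rhs)
      (rule has_derivative_Pair has_derivative_add has_derivative_diff has_derivative_minus
       has_derivative_sum has_derivative_scaleR_left has_derivative_scaleR_right has_derivative_mult_right
       mv[OF G y] mv[OF g q] mv[OF G p] in0[OF G1 y _ y] in0[OF G1 y _ p] in0[OF g1 q _ q] sc0[OF G1] mu0[OF G2]
       | simp add: fun_eq_iff)+
qed

text \<open>
  The symmetry of \<open>g\<close>, of \<open>G\<close> and hence of the partial derivatives of \<open>G\<close> merges the two equal terms that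
  each quadratic form contributes.
\<close>
lemma ham_grads:
  fixes g :: "real^'n \<Rightarrow> real^'n^'n"
  defines "G \<equiv> \<lambda>x. matrix_inv (g x)"
  assumes g: "smooth_bdd UNIV g" and G: "smooth_bdd UNIV G"
    and gs: "\<And>x. transpose (g x) = g x" and Gs: "\<And>x. transpose (G x) = G x"
  shows "ham_field g G (x, y, q, p) =
    (grad (\<lambda>\<pi>. ham g x y q \<pi>) p, grad (\<lambda>\<kappa>. ham g x y \<kappa> p) q,
     - grad (\<lambda>\<eta>. ham g x \<eta> q p) y, - grad (\<lambda>\<xi>. ham g \<xi> y q p) x)"
proof -
  interpret mv: bounded_bilinear "\<lambda>(A::real^'n^'n) v. A *v v" by (rule bounded_bilinear_matrix_vector)
  have sym: "(A *v a) \<bullet> b = a \<bullet> (A *v b)" if "transpose A = A" for A :: "real^'n^'n" and a b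
    using dot_lmul_matrix[of a A b] that by (metis inner_commute transpose_matrix_vector)
  have D: "(f has_derivative (\<lambda>h. \<Sum>i\<in>UNIV. h $ i *\<^sub>R pdiff f i x)) (at x)"
    if "smooth_bdd UNIV f" for f :: "real^'n \<Rightarrow> real^'n^'n" and x
  proof -
    have d: "(f has_derivative frechet_derivative f (at x)) (at x)" using smooth_bddD(1)[OF open_UNIV that] by simp
    then interpret b: bounded_linear "frechet_derivative f (at x)" by (rule has_derivative_bounded_linear)
    have "frechet_derivative f (at x) h = (\<Sum>i\<in>UNIV. h $ i *\<^sub>R pdiff f i x)" for h
      unfolding pdiff_def b.scaleR[symmetric] b.sum[symmetric]
      by (simp add: basis_expansion flip: scalar_mult_eq_scaleR)
    then show ?thesis by (intro has_derivative_eq_rhs[OF d]) (simp add: fun_eq_iff)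
  qed
  note G1 = smooth_bdd_pdiff[OF G]
  have Gps: "transpose (pdiff G i x) = pdiff G i x" for i x
  proof -
    have "((\<lambda>x. transpose (G x)) has_derivative (\<lambda>h. transpose (frechet_derivative G (at x) h))) (at x)"
      using smooth_bddD(1)[OF open_UNIV G] by (intro bounded_linear.has_derivative[OF bounded_linear_transpose]) simp
    then have "(G has_derivative (\<lambda>h. transpose (frechet_derivative G (at x) h))) (at x)" by (simp add: Gs)
    from frechet_derivative_at[OF this] show ?thesis unfolding pdiff_def by metis
  qed
  have gr: "grad (\<lambda>\<xi>. (G \<xi> *v y) \<bullet> y) x = (\<Sum>i\<in>UNIV. ((pdiff G i x *v y) \<bullet> y) *\<^sub>R axis i 1)" for x y
    by (rule grad_eqI)
      (auto intro!: derivative_eq_intros mv.FDERIV[OF D[OF G] has_derivative_const]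
        simp: mv.sum_left mv.scaleR_left inner_sum_left inner_axis' ac_simps)
  have gri: "grad (\<lambda>\<xi>. (G \<xi> *v y) \<bullet> y) x \<bullet> q = (\<Sum>i\<in>UNIV. q $ i * ((pdiff G i x *v y) \<bullet> y))" for x y q
    by (simp add: gr inner_sum_left inner_axis' ac_simps)
  have Gx: "matrix_inv (g x) = G x" for x by (simp add: G_def)
  have h: "ham g x y q p = 1/2 * ((g x *v q) \<bullet> q) - (G x *v y) \<bullet> p
     + 1/2 * (\<Sum>i\<in>UNIV. q $ i * ((pdiff G i x *v y) \<bullet> y))" for x y q p
    using gri by (simp add: ham_def Gx)
  note bl = bounded_linear.has_derivative[OF mv.bounded_linear_right has_derivative_ident]
  have 1: "grad (\<lambda>\<pi>. ham g x y q \<pi>) p = - (G x *v y)"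
    unfolding h by (rule grad_eqI) (auto intro!: derivative_eq_intros)
  have 2: "grad (\<lambda>\<kappa>. ham g x y \<kappa> p) q = g x *v q + (1/2) *\<^sub>R (\<Sum>i\<in>UNIV. ((pdiff G i x *v y) \<bullet> y) *\<^sub>R axis i 1)"
    unfolding h
  proof (rule grad_eqI, rule has_derivative_eq_rhs)
    show "((\<lambda>\<kappa>. 1/2 * ((g x *v \<kappa>) \<bullet> \<kappa>) - (G x *v y) \<bullet> p
        + 1/2 * (\<Sum>i\<in>UNIV. \<kappa> $ i * ((pdiff G i x *v y) \<bullet> y))) has_derivative
      (\<lambda>k. 1/2 * ((g x *v q) \<bullet> k + (g x *v k) \<bullet> q) - 0
        + 1/2 * (\<Sum>i\<in>UNIV. k $ i * ((pdiff G i x *v y) \<bullet> y)))) (at q)"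
      by (intro has_derivative_add has_derivative_diff has_derivative_mult_right has_derivative_sum
        has_derivative_mult_left has_derivative_inner has_derivative_const bl has_derivative_ident
        bounded_linear.has_derivative[OF bounded_linear_vec_nth])
    have "(g x *v k) \<bullet> q = (g x *v q) \<bullet> k" for k using sym[OF gs, of x k q] by (simp add: inner_commute)
    then show "(\<lambda>k. 1/2 * ((g x *v q) \<bullet> k + (g x *v k) \<bullet> q) - 0
        + 1/2 * (\<Sum>i\<in>UNIV. k $ i * ((pdiff G i x *v y) \<bullet> y))) =
      (\<bullet>) (g x *v q + (1/2) *\<^sub>R (\<Sum>i\<in>UNIV. ((pdiff G i x *v y) \<bullet> y) *\<^sub>R axis i 1))"
      by (simp add: fun_eq_iff inner_add_left inner_sum_left inner_axis' mult.commute)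
  qed
  have 3: "grad (\<lambda>\<eta>. ham g x \<eta> q p) y = - (G x *v p - (\<Sum>i\<in>UNIV. (q $ i) *\<^sub>R (pdiff G i x *v y)))"
    unfolding h
  proof (rule grad_eqI, rule has_derivative_eq_rhs)
    show "((\<lambda>\<eta>. 1/2 * ((g x *v q) \<bullet> q) - (G x *v \<eta>) \<bullet> p
        + 1/2 * (\<Sum>i\<in>UNIV. q $ i * ((pdiff G i x *v \<eta>) \<bullet> \<eta>))) has_derivative
      (\<lambda>k. 0 - (G x *v k) \<bullet> p
        + 1/2 * (\<Sum>i\<in>UNIV. q $ i * ((pdiff G i x *v y) \<bullet> k + (pdiff G i x *v k) \<bullet> y)))) (at y)"
      by (intro has_derivative_add has_derivative_diff has_derivative_mult_right has_derivative_sum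
        has_derivative_inner_left has_derivative_inner has_derivative_const bl has_derivative_ident)
    have *: "(pdiff G i x *v k) \<bullet> y = (pdiff G i x *v y) \<bullet> k" for i k
      using sym[OF Gps, of i x k y] by (simp add: inner_commute)
    have **: "(G x *v k) \<bullet> p = (G x *v p) \<bullet> k" for k using sym[OF Gs, of x k p] by (simp add: inner_commute)
    show "(\<lambda>k. 0 - (G x *v k) \<bullet> p
        + 1/2 * (\<Sum>i\<in>UNIV. q $ i * ((pdiff G i x *v y) \<bullet> k + (pdiff G i x *v k) \<bullet> y))) =
      (\<bullet>) (- (G x *v p - (\<Sum>i\<in>UNIV. (q $ i) *\<^sub>R (pdiff G i x *v y))))"
      by (simp add: fun_eq_iff inner_diff_left inner_sum_left * ** sum_distrib_left)
  qed
  have 4: "grad (\<lambda>\<xi>. ham g \<xi> y q p) x = - (\<Sum>i\<in>UNIV. ((pdiff G i x *v y) \<bullet> p - 1/2 * ((pdiff g i x *v q) \<bullet> q)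
         - 1/2 * (\<Sum>j\<in>UNIV. q $ j * ((pdiff (pdiff G j) i x *v y) \<bullet> y))) *\<^sub>R axis i 1)"
    unfolding h
  proof (rule grad_eqI, rule has_derivative_eq_rhs)
    show "((\<lambda>\<xi>. 1/2 * ((g \<xi> *v q) \<bullet> q) - (G \<xi> *v y) \<bullet> p
        + 1/2 * (\<Sum>i\<in>UNIV. q $ i * ((pdiff G i \<xi> *v y) \<bullet> y))) has_derivative
      (\<lambda>k. 1/2 * (((\<Sum>i\<in>UNIV. k $ i *\<^sub>R pdiff g i x) *v q) \<bullet> q)
        - ((\<Sum>i\<in>UNIV. k $ i *\<^sub>R pdiff G i x) *v y) \<bullet> p
        + 1/2 * (\<Sum>j\<in>UNIV. q $ j * (((\<Sum>i\<in>UNIV. k $ i *\<^sub>R pdiff (pdiff G j) i x) *v y) \<bullet> y)))) (at x)"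
      by (intro has_derivative_add has_derivative_diff has_derivative_sum has_derivative_mult_right
       has_derivative_inner_left bounded_linear.has_derivative[OF mv.bounded_linear_left] D g G G1)
    have sw: "(\<Sum>j\<in>UNIV. q $ j * (((\<Sum>i\<in>UNIV. k $ i *\<^sub>R pdiff (pdiff G j) i x) *v y) \<bullet> y)) =
      (\<Sum>i\<in>UNIV. k $ i * (\<Sum>j\<in>UNIV. q $ j * ((pdiff (pdiff G j) i x *v y) \<bullet> y)))" for k
    proof -
      have "(\<Sum>j\<in>UNIV. q $ j * (((\<Sum>i\<in>UNIV. k $ i *\<^sub>R pdiff (pdiff G j) i x) *v y) \<bullet> y)) =
        (\<Sum>j\<in>UNIV. \<Sum>i\<in>UNIV. k $ i * (q $ j * ((pdiff (pdiff G j) i x *v y) \<bullet> y)))"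
        by (simp add: mv.sum_left mv.scaleR_left inner_sum_left sum_distrib_left ac_simps)
      also have "\<dots> = (\<Sum>i\<in>UNIV. \<Sum>j\<in>UNIV. k $ i * (q $ j * ((pdiff (pdiff G j) i x *v y) \<bullet> y)))"
        by (rule sum.swap)
      finally show ?thesis by (simp add: sum_distrib_left)
    qed
    show "(\<lambda>k. 1/2 * (((\<Sum>i\<in>UNIV. k $ i *\<^sub>R pdiff g i x) *v q) \<bullet> q)
        - ((\<Sum>i\<in>UNIV. k $ i *\<^sub>R pdiff G i x) *v y) \<bullet> p
        + 1/2 * (\<Sum>j\<in>UNIV. q $ j * (((\<Sum>i\<in>UNIV. k $ i *\<^sub>R pdiff (pdiff G j) i x) *v y) \<bullet> y))) =
      (\<bullet>) (- (\<Sum>i\<in>UNIV. ((pdiff G i x *v y) \<bullet> p - 1/2 * ((pdiff g i x *v q) \<bullet> q)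
         - 1/2 * (\<Sum>j\<in>UNIV. q $ j * ((pdiff (pdiff G j) i x *v y) \<bullet> y))) *\<^sub>R axis i 1))"
      (is "?l = (\<bullet>) (- (\<Sum>i\<in>UNIV. ?c i *\<^sub>R axis i 1))")
    proof
      fix k
      have "?l k = (\<Sum>i\<in>UNIV. 1/2 * (k $ i * ((pdiff g i x *v q) \<bullet> q)) - k $ i * ((pdiff G i x *v y) \<bullet> p)
         + 1/2 * (k $ i * (\<Sum>j\<in>UNIV. q $ j * ((pdiff (pdiff G j) i x *v y) \<bullet> y))))"
        unfolding sw
        unfolding mv.sum_left mv.scaleR_left inner_sum_left inner_scaleR_left sum_distrib_left[of "1/2"]
          sum.distrib sum_subtractf ..
      also have "\<dots> = (\<Sum>i\<in>UNIV. - (k $ i * ?c i))"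
        by (intro sum.cong) (auto simp: algebra_simps)
      also have "\<dots> = (- (\<Sum>i\<in>UNIV. ?c i *\<^sub>R axis i 1)) \<bullet> k"
        unfolding sum_negf inner_minus_left inner_sum_left inner_scaleR_left inner_axis' by (simp add: mult.commute)
      finally show "?l k = (- (\<Sum>i\<in>UNIV. ?c i *\<^sub>R axis i 1)) \<bullet> k" .
    qed
  qed
  show ?thesis unfolding 1 2 3 4 by (simp add: ham_field_def)
qed

section \<open>The Hamiltonian flow near its equilibria\<close>

lemma norm_Pair_scale_ge:
  assumes "0 \<le> m" "m \<le> \<alpha>" "m \<le> \<beta>"
  shows "m * norm w \<le> norm (\<alpha> *\<^sub>R fst w, \<beta> *\<^sub>R snd w)"
proof -
  have "m *\<^sub>R w = (m *\<^sub>R fst w, m *\<^sub>R snd w)" by (simp add: prod_eq_iff)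
  then have "m * norm w = norm (m *\<^sub>R fst w, m *\<^sub>R snd w)"
    using assms(1) by (metis norm_scaleR abs_of_nonneg)
  also have "\<dots> \<le> norm (\<alpha> *\<^sub>R fst w, \<beta> *\<^sub>R snd w)"
    unfolding norm_Pair using assms
    by (intro real_sqrt_le_mono add_mono power_mono) (auto intro: mult_right_mono)
  finally show ?thesis .
qed

lemma norm_phase_components:
  fixes x y q p :: "'a::real_normed_vector"
  shows
  "norm y \<le> norm (x, y, q, p)" "norm q \<le> norm (x, y, q, p)" "norm p \<le> norm (x, y, q, p)"
  using norm_snd_le[of "(y, q, p)" x] norm_fst_le[of y "(q, p)"] norm_snd_le[of "(q, p)" y]
    norm_fst_le[of q p] norm_snd_le[of p q] by linarith+

locale ham_metric =
  fixes g :: "real^'n \<Rightarrow> real^'n^'n"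
  assumes g: "smooth_bdd UNIV g" and Gb: "bounded (range (\<lambda>x. matrix_inv (g x)))"
    and pd: "\<And>x. pos_def_matrix (g x)"
begin

definition G where "G x = matrix_inv (g x)"
definition V where "V = ham_field g G"

lemma gG [simp]: "G x *v (g x *v v) = v" "g x *v (G x *v v) = v"
  using pos_def_matrix_inv[OF pd] by (simp_all add: G_def matrix_vector_mul_assoc)

lemma G: "smooth_bdd UNIV G"
  by (rule smooth_bdd_inverse_matrix[OF _ _ g])
    (use pos_def_matrix_inv[OF pd] Gb in \<open>auto simp: G_def[abs_def]\<close>)

lemma smooth_V: "smooth_bdd (slab R) V"
  unfolding V_def by (rule smooth_bdd_ham_field[OF g G])

lemma ham_solution_iff:
  "ham_solution g T x y q p \<longleftrightarrow> (\<forall>s\<in>{0..T}.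
     ((\<lambda>s. (x s, y s, q s, p s)) has_vector_derivative V (x s, y s, q s, p s)) (at s within {0..T}))"
proof -
  have Vg: "V (a, b, c, d) = (grad (\<lambda>\<pi>. ham g a b c \<pi>) d, grad (\<lambda>\<kappa>. ham g a b \<kappa> d) c,
     - grad (\<lambda>\<eta>. ham g a \<eta> c d) b, - grad (\<lambda>\<xi>. ham g \<xi> b c d) a)" for a b c d
    unfolding V_def G_def[abs_def]
    by (rule ham_grads[OF g G[unfolded G_def[abs_def]]])
      (use pd pos_def_matrix_inv[OF pd] in \<open>auto simp: pos_def_matrix_def\<close>)
  have pair: "((\<lambda>s. (f s, h s)) has_vector_derivative (a, b)) (at s within A) \<longleftrightarrow>
      (f has_vector_derivative a) (at s within A) \<and> (h has_vector_derivative b) (at s within A)"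
    for f :: "real \<Rightarrow> 'u::real_normed_vector" and h :: "real \<Rightarrow> 'v::real_normed_vector" and a b s A
    using bounded_linear.has_vector_derivative[OF bounded_linear_fst, of "\<lambda>s. (f s, h s)" "(a, b)" "at s within A"]
      bounded_linear.has_vector_derivative[OF bounded_linear_snd, of "\<lambda>s. (f s, h s)" "(a, b)" "at s within A"]
    by (auto intro: has_vector_derivative_Pair)
  show ?thesis unfolding ham_solution_def Vg pair by blast
qed

text \<open>
  Two trajectories on a compact time interval stay in a common slab, on which the vector field is
  Lipschitz.
\<close>
lemma ham_reaches_unique:
  assumes T: "0 \<le> T" and z: "ham_reaches g T x0 y0 q0 p0 z" "ham_reaches g T x0 y0 q0 p0 z'"
  shows "z = z'"
proof -
  have "\<exists>w. w 0 = (x0, y0, q0, p0) \<and> w T = z \<and>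
      (\<forall>s\<in>{0..T}. (w has_vector_derivative V (w s)) (at s within {0..T}))"
    if "ham_reaches g T x0 y0 q0 p0 z" for z
  proof -
    from that obtain x y q p where "ham_solution g T x y q p"
     "x 0 = x0" "y 0 = y0" "q 0 = q0" "p 0 = p0" "z = (x T, y T, q T, p T)" unfolding ham_reaches_def by blast
    then show ?thesis unfolding ham_solution_iff by (intro exI[of _ "\<lambda>s. (x s, y s, q s, p s)"]) auto
  qed
  with z obtain w w' where w: "w 0 = (x0, y0, q0, p0)" "w T = z"
      "\<And>s. s \<in> {0..T} \<Longrightarrow> (w has_vector_derivative V (w s)) (at s within {0..T})"
    and w': "w' 0 = (x0, y0, q0, p0)" "w' T = z'"
      "\<And>s. s \<in> {0..T} \<Longrightarrow> (w' has_vector_derivative V (w' s)) (at s within {0..T})" by metis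
  have "bounded (w ` {0..T})" "bounded (w' ` {0..T})"
    using w(3) w'(3)
    by (meson compact_imp_bounded compact_continuous_image compact_Icc continuous_on_eq_continuous_within
        has_vector_derivative_continuous)+
  then have "bounded (w ` {0..T} \<union> w' ` {0..T})" by simp
  then obtain R where R: "\<And>v. v \<in> w ` {0..T} \<union> w' ` {0..T} \<Longrightarrow> norm v < R"
    unfolding bounded_pos_less by blast
  have in_slab: "v \<in> slab R" if "norm v < R" for v :: "'n phase"
    using norm_phase_components[where x="fst v" and y="fst (snd v)" and q="fst (snd (snd v))"
        and p="snd (snd (snd v))"] that
    by (auto simp: slab_def split_beta mem_Times_iff)
  obtain L where L: "\<And>a b. a \<in> slab R \<Longrightarrow> b \<in> slab R \<Longrightarrow> norm (V a - V b) \<le> L * norm (a - b)"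
    using Cb_lipschitz[OF convex_slab, of 0 R V] smooth_V unfolding smooth_bdd_def by blast
  have "w T = w' T"
    by (rule ode_unique[OF T w(3) w'(3)]) (auto intro!: L in_slab R simp: w w')
  then show ?thesis using w w' by simp
qed

lemma ham_flow_eq:
  assumes "0 \<le> T" "ham_reaches g T x0 y0 q0 p0 z"
  shows "ham_flow g T x0 y0 q0 p0 = z"
  unfolding ham_flow_def using assms ham_reaches_unique by blast

end

context ham_metric
begin

definition phase_box :: "real \<Rightarrow> 'n phase set" where
  "phase_box r = UNIV \<times> cball 0 r \<times> cball 0 r \<times> cball 0 r"

text \<open>
  The radii \<open>1\<close>, \<open>3/2\<close> and \<open>2\<close> leave initial values a margin of \<open>1/2\<close> inside the closed set of trajectories,
  and the latter a margin inside the open set where \<open>V\<close> is controlled.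
\<close>
lemma flow_setup_exists: "\<exists>\<delta> L. flow_setup V (slab 2) (phase_box (3/2)) (phase_box 1) \<delta> L"
proof -
  have "bounded (V ` slab 2)" using smooth_V Cb_bounded unfolding smooth_bdd_def by blast
  then obtain L1 where L1: "\<And>x. x \<in> slab 2 \<Longrightarrow> norm (V x) \<le> L1" unfolding bounded_iff by blast
  obtain L2 where L2: "L2 > 0" "\<And>x y. x \<in> slab 2 \<Longrightarrow> y \<in> slab 2 \<Longrightarrow> norm (V x - V y) \<le> L2 * norm (x - y)"
    using Cb_lipschitz[OF convex_slab, of 0 2 V] smooth_V unfolding smooth_bdd_def by blast
  note V' = smooth_bddD[OF open_slab smooth_V[of 2]]
  have "bounded ((\<lambda>x. frechet_derivative V (at x) v) ` slab 2)" for v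
    using V'(2) Cb_bounded unfolding smooth_bdd_def by blast
  then obtain L3 where L3: "L3 > 0" "\<And>x h. x \<in> slab 2 \<Longrightarrow> norm (frechet_derivative V (at x) h) \<le> L3 * norm h"
    using Cb_derivative_bound[of "slab 2" V "\<lambda>x. frechet_derivative V (at x)"] V'(1) by blast
  define L where "L = max L1 (max L2 L3)"
  have L: "L1 \<le> L" "L2 \<le> L" "L3 \<le> L" "0 < L" using L2 by (auto simp: L_def)
  have "flow_setup V (slab 2) (phase_box (3/2)) (phase_box 1) (1 / (2 * L)) L"
  proof
    show "open (slab 2)" "convex (slab 2)" by (rule open_slab convex_slab)+
    show "closed (phase_box (3/2))" unfolding phase_box_def by (intro closed_Times) auto
    show "phase_box (3/2) \<subseteq> slab 2" by (auto simp: phase_box_def slab_def)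
    show "z' \<in> phase_box (3/2)" if "z \<in> phase_box 1" "norm (z' - z) \<le> 1/2" for z z'
    proof -
      obtain x y q p x' y' q' p' where z: "z = (x, y, q, p)" "z' = (x', y', q', p')" by (metis prod.exhaust)
      then have "norm (y' - y) \<le> 1/2" "norm (q' - q) \<le> 1/2" "norm (p' - p) \<le> 1/2"
        using norm_phase_components[where x="x' - x" and y="y' - y" and q="q' - q" and p="p' - p"] that(2) by auto
      then show ?thesis using that(1) norm_triangle_sub[of y' y] norm_triangle_sub[of q' q] norm_triangle_sub[of p' p]
        by (auto simp: z phase_box_def)
    qed
    show "smooth_bdd (slab 2) V" by (rule smooth_V)
    show "0 < 1 / (2 * L)" "0 < L" "1 / (2 * L) * L \<le> 1/2" using L by auto
    show "norm (V x) \<le> L" if "x \<in> slab 2" for x using L1[OF that] L by simp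
    show "norm (V x - V y) \<le> L * norm (x - y)" if "x \<in> slab 2" "y \<in> slab 2" for x y
      using order_trans[OF L2(2)[OF that] mult_right_mono[OF L(2)]] by simp
    show "norm (frechet_derivative V (at x) h) \<le> L * norm h" if "x \<in> slab 2" for x h
      using order_trans[OF L3(2)[OF that] mult_right_mono[OF L(3)]] by simp
  qed
  then show ?thesis by blast
qed

end

locale ham_flow_setup = ham_metric g + flow_setup V "slab 2" "phase_box (3/2)" "phase_box 1" \<delta> L
  for g :: "real^'n \<Rightarrow> real^'n^'n" and \<delta> L
begin

text \<open>
  Slowing time down by the factor \<open>\<tau>\<close> and rescaling the fibre coordinates with their weights maps trajectories to
  trajectories.
\<close>
lemma ham_reaches_sol:
  assumes \<tau>: "0 < \<tau>" and z: "(x0, \<tau> *\<^sub>R y0, \<tau>^2 *\<^sub>R q0, \<tau>^3 *\<^sub>R p0) \<in> phase_box 1"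
    and e: "sol (x0, \<tau> *\<^sub>R y0, \<tau>^2 *\<^sub>R q0, \<tau>^3 *\<^sub>R p0) \<delta> = (X, Y, Q, P)"
  shows "ham_reaches g (\<tau> * \<delta>) x0 y0 q0 p0 (X, (1/\<tau>) *\<^sub>R Y, (1/\<tau>)^2 *\<^sub>R Q, (1/\<tau>)^3 *\<^sub>R P)"
proof -
  let ?\<mu> = "1 / \<tau>"
  define u where "u = apply_bcontfun (sol (x0, \<tau> *\<^sub>R y0, \<tau>^2 *\<^sub>R q0, \<tau>^3 *\<^sub>R p0))"
  define S :: "'n phase \<Rightarrow> 'n phase" where "S = (\<lambda>(x, y, q, p). (x, ?\<mu> *\<^sub>R y, ?\<mu>^2 *\<^sub>R q, ?\<mu>^3 *\<^sub>R p))"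
  have SV: "V (S w) = ?\<mu> *\<^sub>R S (V w)" for w
  proof -
    obtain x y q p where w: "w = (x, y, q, p)" by (metis prod.exhaust)
    show ?thesis
      unfolding V_def w S_def case_prod_conv ham_field_scaling
      by (simp add: split_beta power2_eq_square power3_eq_cube power4_eq_xxxx)
  qed
  have Sl: "bounded_linear S"
    unfolding S_def linear_conv_bounded_linear[symmetric]
    by (auto intro!: linearI simp: scaleR_add_right)
  have sol': "((\<lambda>s. S (u (?\<mu> * s))) has_vector_derivative V (S (u (?\<mu> * s)))) (at s within {0..\<tau> * \<delta>})"
    if s: "s \<in> {0..\<tau> * \<delta>}" for s
  proof -
    have ms: "?\<mu> * s \<in> {0..\<delta>}" if "s \<in> {0..\<tau> * \<delta>}" for s using that \<tau> by (auto simp: field_simps)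
    have "(u has_vector_derivative V (u (?\<mu> * s))) (at (?\<mu> * s) within (\<lambda>s. ?\<mu> * s) ` {0..\<tau> * \<delta>})"
      unfolding u_def
      by (rule has_vector_derivative_within_subset[OF sol_has_vector_derivative[OF z ms[OF s]]]) (use ms in auto)
    moreover have "((\<lambda>s. ?\<mu> * s) has_vector_derivative ?\<mu>) (at s within {0..\<tau> * \<delta>})"
      using \<tau> by (auto intro!: derivative_eq_intros simp: has_real_derivative_iff_has_vector_derivative[symmetric])
    ultimately have "(u \<circ> (\<lambda>s. ?\<mu> * s) has_vector_derivative ?\<mu> *\<^sub>R V (u (?\<mu> * s))) (at s within {0..\<tau> * \<delta>})"
      by (rule vector_diff_chain_within[rotated])
    from bounded_linear.has_vector_derivative[OF Sl this]
    show ?thesis unfolding SV o_def bounded_linear.linear[OF Sl, THEN linear_cmul] .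
  qed
  define x y q p where "x s = fst (S (u (?\<mu> * s)))" and "y s = fst (snd (S (u (?\<mu> * s))))"
    and "q s = fst (snd (snd (S (u (?\<mu> * s)))))" and "p s = snd (snd (snd (S (u (?\<mu> * s)))))" for s
  have xyqp: "(x s, y s, q s, p s) = S (u (?\<mu> * s))" for s by (simp add: x_def y_def q_def p_def)
  have "ham_solution g (\<tau> * \<delta>) x y q p" unfolding ham_solution_iff xyqp using sol' by blast
  moreover have "(x 0, y 0, q 0, p 0) = (x0, y0, q0, p0)"
    using \<tau> sol_0[OF z] unfolding xyqp by (simp add: u_def S_def power_divide)
  moreover have "(x (\<tau> * \<delta>), y (\<tau> * \<delta>), q (\<tau> * \<delta>), p (\<tau> * \<delta>)) =
      (X, (1/\<tau>) *\<^sub>R Y, (1/\<tau>)^2 *\<^sub>R Q, (1/\<tau>)^3 *\<^sub>R P)"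
    unfolding xyqp using \<tau> e by (simp add: u_def S_def)
  ultimately show ?thesis unfolding ham_reaches_def by (intro exI[of _ x] exI[of _ y] exI[of _ q] exI[of _ p]) auto
qed

text \<open>
  The map of the theorem at the reference time \<open>\<delta>\<close>, as a function of \<open>w = (q\<^sub>0, p\<^sub>0)\<close>.
\<close>
definition endpoint :: "real^'n \<Rightarrow> real^'n \<Rightarrow> (real^'n) \<times> (real^'n) \<Rightarrow> (real^'n) \<times> (real^'n)" where
  "endpoint x0 \<eta> w = (let u = sol (x0, \<eta>, fst w, snd w) \<delta> in (fst u, fst (snd u)))"

text \<open>
  The corresponding map of the linearised flow at the equilibrium \<open>(x\<^sub>0, 0, 0, 0)\<close>, obtained by integrating the
  nilpotent system from the bottom up.
\<close>
definition lin_endpoint :: "real^'n \<Rightarrow> (real^'n) \<times> (real^'n) \<Rightarrow> (real^'n) \<times> (real^'n)" where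
  "lin_endpoint x0 = (\<lambda>(a, b). (- (\<delta>^2/2) *\<^sub>R a - (\<delta>^3/6) *\<^sub>R (G x0 *v b), \<delta> *\<^sub>R (g x0 *v a) + (\<delta>^2/2) *\<^sub>R b))"

text \<open>
  Block elimination. Substituting \<open>p = 2/\<delta>\<^sup>2 (b - \<delta> g q)\<close> into the first component and using \<open>G g = 1\<close>
  leaves \<open>- \<delta>\<^sup>2/6 q\<close>, because \<open>-1/2 + 1/3 = -1/6\<close>.
\<close>
definition lin_endpoint_inv :: "real^'n \<Rightarrow> (real^'n) \<times> (real^'n) \<Rightarrow> (real^'n) \<times> (real^'n)" where
  "lin_endpoint_inv x0 = (\<lambda>(a, b). let q = - (6/\<delta>^2) *\<^sub>R (a + (\<delta>/3) *\<^sub>R (G x0 *v b))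
     in (q, (2/\<delta>^2) *\<^sub>R (b - \<delta> *\<^sub>R (g x0 *v q))))"

lemma XY_map_eq:
  assumes \<tau>: "0 < \<tau>" and z: "(x0, \<tau> *\<^sub>R y0, \<tau>^2 *\<^sub>R q0, \<tau>^3 *\<^sub>R p0) \<in> phase_box 1"
  shows "ham_exists g (\<tau> * \<delta>) x0 y0 q0 p0"
    and "XY_map g (\<tau> * \<delta>) x0 y0 (q0, p0) =
      (fst (endpoint x0 (\<tau> *\<^sub>R y0) (\<tau>^2 *\<^sub>R q0, \<tau>^3 *\<^sub>R p0)), (1/\<tau>) *\<^sub>R snd (endpoint x0 (\<tau> *\<^sub>R y0) (\<tau>^2 *\<^sub>R q0, \<tau>^3 *\<^sub>R p0)))"
proof -
  obtain X Y Q P where e: "sol (x0, \<tau> *\<^sub>R y0, \<tau>^2 *\<^sub>R q0, \<tau>^3 *\<^sub>R p0) \<delta> = (X, Y, Q, P)"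
    by (metis prod.exhaust)
  note r = ham_reaches_sol[OF \<tau> z e]
  show "ham_exists g (\<tau> * \<delta>) x0 y0 q0 p0" using r unfolding ham_reaches_def ham_exists_def by blast
  have "0 \<le> \<tau> * \<delta>" using \<tau> \<delta> by simp
  then show "XY_map g (\<tau> * \<delta>) x0 y0 (q0, p0) =
      (fst (endpoint x0 (\<tau> *\<^sub>R y0) (\<tau>^2 *\<^sub>R q0, \<tau>^3 *\<^sub>R p0)), (1/\<tau>) *\<^sub>R snd (endpoint x0 (\<tau> *\<^sub>R y0) (\<tau>^2 *\<^sub>R q0, \<tau>^3 *\<^sub>R p0)))"
    using ham_flow_eq[OF _ r] by (simp add: XY_map_def flow_X_def flow_Y_def endpoint_def e)
qed

interpretation mv: bounded_bilinear "\<lambda>(A::real^'n^'n) v. A *v v" by (rule bounded_bilinear_matrix_vector)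

lemma linear_lin_endpoint_inv: "linear (lin_endpoint_inv x0)"
proof -
  have "linear (\<lambda>(a, b). let q = c *\<^sub>R (a + d *\<^sub>R (G x0 *v b)) in (q, e *\<^sub>R (b - f *\<^sub>R (g x0 *v q))))"
    for c d e f :: real
    by (rule linearI) (auto simp: Let_def algebra_simps mv.add_right mv.scaleR_right matrix_vector_mult_scaleR)
  then show ?thesis unfolding lin_endpoint_inv_def .
qed

lemma lin_endpoint_inv_left: "lin_endpoint_inv x0 (lin_endpoint x0 w) = w"
proof -
  obtain a b where w: "w = (a, b)" by force
  have q: "- (6/\<delta>^2) *\<^sub>R ((- (\<delta>^2/2) *\<^sub>R a - (\<delta>^3/6) *\<^sub>R (G x0 *v b)) +
    (\<delta>/3) *\<^sub>R (G x0 *v (\<delta> *\<^sub>R (g x0 *v a) + (\<delta>^2/2) *\<^sub>R b))) = a"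
    using \<delta>(1) scaleR_left_distrib[of 1 2 a]
    by (simp add: mv.add_right mv.diff_right mv.scaleR_right matrix_vector_mult_scaleR algebra_simps
        scaleR_add_left[symmetric] power2_eq_square power3_eq_cube)
  show ?thesis using \<delta>(1) unfolding w lin_endpoint_def lin_endpoint_inv_def case_prod_conv q Let_def by simp
qed

lemma lin_endpoint_inv_eq_0: "lin_endpoint_inv x0 z = 0 \<Longrightarrow> z = 0"
  using \<delta>(1) by (cases z) (auto simp: lin_endpoint_inv_def Let_def zero_prod_def)

lemma lin_endpoint_inv_bound: "\<exists>B>0. \<forall>x0 z. norm (lin_endpoint_inv x0 z) \<le> B * norm z"
proof -
  have "\<exists>K>0. \<forall>x v. norm (f x *v v) \<le> K * norm v" if "smooth_bdd UNIV f" for f :: "real^'n \<Rightarrow> real^'n^'n"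
  proof -
    have "bounded (range f)" using that Cb_bounded unfolding smooth_bdd_def by blast
    then obtain A where A: "\<And>x. norm (f x) \<le> A" unfolding bounded_iff by blast
    obtain K where K: "K > 0" "\<And>(A::real^'n^'n) v. norm (A *v v) \<le> norm A * norm v * K" using mv.pos_bounded by blast
    have "norm (f x *v v) \<le> (\<bar>A\<bar> * K + 1) * norm v" for x v
    proof -
      have "norm (f x *v v) \<le> norm (f x) * norm v * K" by (rule K)
      also have "\<dots> \<le> \<bar>A\<bar> * norm v * K" using A[of x] K(1) by (intro mult_right_mono) auto
      also have "\<dots> \<le> (\<bar>A\<bar> * K + 1) * norm v" by (simp add: algebra_simps)
      finally show ?thesis .
    qed
    moreover have "\<bar>A\<bar> * K + 1 > 0" using K(1) by (smt (verit) mult_nonneg_nonneg)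
    ultimately show ?thesis by blast
  qed
  then obtain Kg KG where Kg: "Kg > 0" "\<And>x v. norm (g x *v v) \<le> Kg * norm v"
    and KG: "KG > 0" "\<And>x v. norm (G x *v v) \<le> KG * norm v"
    using g G by metis
  define A where "A = 6/\<delta>^2 * (1 + \<delta>/3 * KG)"
  define B where "B = A + 2/\<delta>^2 * (1 + \<delta> * Kg * A)"
  have A: "A > 0" using \<delta> KG by (simp add: A_def add_pos_pos)
  have "norm (lin_endpoint_inv x0 (a, b)) \<le> B * norm (a, b)" for x0 a b
  proof -
    let ?q = "- (6/\<delta>^2) *\<^sub>R (a + (\<delta>/3) *\<^sub>R (G x0 *v b))"
    let ?n = "norm (a, b)"
    have ab: "norm a \<le> ?n" "norm b \<le> ?n" by (auto intro: norm_fst_le norm_snd_le)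
    have "norm (G x0 *v b) \<le> KG * ?n" using order_trans[OF KG(2) mult_left_mono[OF ab(2)]] KG(1) by simp
    then have "norm ((\<delta>/3) *\<^sub>R (G x0 *v b)) \<le> \<delta>/3 * (KG * ?n)" using \<delta> by (simp add: mult_left_mono)
    then have "norm (a + (\<delta>/3) *\<^sub>R (G x0 *v b)) \<le> (1 + \<delta>/3 * KG) * ?n"
      using norm_triangle_le[of a "(\<delta>/3) *\<^sub>R (G x0 *v b)" "?n + \<delta>/3 * (KG * ?n)"] ab(1) by (simp add: algebra_simps)
    then have "6/\<delta>^2 * norm (a + (\<delta>/3) *\<^sub>R (G x0 *v b)) \<le> 6/\<delta>^2 * ((1 + \<delta>/3 * KG) * ?n)"
      by (intro mult_left_mono) auto
    moreover have "norm ?q = 6/\<delta>^2 * norm (a + (\<delta>/3) *\<^sub>R (G x0 *v b))" by simp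
    ultimately have "norm ?q \<le> 6/\<delta>^2 * ((1 + \<delta>/3 * KG) * ?n)" by metis
    then have q: "norm ?q \<le> A * ?n" by (simp only: A_def mult.assoc)
    then have "norm (g x0 *v ?q) \<le> Kg * (A * ?n)" using order_trans[OF Kg(2) mult_left_mono[OF q]] Kg(1) by simp
    then have "norm (\<delta> *\<^sub>R (g x0 *v ?q)) \<le> \<delta> * (Kg * (A * ?n))" using \<delta> by (simp add: mult_left_mono)
    then have "norm (b - \<delta> *\<^sub>R (g x0 *v ?q)) \<le> (1 + \<delta> * Kg * A) * ?n"
      using norm_triangle_ineq4[of b "\<delta> *\<^sub>R (g x0 *v ?q)"] ab(2) by (simp add: algebra_simps)
    then have "2/\<delta>^2 * norm (b - \<delta> *\<^sub>R (g x0 *v ?q)) \<le> 2/\<delta>^2 * ((1 + \<delta> * Kg * A) * ?n)"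
      by (intro mult_left_mono) auto
    moreover have "norm ((2/\<delta>^2) *\<^sub>R (b - \<delta> *\<^sub>R (g x0 *v ?q))) = 2/\<delta>^2 * norm (b - \<delta> *\<^sub>R (g x0 *v ?q))"
      by (simp only: norm_scaleR) simp
    ultimately have p: "norm ((2/\<delta>^2) *\<^sub>R (b - \<delta> *\<^sub>R (g x0 *v ?q))) \<le> 2/\<delta>^2 * (1 + \<delta> * Kg * A) * ?n"
      by (metis mult.assoc)
    have "norm (lin_endpoint_inv x0 (a, b)) \<le> norm ?q + norm ((2/\<delta>^2) *\<^sub>R (b - \<delta> *\<^sub>R (g x0 *v ?q)))"
      unfolding lin_endpoint_inv_def Let_def case_prod_conv by (rule norm_Pair_le)
    also have "\<dots> \<le> B * ?n" using q p by (simp add: B_def algebra_simps)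
    finally show ?thesis .
  qed
  moreover have "B > 0" using A \<delta> Kg unfolding B_def by (intro add_pos_pos mult_pos_pos) auto
  ultimately show ?thesis by (metis prod.exhaust)
qed

lemma endpoint_close_to_linear:
  "\<exists>C>0. \<forall>x0 \<eta> w w' \<rho>. \<rho> \<le> 1 \<longrightarrow> norm \<eta> \<le> \<rho> \<longrightarrow> norm (fst w) \<le> \<rho> \<longrightarrow> norm (snd w) \<le> \<rho> \<longrightarrow>
     norm (fst w') \<le> \<rho> \<longrightarrow> norm (snd w') \<le> \<rho> \<longrightarrow>
     norm (endpoint x0 \<eta> w - endpoint x0 \<eta> w' - lin_endpoint x0 (w - w')) \<le> C * \<rho> * norm (w - w')"
proof -
  obtain C where C: "C > 0" "\<And>zc z z' P \<rho>. zc \<in> phase_box 1 \<Longrightarrow> z \<in> phase_box 1 \<Longrightarrow> z' \<in> phase_box 1 \<Longrightarrow> V zc = 0 \<Longrightarrow>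
     norm (z - zc) \<le> \<rho> \<Longrightarrow> norm (z' - zc) \<le> \<rho> \<Longrightarrow> P 0 = z - z' \<Longrightarrow>
     (\<forall>s\<in>{0..\<delta>}. (P has_vector_derivative frechet_derivative V (at zc) (P s)) (at s within {0..\<delta>})) \<Longrightarrow>
     norm (sol z \<delta> - sol z' \<delta> - P \<delta>) \<le> C * \<rho> * norm (z - z')"
    using sol_difference_near_equilibrium by blast
  have "norm (endpoint x0 \<eta> w - endpoint x0 \<eta> w' - lin_endpoint x0 (w - w')) \<le> (C * 3) * \<rho> * norm (w - w')"
    if \<rho>: "\<rho> \<le> 1" "norm \<eta> \<le> \<rho>" "norm (fst w) \<le> \<rho>" "norm (snd w) \<le> \<rho>" "norm (fst w') \<le> \<rho>" "norm (snd w') \<le> \<rho>"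
    for x0 \<eta> w w' \<rho>
  proof -
    let ?zc = "(x0, 0, 0, 0) :: 'n phase"
    let ?z = "(x0, \<eta>, fst w, snd w)" and ?z' = "(x0, \<eta>, fst w', snd w')"
    obtain a b where ab: "w - w' = (a, b)" by force
    then have ab': "a = fst w - fst w'" "b = snd w - snd w'" by (metis fst_conv fst_diff, metis snd_conv snd_diff)
    \<comment> \<open>the solution of the linearised system that starts at \<open>(0, 0, a, b)\<close>\<close>
    define P where "P s = (- (s^2/2) *\<^sub>R a - (s^3/6) *\<^sub>R (G x0 *v b), s *\<^sub>R (g x0 *v a) + (s^2/2) *\<^sub>R b,
        a + s *\<^sub>R (G x0 *v b), b)" for s
    have D: "frechet_derivative V (at ?zc) = (\<lambda>(hx, hy, hq, hp). (- (G x0 *v hy), g x0 *v hq, G x0 *v hp, 0))"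
      using frechet_derivative_at[OF ham_field_derivative_zero_section[OF g G]] unfolding V_def by metis
    have "(P has_vector_derivative frechet_derivative V (at ?zc) (P s)) (at s within {0..\<delta>})" for s
    proof -
      have p: "((\<lambda>s. - (s^2/2)) has_real_derivative - s) (at s within A)"
        "((\<lambda>s. s^3/6) has_real_derivative s^2/2) (at s within A)"
        "((\<lambda>s. s^2/2) has_real_derivative s) (at s within A)" for s :: real and A
        by (auto intro!: derivative_eq_intros)
      have "(P has_vector_derivative (- s *\<^sub>R a - (s^2/2) *\<^sub>R (G x0 *v b), g x0 *v a + s *\<^sub>R b, G x0 *v b, 0)) (at s within {0..\<delta>})"
        unfolding P_def[abs_def]
        by (rule derivative_eq_intros has_vector_derivative_Pair p refl | simp)+
      moreover have "frechet_derivative V (at ?zc) (P s) = (- s *\<^sub>R a - (s^2/2) *\<^sub>R (G x0 *v b), g x0 *v a + s *\<^sub>R b, G x0 *v b, 0)"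
        unfolding D P_def by (simp add: mv.add_right mv.scaleR_right matrix_vector_mult_scaleR algebra_simps)
      ultimately show ?thesis by simp
    qed
    then have "norm (sol ?z \<delta> - sol ?z' \<delta> - P \<delta>) \<le> C * (3 * \<rho>) * norm (?z - ?z')"
    proof (intro C(2)[of ?zc])
      show "?zc \<in> phase_box 1" "?z \<in> phase_box 1" "?z' \<in> phase_box 1" using \<rho> by (auto simp: phase_box_def mem_Times_iff)
      show "V ?zc = 0" by (simp add: V_def ham_field_def zero_prod_def)
      show "P 0 = ?z - ?z'" by (simp add: P_def ab' prod_eq_iff)
      have tri: "norm (0::real^'n, y, q, p) \<le> norm y + norm q + norm p" for y q p :: "real^'n"
        using norm_Pair_le[of 0 "(y, q, p)"] norm_Pair_le[of y "(q, p)"] norm_Pair_le[of q p] by simp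
      have "?z - ?zc = (0, \<eta>, fst w, snd w)" by (simp add: prod_eq_iff)
      then show "norm (?z - ?zc) \<le> 3 * \<rho>" using tri[of \<eta> "fst w" "snd w"] \<rho> by simp
      have "?z' - ?zc = (0, \<eta>, fst w', snd w')" by (simp add: prod_eq_iff)
      then show "norm (?z' - ?zc) \<le> 3 * \<rho>" using tri[of \<eta> "fst w'" "snd w'"] \<rho> by simp
    qed auto
    moreover have "?z - ?z' = (0, 0, w - w')" by (simp add: prod_eq_iff)
    then have "norm (?z - ?z') = norm (w - w')" by (simp add: norm_Pair)
    moreover have "norm (endpoint x0 \<eta> w - endpoint x0 \<eta> w' - lin_endpoint x0 (w - w')) \<le> norm (sol ?z \<delta> - sol ?z' \<delta> - P \<delta>)"
    proof -
      have pr: "norm (fst u, fst (snd u)) \<le> norm u" for u :: "'n phase"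
        by (cases u) (auto simp: norm_Pair intro!: real_sqrt_le_mono)
      have "endpoint x0 \<eta> w - endpoint x0 \<eta> w' - lin_endpoint x0 (w - w') = (let u = sol ?z \<delta> - sol ?z' \<delta> - P \<delta> in (fst u, fst (snd u)))"
        by (simp add: endpoint_def lin_endpoint_def ab P_def Let_def)
      then show ?thesis using pr[of "sol ?z \<delta> - sol ?z' \<delta> - P \<delta>"] by (simp only: Let_def)
    qed
    ultimately show ?thesis by simp
  qed
  moreover have "C * 3 > 0" using C by simp
  ultimately show ?thesis by blast
qed

end

section \<open>Rescaling to arbitrary times\<close>

context ham_flow_setup
begin

lemma polydisc_eq:
  assumes "0 < \<tau>"
  shows "(polydisc (\<rho> * \<delta>) (\<tau> * \<delta>) :: ((real^'n) \<times> (real^'n)) set) = ball 0 ((\<rho>/\<tau>)^2) \<times> ball 0 ((\<rho>/\<tau>)^3)"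
  using \<delta>(1) assms by (simp add: polydisc_def power_mult_distrib power_divide)

lemma polydisc_scaled:
  fixes q p :: "real^'n"
  assumes \<tau>: "0 < \<tau>" and \<rho>: "0 < \<rho>" "\<rho> \<le> 1" and w: "(q, p) \<in> polydisc (\<rho> * \<delta>) (\<tau> * \<delta>)"
  shows "norm (\<tau>^2 *\<^sub>R q) \<le> \<rho>" "norm (\<tau>^3 *\<^sub>R p) \<le> \<rho>"
proof -
  have "norm q < (\<rho>/\<tau>)^2" "norm p < (\<rho>/\<tau>)^3" using w by (auto simp: polydisc_eq[OF \<tau>])
  then have "\<tau>^2 * norm q \<le> \<rho>^2" "\<tau>^3 * norm p \<le> \<rho>^3"
    using \<tau> by (auto simp: power_divide field_simps)
  moreover have "\<rho>^2 \<le> \<rho>" "\<rho>^3 \<le> \<rho>"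
    using power_decreasing[of 1 2 \<rho>] power_decreasing[of 1 3 \<rho>] \<rho> by auto
  ultimately show "norm (\<tau>^2 *\<^sub>R q) \<le> \<rho>" "norm (\<tau>^3 *\<^sub>R p) \<le> \<rho>" using \<tau> by auto
qed

text \<open>
  The normalised result transported to time \<open>t = \<tau> \<delta>\<close> and parameter \<open>c = \<rho> \<delta>\<close>. The diagonal rescalings
  change the expansion constant by a factor that depends on \<open>\<tau>\<close>, which is harmless for the
  diffeomorphism property, while the ball in the image is measured in the normalised norm, where its
  radius does not depend on \<open>\<tau>\<close>.
\<close>
lemma diffeo_at_scale:
  assumes \<tau>: "0 < \<tau>" and \<rho>: "0 < \<rho>" "\<rho> \<le> 1" and y0: "norm (\<tau> *\<^sub>R y0) \<le> \<rho>"
    and B: "0 < B" "\<And>z. norm (lin_endpoint_inv x0 z) \<le> B * norm z"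
    and close: "\<And>w w'. norm (fst w) \<le> \<rho> \<Longrightarrow> norm (snd w) \<le> \<rho> \<Longrightarrow> norm (fst w') \<le> \<rho> \<Longrightarrow> norm (snd w') \<le> \<rho> \<Longrightarrow>
      norm (endpoint x0 (\<tau> *\<^sub>R y0) w - endpoint x0 (\<tau> *\<^sub>R y0) w' - lin_endpoint x0 (w - w')) \<le> 1 / (2 * B) * norm (w - w')"
  shows "\<forall>(q, p) \<in> polydisc (\<rho> * \<delta>) (\<tau> * \<delta>). ham_exists g (\<tau> * \<delta>) x0 y0 q p"
    and "diffeo_onto_image (polydisc (\<rho> * \<delta>) (\<tau> * \<delta>)) (XY_map g (\<tau> * \<delta>) x0 y0)"
    and "\<And>x y. norm (x - flow_X g (\<tau> * \<delta>) x0 y0 0 0) + \<tau> * norm (y - flow_Y g (\<tau> * \<delta>) x0 y0 0 0) < \<rho>^3 / (4 * B) \<Longrightarrow>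
      (x, y) \<in> XY_map g (\<tau> * \<delta>) x0 y0 ` polydisc (\<rho> * \<delta>) (\<tau> * \<delta>)"
proof -
  let ?S = "polydisc (\<rho> * \<delta>) (\<tau> * \<delta>) :: ((real^'n) \<times> (real^'n)) set"
  let ?H = "XY_map g (\<tau> * \<delta>) x0 y0"
  let ?\<eta> = "\<tau> *\<^sub>R y0"
  define \<iota> :: "(real^'n) \<times> (real^'n) \<Rightarrow> 'n phase" where "\<iota> w = (x0, ?\<eta>, \<tau>^2 *\<^sub>R fst w, \<tau>^3 *\<^sub>R snd w)" for w
  define \<kappa> :: "(real^'n) \<times> (real^'n) \<Rightarrow> (real^'n) \<times> (real^'n)" where "\<kappa> w = (\<tau>^2 *\<^sub>R fst w, \<tau>^3 *\<^sub>R snd w)" for w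
  have inS: "norm (fst (\<kappa> w)) \<le> \<rho>" "norm (snd (\<kappa> w)) \<le> \<rho>" if "w \<in> ?S" for w
    using polydisc_scaled[OF \<tau> \<rho>, of "fst w" "snd w"] that by (auto simp: \<kappa>_def)
  have phase_box: "\<iota> w \<in> phase_box 1" if "w \<in> ?S" for w
    using inS[OF that] y0 \<rho> by (auto simp: phase_box_def \<iota>_def \<kappa>_def)
  have H: "?H w = (fst (endpoint x0 ?\<eta> (\<kappa> w)), (1/\<tau>) *\<^sub>R snd (endpoint x0 ?\<eta> (\<kappa> w)))" if "w \<in> ?S" for w
    using XY_map_eq(2)[OF \<tau> phase_box[OF that, unfolded \<iota>_def]] by (simp add: \<kappa>_def)
  show "\<forall>(q, p) \<in> ?S. ham_exists g (\<tau> * \<delta>) x0 y0 q p"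
    using XY_map_eq(1)[OF \<tau>] phase_box by (auto simp: \<iota>_def)
  have openS: "open ?S" and convS: "convex ?S" and bdS: "bounded ?S"
    unfolding polydisc_def by (auto intro: open_Times convex_Times bounded_Times)
  have smooth: "smooth_bdd ?S ?H"
  proof -
    have l: "bounded_linear (\<lambda>w::(real^'n) \<times> (real^'n). (0::real^'n, 0::real^'n, \<tau>^2 *\<^sub>R fst w, \<tau>^3 *\<^sub>R snd w))"
      unfolding linear_conv_bounded_linear[symmetric] by (auto intro!: linearI simp: scaleR_add_right)
    have il: "\<iota> w' - \<iota> w = (\<lambda>w. (0, 0, \<tau>^2 *\<^sub>R fst w, \<tau>^3 *\<^sub>R snd w)) (w' - w)" for w w'
      by (simp add: \<iota>_def scaleR_diff_right)
    have "bounded (\<iota> ` ?S)"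
    proof (rule bounded_subset)
      show "bounded ({x0} \<times> {?\<eta>} \<times> cball (0::real^'n) \<rho> \<times> cball (0::real^'n) \<rho>)" by (intro bounded_Times) auto
      show "\<iota> ` ?S \<subseteq> {x0} \<times> {?\<eta>} \<times> cball 0 \<rho> \<times> cball 0 \<rho>" using inS by (auto simp: \<iota>_def \<kappa>_def)
    qed
    from smooth_bdd_sol[OF openS phase_box l il this, of \<delta>]
    have "Cb k ?S (\<lambda>w. apply_bcontfun (sol (\<iota> w)) \<delta>)" for k unfolding smooth_bdd_def by blast
    moreover have "bounded_linear (\<lambda>u::'n phase. (fst u, (1/\<tau>) *\<^sub>R fst (snd u)))"
      unfolding linear_conv_bounded_linear[symmetric] by (auto intro!: linearI simp: scaleR_add_right)
    ultimately have "Cb k ?S (\<lambda>w. (fst (sol (\<iota> w) \<delta>), (1/\<tau>) *\<^sub>R fst (snd (sol (\<iota> w) \<delta>))))" for k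
      by (rule Cb_linear[rotated])
    then show ?thesis unfolding smooth_bdd_def
      by (intro allI) (rule Cb_cong[OF openS], auto simp: H endpoint_def \<iota>_def \<kappa>_def Let_def)
  qed
  define m where "m = min 1 (1/\<tau>) * (1 / (2 * B)) * min (\<tau>^2) (\<tau>^3)"
  have m: "m > 0" using \<tau> B by (simp add: m_def)
  have low: "m * norm (w - w') \<le> norm (?H w - ?H w')" if "w \<in> ?S" "w' \<in> ?S" for w w'
  proof -
    let ?d = "endpoint x0 ?\<eta> (\<kappa> w) - endpoint x0 ?\<eta> (\<kappa> w')"
    have 1: "min (\<tau>^2) (\<tau>^3) * norm (w - w') \<le> norm (\<kappa> w - \<kappa> w')"
      using norm_Pair_scale_ge[of "min (\<tau>^2) (\<tau>^3)" "\<tau>^2" "\<tau>^3" "w - w'"] \<tau>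
      by (simp add: \<kappa>_def scaleR_diff_right)
    have 2: "norm (\<kappa> w - \<kappa> w') \<le> 2 * B * norm ?d"
      by (rule perturbed_linear_expanding[where N="lin_endpoint_inv x0" and M="lin_endpoint x0", OF lin_endpoint_inv_left B(2,1) close]) (intro inS that)+
    have 3: "min 1 (1/\<tau>) * norm ?d \<le> norm (?H w - ?H w')"
      using norm_Pair_scale_ge[of "min 1 (1/\<tau>)" 1 "1/\<tau>" ?d] \<tau>
      by (simp add: H that scaleR_diff_right)
    have "m * norm (w - w') = min 1 (1/\<tau>) * (1 / (2 * B)) * (min (\<tau>^2) (\<tau>^3) * norm (w - w'))" by (simp add: m_def)
    also have "\<dots> \<le> min 1 (1/\<tau>) * (1 / (2 * B)) * (2 * B * norm ?d)"
      using \<tau> B(1) order_trans[OF 1 2] by (intro mult_left_mono) auto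
    also have "\<dots> = min 1 (1/\<tau>) * norm ?d" using B(1) by simp
    finally show ?thesis using 3 by linarith
  qed
  show "diffeo_onto_image ?S ?H"
    by (rule diffeo_onto_image_if_expanding[OF openS convS bdS smooth m low])
  fix x y
  assume xy: "norm (x - flow_X g (\<tau> * \<delta>) x0 y0 0 0) + \<tau> * norm (y - flow_Y g (\<tau> * \<delta>) x0 y0 0 0) < \<rho>^3 / (4 * B)"
  have 0: "(0, 0) \<in> ?S" using \<rho> \<tau> by (simp add: polydisc_eq[OF \<tau>])
  have "flow_X g (\<tau> * \<delta>) x0 y0 0 0 = fst (endpoint x0 ?\<eta> 0)" "flow_Y g (\<tau> * \<delta>) x0 y0 0 0 = (1/\<tau>) *\<^sub>R snd (endpoint x0 ?\<eta> 0)"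
    using H[OF 0] by (auto simp: XY_map_def \<kappa>_def zero_prod_def)
  then have "norm (x - fst (endpoint x0 ?\<eta> 0)) + norm (\<tau> *\<^sub>R y - snd (endpoint x0 ?\<eta> 0)) < \<rho>^3 / (4 * B)"
    using xy \<tau> norm_scaleR[of \<tau> "y - (1/\<tau>) *\<^sub>R snd (endpoint x0 ?\<eta> 0)"] by (simp add: scaleR_diff_right)
  then have "norm ((x, \<tau> *\<^sub>R y) - endpoint x0 ?\<eta> 0) < \<rho>^3 / (4 * B)"
    using norm_Pair_le[of "x - fst (endpoint x0 ?\<eta> 0)" "\<tau> *\<^sub>R y - snd (endpoint x0 ?\<eta> 0)"]
    by (cases "endpoint x0 ?\<eta> 0") auto
  then have "(x, \<tau> *\<^sub>R y) \<in> ball (endpoint x0 ?\<eta> 0) ((\<rho>^3/2) / (2 * B))" by (simp add: dist_norm norm_minus_commute)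
  also have "\<dots> \<subseteq> endpoint x0 ?\<eta> ` cball 0 (\<rho>^3/2)"
  proof (rule perturbed_linear_image_contains_ball[OF linear_lin_endpoint_inv lin_endpoint_inv_left lin_endpoint_inv_eq_0 B(2,1)])
    show "0 < \<rho>^3/2" using \<rho> by simp
    have le: "norm (fst w) \<le> \<rho>" "norm (snd w) \<le> \<rho>" if "norm w \<le> \<rho>^3/2" for w :: "(real^'n) \<times> (real^'n)"
    proof -
      have "\<rho>^3/2 \<le> \<rho>" using power_decreasing[of 1 3 \<rho>] \<rho> by simp
      then show "norm (fst w) \<le> \<rho>" "norm (snd w) \<le> \<rho>"
        using that norm_fst_le[of "fst w" "snd w"] norm_snd_le[of "snd w" "fst w"] by auto
    qed
    show "norm (endpoint x0 ?\<eta> w - endpoint x0 ?\<eta> w' - lin_endpoint x0 (w - w')) \<le> 1 / (2 * B) * norm (w - w')"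
      if "norm w \<le> \<rho>^3/2" "norm w' \<le> \<rho>^3/2" for w w'
      by (intro close le that)
  qed
  finally obtain a b where ab: "norm (a, b) \<le> \<rho>^3/2" "endpoint x0 ?\<eta> (a, b) = (x, \<tau> *\<^sub>R y)" by force
  define w where "w = ((1/\<tau>)^2 *\<^sub>R a, (1/\<tau>)^3 *\<^sub>R b)"
  have \<kappa>w: "\<kappa> w = (a, b)" using \<tau> by (simp add: \<kappa>_def w_def power_divide)
  have na: "norm a \<le> \<rho>^3/2" "norm b \<le> \<rho>^3/2" using ab(1) norm_fst_le[of a b] norm_snd_le[of b a] by auto
  have "\<rho>^3/2 < \<rho>^3" "\<rho>^3 \<le> \<rho>^2" using \<rho> power_decreasing[of 2 3 \<rho>] by auto
  then have "norm a < \<rho>^2" "norm b < \<rho>^3" using na by linarith+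
  then have wS: "w \<in> ?S" using \<tau> by (simp add: polydisc_eq[OF \<tau>] w_def power_divide divide_strict_right_mono)
  have "?H w = (x, y)" using \<tau> by (simp add: H[OF wS] \<kappa>w ab(2))
  then show "(x, y) \<in> ?H ` ?S" using wS by force
qed

end

theorem theorem3p1:
  fixes g :: "real^'n \<Rightarrow> real^'n^'n"
  assumes "smooth_on UNIV g"
    and "\<And>x. pos_def_matrix (g x)"
    and "bounded_derivs g"
    and "bounded_derivs (\<lambda>x. matrix_inv (g x))"
    and "assumption_E g"
  shows "(\<exists>c>0. \<exists>t0>0. diffeo_property g c t0) \<and>
    (\<forall>c>0. \<forall>t0>0. diffeo_property g c t0 \<longrightarrow>
      (\<exists>r>0. \<exists>c'\<in>{0<..c}. \<exists>t0'\<in>{0<..t0}.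
        diffeo_property g c' t0' \<and>
        (\<forall>x0 t y0. 0 < t \<and> t \<le> t0' \<and> norm y0 \<le> c' / t \<longrightarrow>
          ball (flow_X g t x0 y0 0 0) r \<times> ball (flow_Y g t x0 y0 0 0) (r / t)
            \<subseteq> XY_map g t x0 y0 ` polydisc c' t)))"
proof -
  have "bounded (range (\<lambda>x. matrix_inv (g x)))"
    using assms(4)[unfolded bounded_derivs_def, rule_format, of "[]"] by simp
  then interpret ham_metric g
    using smooth_on_imp_smooth_bdd[OF assms(1,3)] assms(2) by unfold_locales
  obtain \<delta> L where "flow_setup V (slab 2) (phase_box (3/2)) (phase_box 1) \<delta> L" using flow_setup_exists by blast
  then interpret S: flow_setup V "slab 2" "phase_box (3/2)" "phase_box 1" \<delta> L .
  interpret ham_flow_setup g \<delta> L by unfold_locales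
  obtain B where B: "B > 0" "\<And>x0 z. norm (lin_endpoint_inv x0 z) \<le> B * norm z" using lin_endpoint_inv_bound by blast
  obtain C where C: "C > 0" "\<And>x0 \<eta> w w' \<rho>. \<rho> \<le> 1 \<Longrightarrow> norm \<eta> \<le> \<rho> \<Longrightarrow> norm (fst w) \<le> \<rho> \<Longrightarrow> norm (snd w) \<le> \<rho> \<Longrightarrow>
     norm (fst w') \<le> \<rho> \<Longrightarrow> norm (snd w') \<le> \<rho> \<Longrightarrow>
     norm (endpoint x0 \<eta> w - endpoint x0 \<eta> w' - lin_endpoint x0 (w - w')) \<le> C * \<rho> * norm (w - w')"
    using endpoint_close_to_linear by blast
  \<comment> \<open>the Lipschitz error \<open>C \<rho>\<close> must stay below half the expansion \<open>1 / B\<close> of the linear map\<close>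
  define \<rho>0 where "\<rho>0 = min 1 (1 / (2 * B * C))"
  have \<rho>0: "0 < \<rho>0" "\<rho>0 \<le> 1" "C * \<rho>0 \<le> 1 / (2 * B)"
  proof -
    show "0 < \<rho>0" "\<rho>0 \<le> 1" using B C by (auto simp: \<rho>0_def)
    have "C * \<rho>0 \<le> C * (1 / (2 * B * C))" using C by (intro mult_left_mono) (auto simp: \<rho>0_def)
    then show "C * \<rho>0 \<le> 1 / (2 * B)" using C by simp
  qed
  have close: "norm (endpoint x0 \<eta> w - endpoint x0 \<eta> w' - lin_endpoint x0 (w - w')) \<le> 1 / (2 * B) * norm (w - w')"
    if "\<rho> \<le> \<rho>0" "norm \<eta> \<le> \<rho>" "norm (fst w) \<le> \<rho>" "norm (snd w) \<le> \<rho>" "norm (fst w') \<le> \<rho>" "norm (snd w') \<le> \<rho>"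
    for x0 \<eta> w w' \<rho>
  proof -
    have "norm (endpoint x0 \<eta> w - endpoint x0 \<eta> w' - lin_endpoint x0 (w - w')) \<le> C * \<rho> * norm (w - w')"
      using that \<rho>0 by (intro C(2)) auto
    also have "C * \<rho> \<le> C * \<rho>0" using that(1) C(1) by (intro mult_left_mono) auto
    then have "C * \<rho> * norm (w - w') \<le> 1 / (2 * B) * norm (w - w')"
      using \<rho>0(3) by (intro mult_right_mono norm_ge_zero) linarith
    finally show ?thesis .
  qed
  have scale: "0 < t / \<delta>" "t / \<delta> * \<delta> = t" "c / \<delta> * \<delta> = c" "norm ((t / \<delta>) *\<^sub>R y0) \<le> c / \<delta>"
    if "0 < t" "norm y0 \<le> c / t" for t c and y0 :: "real^'n"
    using that S.\<delta>(1) by (auto simp: field_simps)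
  have main: "diffeo_property g c t0" if c: "0 < c" "c \<le> \<rho>0 * \<delta>" for c t0
    unfolding diffeo_property_def
  proof (intro allI impI, elim conjE)
    fix x0 t and y0 :: "real^'n" assume t: "0 < t" "norm y0 \<le> c / t"
    note s = scale[OF t]
    have \<rho>: "0 < c / \<delta>" "c / \<delta> \<le> \<rho>0" using c S.\<delta>(1) by (auto simp: field_simps)
    have \<rho>1: "c / \<delta> \<le> 1" using \<rho>(2) \<rho>0(2) by linarith
    show "(\<forall>(q0, p0)\<in>polydisc c t. ham_exists g t x0 y0 q0 p0) \<and> diffeo_onto_image (polydisc c t) (XY_map g t x0 y0)"
      using diffeo_at_scale(1,2)[OF s(1) \<rho>(1) \<rho>1 s(4) B close[OF \<rho>(2) s(4)], of x0] unfolding s(2,3) by blast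
  qed
  show ?thesis
  proof (intro conjI allI impI)
    show "\<exists>c>0. \<exists>t0>0. diffeo_property g c t0"
      using main[of "\<rho>0 * \<delta>" 1] \<rho>0 S.\<delta>(1) by (intro exI[of _ "\<rho>0 * \<delta>"] conjI exI[of _ 1]) auto
    fix c t0 :: real assume ct: "0 < c" "0 < t0"
    define c' where "c' = min c (\<rho>0 * \<delta>)"
    have c': "0 < c'" "c' \<le> c" "c' \<le> \<rho>0 * \<delta>" using ct \<rho>0 S.\<delta>(1) by (auto simp: c'_def)
    \<comment> \<open>chosen so that \<open>r + r / \<delta>\<close> is the radius of the ball in the image at the reference time\<close>
    define r where "r = (c' / \<delta>)^3 / (4 * B) / (1 + 1 / \<delta>)"
    have r: "0 < r" using c' B S.\<delta>(1) by (simp add: r_def add_pos_pos)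
    have r': "r + r / \<delta> = (c' / \<delta>)^3 / (4 * B)"
    proof -
      have "r + r / \<delta> = r * (1 + 1 / \<delta>)" by (simp add: algebra_simps)
      moreover have "1 + 1 / \<delta> \<noteq> 0" using S.\<delta>(1) by (simp add: add_pos_pos less_imp_neq[symmetric])
      ultimately show ?thesis by (simp add: r_def)
    qed
    have "ball (flow_X g t x0 y0 0 0) r \<times> ball (flow_Y g t x0 y0 0 0) (r / t) \<subseteq> XY_map g t x0 y0 ` polydisc c' t"
      if t: "0 < t" "norm y0 \<le> c' / t" for x0 t and y0 :: "real^'n"
    proof clarify
      fix x y assume x: "x \<in> ball (flow_X g t x0 y0 0 0) r" and y: "y \<in> ball (flow_Y g t x0 y0 0 0) (r / t)"
      note s = scale[OF t]
      have \<rho>: "0 < c' / \<delta>" "c' / \<delta> \<le> \<rho>0" using c' S.\<delta>(1) by (auto simp: field_simps)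
      have \<rho>1: "c' / \<delta> \<le> 1" using \<rho>(2) \<rho>0(2) by linarith
      have "t / \<delta> * norm (y - flow_Y g t x0 y0 0 0) \<le> t / \<delta> * (r / t)"
        using y t S.\<delta>(1) by (intro mult_left_mono) (auto simp: dist_norm norm_minus_commute)
      then have "norm (x - flow_X g t x0 y0 0 0) + t / \<delta> * norm (y - flow_Y g t x0 y0 0 0) < (c' / \<delta>)^3 / (4 * B)"
        using x t r' by (simp add: dist_norm norm_minus_commute)
      then have xy: "norm (x - flow_X g (t / \<delta> * \<delta>) x0 y0 0 0) + t / \<delta> * norm (y - flow_Y g (t / \<delta> * \<delta>) x0 y0 0 0)
          < (c' / \<delta>)^3 / (4 * B)"
        unfolding s(2) .
      have "(x, y) \<in> XY_map g (t / \<delta> * \<delta>) x0 y0 ` polydisc (c' / \<delta> * \<delta>) (t / \<delta> * \<delta>)"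
        by (rule diffeo_at_scale(3)[OF s(1) \<rho>(1) \<rho>1 s(4) B close[OF \<rho>(2) s(4)] xy])
      then show "(x, y) \<in> XY_map g t x0 y0 ` polydisc c' t" unfolding s(2,3) .
    qed
    then show "\<exists>r>0. \<exists>c'\<in>{0<..c}. \<exists>t0'\<in>{0<..t0}. diffeo_property g c' t0' \<and>
        (\<forall>x0 t y0. 0 < t \<and> t \<le> t0' \<and> norm y0 \<le> c' / t \<longrightarrow>
          ball (flow_X g t x0 y0 0 0) r \<times> ball (flow_Y g t x0 y0 0 0) (r / t)
            \<subseteq> XY_map g t x0 y0 ` polydisc c' t)"
      using r c' ct main[OF c'(1,3)] by (intro exI[of _ r] conjI bexI[of _ c'] bexI[of _ t0]) auto
  qed
qed

end
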